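(* The mixed distributive law $\beta:TC\to CT$ gives rise to a comonad $\widetilde{\mathbf C}=\langle\widetilde C,\widetilde\varepsilon,\widetilde\delta\rangle$ on the category $\mathbf{ALG}^{\mathbf T}$ of $\mathbf T$-algebras which lifts $\mathbf C$, in the sense that the underlying functor $U^{\mathbf T}:\mathbf{ALG}^{\mathbf T}\to\mathbf{ALG}$ satisfies $$U^{\mathbf T}\widetilde C=CU^{\mathbf T},\qquad U^{\mathbf T}\widetilde\varepsilon=\varepsilon U^{\mathbf T},\qquad U^{\mathbf T}\widetilde\delta=\delta U^{\mathbf T}.$$ Similarly, $\beta$ gives rise to a monad $\widetilde{\mathbf T}=\langle\widetilde T,\widetilde\eta,\widetilde\mu\rangle$ on the category $\mathbf{ALG}_{\mathbf C}$ of $\mathbf C$-coalgebras which lifts $\mathbf T$, i.e. the underlying functor $V_{\mathbf C}:\mathbf{ALG}_{\mathbf C}\to\mathbf{ALG}$ satisfies $V_{\mathbf C}\widetilde T=TV_{\mathbf C}$, $V_{\mathbf C}\widetilde\eta=\eta V_{\mathbf C}$, $V_{\mathbf C}\widetilde\mu=\mu V_{\mathbf C}$. Furthermore, there is an isomorphism of categories $\Phi:(\mathbf{ALG}_{\mathbf C})^{\widetilde{\mathbf T}}\to(\mathbf{ALG}^{\mathbf T})_{\widetilde{\mathbf C}}$.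
   Context: Fix a commutative ring $\mathbf k$ with identity and $\lambda\in\mathbf k$. All algebras are commutative $\mathbf k$-algebras with identity, algebra homomorphisms preserve the identity, and tensor products are over $\mathbf k$. $\mathbf{ALG}$ is the category of such algebras; $\mathbb N=\{0,1,2,\dots\}$. A Rota-Baxter operator (of weight $\lambda$) on an algebra $R$ is a $\mathbf k$-linear $P:R\to R$ with $P(x)P(y)=P(xP(y))+P(yP(x))+\lambda P(xy)$ for all $x,y$; $(R,P)$ is then a Rota-Baxter algebra. Homomorphisms $(R,P)\to(S,Q)$ are algebra homomorphisms $f$ with $f\circ P=Q\circ f$. For an algebra $A$, $\mathrm{Sha}(A)=\bigoplus_{i\ge1}A^{\otimes i}$ as a module, with product $\diamond$ defined for $\mathfrak a=a_0\otimes\cdots\otimes a_m$, $\mathfrak b=b_0\otimes\cdots\otimes b_n$ by: $\mathfrak a\diamond\mathfrak b=a_0b_0\otimes b_1\otimes\cdots\otimes b_n$ if $m=0$; $\mathfrak a\diamond\mathfrak b=a_0b_0\otimes a_1\otimes\cdots\otimes a_m$ if $n=0$; and, if $m,n>0$, recursively, $\mathfrak a\diamond\mathfrak b=(a_0b_0)\otimes\big((a_1\otimes\cdots\otimes a_m)\diamond(\mathbf 1_A\otimes b_1\otimes\cdots\otimes b_n)+(\mathbf 1_A\otimes a_1\otimes\cdots\otimes a_m)\diamond(b_1\otimes\cdots\otimes b_n)+\lambda(a_1\otimes\cdots\otimes a_m)\diamond(b_1\otimes\cdots\otimes b_n)\big)$. $P_A(x_0\otimes\cdots\otimes x_n)=\mathbf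 1_A\otimes x_0\otimes\cdots\otimes x_n$. It is known that $(\mathrm{Sha}(A),P_A)$ with the inclusion $\eta_A:A\to\mathrm{Sha}(A)$ is the free Rota-Baxter algebra on $A$. Monad $\mathbf T=\langle T,\eta,\mu\rangle$ on $\mathbf{ALG}$: $T(A)=\mathrm{Sha}(A)$, $T(\varphi)=\mathrm{Sha}(\varphi)$ applies $\varphi$ to each tensor factor, $\mu_A(w_0\otimes\cdots\otimes w_k)=w_0P_A(w_1P_A(\cdots P_A(w_k)\cdots))$ for $w_i\in\mathrm{Sha}(A)$. $\mathbf{ALG}^{\mathbf T}$ is its category of algebras $\langle A,h\rangle$, $h:\mathrm{Sha}(A)\to A$. $A^{\mathbb N}$ is the algebra of all functions $\mathbb N\to A$ with the product $(fg)(n)=\sum_{k=0}^n\sum_{j=0}^{n-k}\binom nk\binom{n-k}j\lambda^kf(n-j)g(k+j)$; for $h:A\to B$, $h^{\mathbb N}(f)(n)=h(f(n))$. Comonad $\mathbf C=\langle C,\varepsilon,\delta\rangle$ on $\mathbf{ALG}$: $C(A)=A^{\mathbb N}$, $C(h)=h^{\mathbb N}$, $\varepsilon_A(f)=f(0)$, $(\delta_A(f)(m))(n)=f(m+n)$. $\mathbf{ALG}_{\mathbf C}$ is its category of coalgebras $\langle A,f\rangle$, $f:A\to A^{\mathbb N}$. If $P$ is a Rota-Baxter operator on $A$, then $\widetilde P(f)(0)=P(f(0))$, $\widetilde P(f)(n)=f(n-1)$ ($n\ge1$) defines a Rota-Baxter operator $\widetilde P$ on $A^{\mathbb N}$. The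 map $\beta_A:(\mathrm{Sha}(A^{\mathbb N}),P_{A^{\mathbb N}})\to((\mathrm{Sha}(A))^{\mathbb N},\widetilde{P_A})$ is the unique Rota-Baxter algebra homomorphism with $\beta_A\circ\eta_{A^{\mathbb N}}=(\eta_A)^{\mathbb N}$. The $\beta_A$ form a mixed distributive law $\beta:TC\to CT$ of $\mathbf T$ over $\mathbf C$, i.e. $\beta$ is natural and $\beta\circ\eta C=C\eta$, $\varepsilon T\circ\beta=T\varepsilon$, $\delta T\circ\beta=C\beta\circ\beta C\circ T\delta$, $\beta\circ\mu C=C\mu\circ\beta T\circ T\beta$. The comonad and monad that $\beta$ gives rise to are: $\widetilde C\langle A,h\rangle=\langle A^{\mathbb N},h^{\mathbb N}\circ\beta_A\rangle$, $\widetilde\varepsilon_{\langle A,h\rangle}=\varepsilon_A$, $\widetilde\delta_{\langle A,h\rangle}=\delta_A$; and $\widetilde T\langle A,f\rangle=\langle\mathrm{Sha}(A),\beta_A\circ\mathrm{Sha}(f)\rangle$, $\widetilde\eta_{\langle A,f\rangle}=\eta_A$, $\widetilde\mu_{\langle A,f\rangle}=\mu_A$ (on morphisms $\widetilde C$ and $\widetilde T$ act as $C$ and $T$). $(\mathbf{ALG}_{\mathbf C})^{\widetilde{\mathbf T}}$ is the category of $\widetilde{\mathbf T}$-algebras and $(\mathbf{ALG}^{\mathbf T})_{\widetilde{\mathbf C}}$ the category of $\widetilde{\mathbf C}$-coalgebras. *)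

theory Defs
  imports "HOL-Algebra.Module" "HOL-Library.FuncSet"
begin

section \<open>Categories, monads, comonads and mixed distributive laws\<close>

record ('o, 'm) cat =
  Obj :: "'o set"
  Arr :: "'m set"
  Src :: "'m \<Rightarrow> 'o"
  Tgt :: "'m \<Rightarrow> 'o"
  Ident :: "'o \<Rightarrow> 'm"
  Cmp :: "'m \<Rightarrow> 'm \<Rightarrow> 'm"  \<comment> \<open>\<open>Cmp X g f\<close> is \<open>g\<close> after \<open>f\<close>\<close>

definition Homs :: "('o, 'm) cat \<Rightarrow> 'o \<Rightarrow> 'o \<Rightarrow> 'm set" where
  "Homs X a b = {f \<in> Arr X. Src X f = a \<and> Tgt X f = b}"

locale category =
  fixes X :: "('o, 'm) cat"
  assumes src: "f \<in> Arr X \<Longrightarrow> Src X f \<in> Obj X"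
    and tgt: "f \<in> Arr X \<Longrightarrow> Tgt X f \<in> Obj X"
    and ident: "a \<in> Obj X \<Longrightarrow> Ident X a \<in> Homs X a a"
    and cmp: "\<lbrakk>f \<in> Homs X a b; g \<in> Homs X b c\<rbrakk> \<Longrightarrow> Cmp X g f \<in> Homs X a c"
    and ident_right: "f \<in> Homs X a b \<Longrightarrow> Cmp X f (Ident X a) = f"
    and ident_left: "f \<in> Homs X a b \<Longrightarrow> Cmp X (Ident X b) f = f"
    and assoc: "\<lbrakk>f \<in> Homs X a b; g \<in> Homs X b c; h \<in> Homs X c d\<rbrakk>
      \<Longrightarrow> Cmp X h (Cmp X g f) = Cmp X (Cmp X h g) f"

record ('o, 'm, 'p, 'n) func =
  FO :: "'o \<Rightarrow> 'p"
  FA :: "'m \<Rightarrow> 'n"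

definition is_functor :: "('o, 'm) cat \<Rightarrow> ('p, 'n) cat \<Rightarrow> ('o, 'm, 'p, 'n) func \<Rightarrow> bool" where
  "is_functor X Y F \<longleftrightarrow> category X \<and> category Y
     \<and> (\<forall>a\<in>Obj X. FO F a \<in> Obj Y)
     \<and> (\<forall>f\<in>Arr X. FA F f \<in> Homs Y (FO F (Src X f)) (FO F (Tgt X f)))
     \<and> (\<forall>a\<in>Obj X. FA F (Ident X a) = Ident Y (FO F a))
     \<and> (\<forall>f\<in>Arr X. \<forall>g\<in>Arr X. Src X g = Tgt X f \<longrightarrow>
          FA F (Cmp X g f) = Cmp Y (FA F g) (FA F f))"

text \<open>Functors and transformations carry irrelevant values outside their source category, so
  they are compared on its objects and arrows only.\<close>

definition functor_eq ::
    "('o, 'm) cat \<Rightarrow> ('o, 'm, 'p, 'n) func \<Rightarrow> ('o, 'm, 'p, 'n) func \<Rightarrow> bool" where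
  "functor_eq X F G \<longleftrightarrow>
     (\<forall>a\<in>Obj X. FO F a = FO G a) \<and> (\<forall>f\<in>Arr X. FA F f = FA G f)"

definition trans_eq :: "('o, 'm) cat \<Rightarrow> ('o \<Rightarrow> 'n) \<Rightarrow> ('o \<Rightarrow> 'n) \<Rightarrow> bool" where
  "trans_eq X s t \<longleftrightarrow> (\<forall>a\<in>Obj X. s a = t a)"

definition id_func :: "('o, 'm, 'o, 'm) func" where
  "id_func = \<lparr>FO = \<lambda>a. a, FA = \<lambda>f. f\<rparr>"

definition comp_func ::
    "('p, 'n, 'q, 'l) func \<Rightarrow> ('o, 'm, 'p, 'n) func \<Rightarrow> ('o, 'm, 'q, 'l) func"
    (infixr \<open>\<circ>\<^sub>F\<close> 70) where
  "G \<circ>\<^sub>F F = \<lparr>FO = \<lambda>a. FO G (FO F a), FA = \<lambda>f. FA G (FA F f)\<rparr>"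

definition whisker_left :: "('p, 'n, 'q, 'l) func \<Rightarrow> ('o \<Rightarrow> 'n) \<Rightarrow> 'o \<Rightarrow> 'l" where
  "whisker_left G s = (\<lambda>a. FA G (s a))"

definition whisker_right :: "('p \<Rightarrow> 'l) \<Rightarrow> ('o, 'm, 'p, 'n) func \<Rightarrow> 'o \<Rightarrow> 'l" where
  "whisker_right s F = (\<lambda>a. s (FO F a))"

definition iso_functor :: "('o, 'm) cat \<Rightarrow> ('p, 'n) cat \<Rightarrow> ('o, 'm, 'p, 'n) func \<Rightarrow> bool" where
  "iso_functor X Y F \<longleftrightarrow> is_functor X Y F \<and>
     (\<exists>G. is_functor Y X G \<and> functor_eq X (G \<circ>\<^sub>F F) id_func \<and> functor_eq Y (F \<circ>\<^sub>F G) id_func)"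

definition nat_trans :: "('o, 'm) cat \<Rightarrow> ('p, 'n) cat \<Rightarrow> ('o, 'm, 'p, 'n) func \<Rightarrow>
    ('o, 'm, 'p, 'n) func \<Rightarrow> ('o \<Rightarrow> 'n) \<Rightarrow> bool" where
  "nat_trans X Y F G t \<longleftrightarrow> is_functor X Y F \<and> is_functor X Y G
     \<and> (\<forall>a\<in>Obj X. t a \<in> Homs Y (FO F a) (FO G a))
     \<and> (\<forall>f\<in>Arr X. Cmp Y (t (Tgt X f)) (FA F f) = Cmp Y (FA G f) (t (Src X f)))"

record ('o, 'm) mnd =
  MF :: "('o, 'm, 'o, 'm) func"
  unit :: "'o \<Rightarrow> 'm"
  mu :: "'o \<Rightarrow> 'm"

record ('o, 'm) cmnd =
  CF :: "('o, 'm, 'o, 'm) func"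
  counit :: "'o \<Rightarrow> 'm"
  delta :: "'o \<Rightarrow> 'm"

definition monad :: "('o, 'm) cat \<Rightarrow> ('o, 'm) mnd \<Rightarrow> bool" where
  "monad X T \<longleftrightarrow>
     nat_trans X X id_func (MF T) (unit T) \<and> nat_trans X X (MF T \<circ>\<^sub>F MF T) (MF T) (mu T)
     \<and> (\<forall>a\<in>Obj X.
          Cmp X (mu T a) (unit T (FO (MF T) a)) = Ident X (FO (MF T) a)
        \<and> Cmp X (mu T a) (FA (MF T) (unit T a)) = Ident X (FO (MF T) a)
        \<and> Cmp X (mu T a) (mu T (FO (MF T) a)) = Cmp X (mu T a) (FA (MF T) (mu T a)))"

definition comonad :: "('o, 'm) cat \<Rightarrow> ('o, 'm) cmnd \<Rightarrow> bool" where
  "comonad X C \<longleftrightarrow>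
     nat_trans X X (CF C) id_func (counit C) \<and> nat_trans X X (CF C) (CF C \<circ>\<^sub>F CF C) (delta C)
     \<and> (\<forall>a\<in>Obj X.
          Cmp X (counit C (FO (CF C) a)) (delta C a) = Ident X (FO (CF C) a)
        \<and> Cmp X (FA (CF C) (counit C a)) (delta C a) = Ident X (FO (CF C) a)
        \<and> Cmp X (delta C (FO (CF C) a)) (delta C a) = Cmp X (FA (CF C) (delta C a)) (delta C a))"

definition mixed_distributive_law ::
    "('o, 'm) cat \<Rightarrow> ('o, 'm) mnd \<Rightarrow> ('o, 'm) cmnd \<Rightarrow> ('o \<Rightarrow> 'm) \<Rightarrow> bool" where
  "mixed_distributive_law X T C \<beta> \<longleftrightarrow>
     monad X T \<and> comonad X C \<and> nat_trans X X (MF T \<circ>\<^sub>F CF C) (CF C \<circ>\<^sub>F MF T) \<beta>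
     \<and> (\<forall>a\<in>Obj X.
          Cmp X (\<beta> a) (unit T (FO (CF C) a)) = FA (CF C) (unit T a)
        \<and> Cmp X (counit C (FO (MF T) a)) (\<beta> a) = FA (MF T) (counit C a)
        \<and> Cmp X (delta C (FO (MF T) a)) (\<beta> a) =
            Cmp X (FA (CF C) (\<beta> a)) (Cmp X (\<beta> (FO (CF C) a)) (FA (MF T) (delta C a)))
        \<and> Cmp X (\<beta> a) (mu T (FO (CF C) a)) =
            Cmp X (FA (CF C) (mu T a)) (Cmp X (\<beta> (FO (MF T) a)) (FA (MF T) (\<beta> a))))"

text \<open>The category of \<open>T\<close>-algebras. An arrow is a triple (source, underlying arrow, target).\<close>

type_synonym ('o, 'm) str = "'o \<times> 'm"
type_synonym ('o, 'm) str_arr = "('o, 'm) str \<times> 'm \<times> ('o, 'm) str"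

definition alg_objs :: "('o, 'm) cat \<Rightarrow> ('o, 'm) mnd \<Rightarrow> ('o, 'm) str set" where
  "alg_objs X T = {(a, h). a \<in> Obj X \<and> h \<in> Homs X (FO (MF T) a) a
     \<and> Cmp X h (unit T a) = Ident X a
     \<and> Cmp X h (mu T a) = Cmp X h (FA (MF T) h)}"

definition algebras :: "('o, 'm) cat \<Rightarrow> ('o, 'm) mnd \<Rightarrow> (('o, 'm) str, ('o, 'm) str_arr) cat" where
  "algebras X T = \<lparr>
     Obj = alg_objs X T,
     Arr = {((a, h), f, (b, k)). (a, h) \<in> alg_objs X T \<and> (b, k) \<in> alg_objs X T
              \<and> f \<in> Homs X a b \<and> Cmp X f h = Cmp X k (FA (MF T) f)},
     Src = (\<lambda>(s, f, t). s),
     Tgt = (\<lambda>(s, f, t). t),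
     Ident = (\<lambda>(a, h). ((a, h), Ident X a, (a, h))),
     Cmp = (\<lambda>(s', g, t') (s, f, t). (s, Cmp X g f, t'))\<rparr>"

definition coalg_objs :: "('o, 'm) cat \<Rightarrow> ('o, 'm) cmnd \<Rightarrow> ('o, 'm) str set" where
  "coalg_objs X C = {(a, f). a \<in> Obj X \<and> f \<in> Homs X a (FO (CF C) a)
     \<and> Cmp X (counit C a) f = Ident X a
     \<and> Cmp X (delta C a) f = Cmp X (FA (CF C) f) f}"

definition coalgebras :: "('o, 'm) cat \<Rightarrow> ('o, 'm) cmnd \<Rightarrow> (('o, 'm) str, ('o, 'm) str_arr) cat" where
  "coalgebras X C = \<lparr>
     Obj = coalg_objs X C,
     Arr = {((a, h), f, (b, k)). (a, h) \<in> coalg_objs X C \<and> (b, k) \<in> coalg_objs X C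
              \<and> f \<in> Homs X a b \<and> Cmp X k f = Cmp X (FA (CF C) f) h},
     Src = (\<lambda>(s, f, t). s),
     Tgt = (\<lambda>(s, f, t). t),
     Ident = (\<lambda>(a, h). ((a, h), Ident X a, (a, h))),
     Cmp = (\<lambda>(s', g, t') (s, f, t). (s, Cmp X g f, t'))\<rparr>"

text \<open>The underlying functor, both for algebras (\<open>U\<close>) and for coalgebras (\<open>V\<close>).\<close>

definition underlying :: "(('o, 'm) str, ('o, 'm) str_arr, 'o, 'm) func" where
  "underlying = \<lparr>FO = fst, FA = (\<lambda>(s, f, t). f)\<rparr>"

definition lift_comonad_obj ::
    "('o, 'm) cat \<Rightarrow> ('o, 'm) cmnd \<Rightarrow> ('o \<Rightarrow> 'm) \<Rightarrow> ('o, 'm) str \<Rightarrow> ('o, 'm) str" where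
  "lift_comonad_obj X C \<beta> = (\<lambda>(a, h). (FO (CF C) a, Cmp X (FA (CF C) h) (\<beta> a)))"

definition lift_comonad ::
    "('o, 'm) cat \<Rightarrow> ('o, 'm) cmnd \<Rightarrow> ('o \<Rightarrow> 'm) \<Rightarrow> (('o, 'm) str, ('o, 'm) str_arr) cmnd" where
  "lift_comonad X C \<beta> = (let L = lift_comonad_obj X C \<beta> in \<lparr>
     CF = \<lparr>FO = L, FA = (\<lambda>(s, f, t). (L s, FA (CF C) f, L t))\<rparr>,
     counit = (\<lambda>(a, h). (L (a, h), counit C a, (a, h))),
     delta = (\<lambda>(a, h). (L (a, h), delta C a, L (L (a, h))))\<rparr>)"

definition lift_monad_obj ::
    "('o, 'm) cat \<Rightarrow> ('o, 'm) mnd \<Rightarrow> ('o \<Rightarrow> 'm) \<Rightarrow> ('o, 'm) str \<Rightarrow> ('o, 'm) str" where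
  "lift_monad_obj X T \<beta> = (\<lambda>(a, f). (FO (MF T) a, Cmp X (\<beta> a) (FA (MF T) f)))"

definition lift_monad ::
    "('o, 'm) cat \<Rightarrow> ('o, 'm) mnd \<Rightarrow> ('o \<Rightarrow> 'm) \<Rightarrow> (('o, 'm) str, ('o, 'm) str_arr) mnd" where
  "lift_monad X T \<beta> = (let L = lift_monad_obj X T \<beta> in \<lparr>
     MF = \<lparr>FO = L, FA = (\<lambda>(s, f, t). (L s, FA (MF T) f, L t))\<rparr>,
     unit = (\<lambda>(a, f). ((a, f), unit T a, L (a, f))),
     mu = (\<lambda>(a, f). (L (L (a, f)), mu T a, L (a, f)))\<rparr>)"


section \<open>The category of commutative algebras\<close>

text \<open>HOL has no type of all sets, so the algebras in question are those whose elements are drawn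
  from a universe, as is usual for size reasons. The universe is a type over arbitrary atoms that
  is closed under sequences and under formal linear combinations of words, so that both
  \<open>A \<mapsto> A\<^sup>\<nat>\<close> and \<open>A \<mapsto> Sha(A)\<close> are endofunctors. Through \<open>Atom\<close>, every algebra with
  carrier in an arbitrary type is isomorphic to one in the universe over that type.\<close>

datatype ('k, 'a) univ =
    Atom 'a
  | Seq (un_Seq: "nat \<Rightarrow> ('k, 'a) univ")
  | Ten (un_Ten: "('k \<times> ('k, 'a) univ list) list")

type_synonym ('k, 'a) alg = "('k, ('k, 'a) univ) module"
type_synonym ('k, 'a) alg_arr =
  "('k, 'a) alg \<times> (('k, 'a) univ \<Rightarrow> ('k, 'a) univ) \<times> ('k, 'a) alg"

definition alg_hom ::
    "('k, 'z) ring_scheme \<Rightarrow> ('k, 'b) module \<Rightarrow> ('k, 'c) module \<Rightarrow> ('b \<Rightarrow> 'c) set" where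
  "alg_hom K A B = {f \<in> ring_hom A B.
     \<forall>c\<in>carrier K. \<forall>x\<in>carrier A. f (c \<odot>\<^bsub>A\<^esub> x) = c \<odot>\<^bsub>B\<^esub> f x}"

text \<open>Underlying maps are required to be \<open>extensional\<close>, so that arrows are equal iff they agree
  on the carrier. The library locale \<open>algebra\<close> is that of commutative algebras with identity.\<close>

definition ALG :: "('k, 'z) ring_scheme \<Rightarrow> (('k, 'a) alg, ('k, 'a) alg_arr) cat" where
  "ALG K = \<lparr>
     Obj = {A. algebra K A},
     Arr = {(A, f, B). algebra K A \<and> algebra K B \<and> f \<in> alg_hom K A B \<inter> extensional (carrier A)},
     Src = (\<lambda>(A, f, B). A),
     Tgt = (\<lambda>(A, f, B). B),
     Ident = (\<lambda>A. (A, restrict (\<lambda>x. x) (carrier A), A)),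
     Cmp = (\<lambda>(A', g, B') (A, f, B). (A, compose (carrier A) g f, B'))\<rparr>"


section \<open>Rota-Baxter algebras\<close>

definition rota_baxter ::
    "('k, 'z) ring_scheme \<Rightarrow> 'k \<Rightarrow> ('k, 'b) module \<Rightarrow> ('b \<Rightarrow> 'b) \<Rightarrow> bool" where
  "rota_baxter K lam R P \<longleftrightarrow> algebra K R \<and> P \<in> carrier R \<rightarrow> carrier R
     \<and> (\<forall>x\<in>carrier R. \<forall>y\<in>carrier R. P (x \<oplus>\<^bsub>R\<^esub> y) = P x \<oplus>\<^bsub>R\<^esub> P y)
     \<and> (\<forall>c\<in>carrier K. \<forall>x\<in>carrier R. P (c \<odot>\<^bsub>R\<^esub> x) = c \<odot>\<^bsub>R\<^esub> P x)
     \<and> (\<forall>x\<in>carrier R. \<forall>y\<in>carrier R.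
          P x \<otimes>\<^bsub>R\<^esub> P y =
            P (x \<otimes>\<^bsub>R\<^esub> P y) \<oplus>\<^bsub>R\<^esub> P (y \<otimes>\<^bsub>R\<^esub> P x) \<oplus>\<^bsub>R\<^esub> lam \<odot>\<^bsub>R\<^esub> P (x \<otimes>\<^bsub>R\<^esub> y))"

definition rota_baxter_hom :: "('k, 'z) ring_scheme \<Rightarrow> 'k \<Rightarrow> ('k, 'b) module \<Rightarrow> ('b \<Rightarrow> 'b) \<Rightarrow>
    ('k, 'c) module \<Rightarrow> ('c \<Rightarrow> 'c) \<Rightarrow> ('b \<Rightarrow> 'c) set" where
  "rota_baxter_hom K lam R P S Q = {f \<in> alg_hom K R S.
     rota_baxter K lam R P \<and> rota_baxter K lam S Q \<and> (\<forall>x\<in>carrier R. f (P x) = Q (f x))}"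


section \<open>The free Rota-Baxter algebra\<close>

text \<open>A formal sum \<open>[(c\<^sub>1, w\<^sub>1), \<dots>]\<close> stands for \<open>c\<^sub>1 w\<^sub>1 + \<dots>\<close>, where the nonempty word
  \<open>[a\<^sub>0, \<dots>, a\<^sub>n]\<close> denotes the pure tensor \<open>a\<^sub>0 \<otimes> \<dots> \<otimes> a\<^sub>n\<close>.\<close>

definition formal_sums :: "('k, 'z) ring_scheme \<Rightarrow> ('k, 'b) module \<Rightarrow> ('k \<times> 'b list) list set" where
  "formal_sums K A = lists (carrier K \<times> (lists (carrier A) - {[]}))"

text \<open>The rules up to \<open>coeff_zero\<close> present the free module on the nonempty words; \<open>slot_add\<close> and
  \<open>slot_smult\<close> impose multilinearity. The latter preserve the length of words, so the quotient is
  the direct sum over \<open>i \<ge> 1\<close> of the tensor powers \<open>A\<^bsup>\<otimes>i\<^esup>\<close>.\<close>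

inductive tensor_eq ::
    "('k, 'z) ring_scheme \<Rightarrow> ('k, 'b) module \<Rightarrow> ('k \<times> 'b list) list \<Rightarrow> ('k \<times> 'b list) list \<Rightarrow> bool"
  for K :: "('k, 'z) ring_scheme" and A :: "('k, 'b) module" where
  refl: "xs \<in> formal_sums K A \<Longrightarrow> tensor_eq K A xs xs"
| sym: "tensor_eq K A xs ys \<Longrightarrow> tensor_eq K A ys xs"
| trans: "\<lbrakk>tensor_eq K A xs ys; tensor_eq K A ys zs\<rbrakk> \<Longrightarrow> tensor_eq K A xs zs"
| append: "\<lbrakk>tensor_eq K A xs xs'; tensor_eq K A ys ys'\<rbrakk> \<Longrightarrow> tensor_eq K A (xs @ ys) (xs' @ ys')"
| commute: "\<lbrakk>xs \<in> formal_sums K A; ys \<in> formal_sums K A\<rbrakk> \<Longrightarrow> tensor_eq K A (xs @ ys) (ys @ xs)"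
| coeff_add: "\<lbrakk>c \<in> carrier K; d \<in> carrier K; w \<in> lists (carrier A); w \<noteq> []\<rbrakk>
    \<Longrightarrow> tensor_eq K A [(c \<oplus>\<^bsub>K\<^esub> d, w)] [(c, w), (d, w)]"
| coeff_zero: "\<lbrakk>w \<in> lists (carrier A); w \<noteq> []\<rbrakk> \<Longrightarrow> tensor_eq K A [(\<zero>\<^bsub>K\<^esub>, w)] []"
| slot_add: "\<lbrakk>c \<in> carrier K; u \<in> lists (carrier A); v \<in> lists (carrier A);
     a \<in> carrier A; b \<in> carrier A\<rbrakk>
    \<Longrightarrow> tensor_eq K A [(c, u @ (a \<oplus>\<^bsub>A\<^esub> b) # v)] [(c, u @ a # v), (c, u @ b # v)]"
| slot_smult: "\<lbrakk>c \<in> carrier K; r \<in> carrier K; u \<in> lists (carrier A); v \<in> lists (carrier A);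
     a \<in> carrier A\<rbrakk>
    \<Longrightarrow> tensor_eq K A [(c, u @ (r \<odot>\<^bsub>A\<^esub> a) # v)] [(c \<otimes>\<^bsub>K\<^esub> r, u @ a # v)]"

text \<open>An element of \<open>Sha(A)\<close> is encoded by a chosen representative of its \<open>tensor_eq\<close>-class, as the
  universe contains formal sums but not sets of them. The choice depends on the class only, so
  \<open>cls K A xs = cls K A ys\<close> iff the formal sums \<open>xs\<close> and \<open>ys\<close> are tensor-equal.\<close>

definition cls :: "('k, 'z) ring_scheme \<Rightarrow> ('k, 'a) alg \<Rightarrow>
    ('k \<times> ('k, 'a) univ list) list \<Rightarrow> ('k, 'a) univ" where
  "cls K A xs = Ten (SOME ys. tensor_eq K A xs ys)"

definition scale :: "('k, 'z) ring_scheme \<Rightarrow> 'k \<Rightarrow> ('k \<times> 'b list) list \<Rightarrow> ('k \<times> 'b list) list" where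
  "scale K c xs = map (\<lambda>(d, w). (c \<otimes>\<^bsub>K\<^esub> d, w)) xs"

definition prefix_factor :: "'b \<Rightarrow> ('k \<times> 'b list) list \<Rightarrow> ('k \<times> 'b list) list" where
  "prefix_factor a xs = map (\<lambda>(d, w). (d, a # w)) xs"

text \<open>The product \<open>\<diamond>\<close> of two pure tensors; the equations for empty words are irrelevant.\<close>

function diamond :: "('k, 'z) ring_scheme \<Rightarrow> 'k \<Rightarrow> ('k, 'b) module \<Rightarrow>
    'b list \<Rightarrow> 'b list \<Rightarrow> ('k \<times> 'b list) list" where
  "diamond K lam A [] bs = []"
| "diamond K lam A (a # as) [] = []"
| "diamond K lam A [a] (b # bs) = [(\<one>\<^bsub>K\<^esub>, (a \<otimes>\<^bsub>A\<^esub> b) # bs)]"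
| "diamond K lam A (a # a' # as) [b] = [(\<one>\<^bsub>K\<^esub>, (a \<otimes>\<^bsub>A\<^esub> b) # a' # as)]"
| "diamond K lam A (a # a' # as) (b # b' # bs) = prefix_factor (a \<otimes>\<^bsub>A\<^esub> b)
     (diamond K lam A (a' # as) (\<one>\<^bsub>A\<^esub> # b' # bs)
      @ diamond K lam A (\<one>\<^bsub>A\<^esub> # a' # as) (b' # bs)
      @ scale K lam (diamond K lam A (a' # as) (b' # bs)))"
  by pat_completeness auto
termination
  by (relation "measure (\<lambda>(K, lam, A, as, bs). length as + length bs)") auto

definition diamond_sums :: "('k, 'z) ring_scheme \<Rightarrow> 'k \<Rightarrow> ('k, 'b) module \<Rightarrow>
    ('k \<times> 'b list) list \<Rightarrow> ('k \<times> 'b list) list \<Rightarrow> ('k \<times> 'b list) list" where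
  "diamond_sums K lam A xs ys =
     concat (map (\<lambda>(c, u). concat (map (\<lambda>(d, v). scale K (c \<otimes>\<^bsub>K\<^esub> d) (diamond K lam A u v)) ys)) xs)"

definition Sha :: "('k, 'z) ring_scheme \<Rightarrow> 'k \<Rightarrow> ('k, 'a) alg \<Rightarrow> ('k, 'a) alg" where
  "Sha K lam A = \<lparr>
     carrier = cls K A ` formal_sums K A,
     mult = (\<lambda>x y. cls K A (diamond_sums K lam A (un_Ten x) (un_Ten y))),
     one = cls K A [(\<one>\<^bsub>K\<^esub>, [\<one>\<^bsub>A\<^esub>])],
     zero = cls K A [],
     add = (\<lambda>x y. cls K A (un_Ten x @ un_Ten y)),
     smult = (\<lambda>c x. cls K A (scale K c (un_Ten x)))\<rparr>"

definition Sha_P :: "('k, 'z) ring_scheme \<Rightarrow> ('k, 'a) alg \<Rightarrow> ('k, 'a) univ \<Rightarrow> ('k, 'a) univ" where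
  "Sha_P K A x = cls K A (prefix_factor \<one>\<^bsub>A\<^esub> (un_Ten x))"

definition Sha_map :: "('k, 'z) ring_scheme \<Rightarrow> 'k \<Rightarrow> ('k, 'a) alg_arr \<Rightarrow> ('k, 'a) alg_arr" where
  "Sha_map K lam = (\<lambda>(A, f, B). (Sha K lam A,
     (\<lambda>x\<in>carrier (Sha K lam A). cls K B (map (\<lambda>(c, w). (c, map f w)) (un_Ten x))),
     Sha K lam B))"

definition Sha_unit :: "('k, 'z) ring_scheme \<Rightarrow> 'k \<Rightarrow> ('k, 'a) alg \<Rightarrow> ('k, 'a) alg_arr" where
  "Sha_unit K lam A = (A, (\<lambda>a\<in>carrier A. cls K A [(\<one>\<^bsub>K\<^esub>, [a])]), Sha K lam A)"

text \<open>\<open>nested_P R P [w\<^sub>0, \<dots>, w\<^sub>k]\<close> is \<open>w\<^sub>0 P (w\<^sub>1 P (\<dots> P w\<^sub>k \<dots>))\<close>.\<close>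

fun nested_P :: "('k, 'b) module \<Rightarrow> ('b \<Rightarrow> 'b) \<Rightarrow> 'b list \<Rightarrow> 'b" where
  "nested_P R P [] = \<one>\<^bsub>R\<^esub>"
| "nested_P R P [w] = w"
| "nested_P R P (w # w' # ws) = w \<otimes>\<^bsub>R\<^esub> P (nested_P R P (w' # ws))"

definition linear_ext :: "('k, 'b) module \<Rightarrow> ('c \<Rightarrow> 'b) \<Rightarrow> ('k \<times> 'c) list \<Rightarrow> 'b" where
  "linear_ext R g xs = foldr (\<lambda>(c, w) s. (c \<odot>\<^bsub>R\<^esub> g w) \<oplus>\<^bsub>R\<^esub> s) xs \<zero>\<^bsub>R\<^esub>"

definition Sha_mu :: "('k, 'z) ring_scheme \<Rightarrow> 'k \<Rightarrow> ('k, 'a) alg \<Rightarrow> ('k, 'a) alg_arr" where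
  "Sha_mu K lam A = (Sha K lam (Sha K lam A),
     (\<lambda>x\<in>carrier (Sha K lam (Sha K lam A)).
        linear_ext (Sha K lam A) (nested_P (Sha K lam A) (Sha_P K A)) (un_Ten x)),
     Sha K lam A)"

definition Sha_monad :: "('k, 'z) ring_scheme \<Rightarrow> 'k \<Rightarrow> (('k, 'a) alg, ('k, 'a) alg_arr) mnd" where
  "Sha_monad K lam = \<lparr>
     MF = \<lparr>FO = Sha K lam, FA = Sha_map K lam\<rparr>,
     unit = Sha_unit K lam,
     mu = Sha_mu K lam\<rparr>"


section \<open>The algebra of sequences\<close>

definition Seq_mult :: "'k \<Rightarrow> ('k, 'z) ring_scheme \<Rightarrow> ('k, 'b) module \<Rightarrow>
    (nat \<Rightarrow> 'b) \<Rightarrow> (nat \<Rightarrow> 'b) \<Rightarrow> nat \<Rightarrow> 'b" where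
  "Seq_mult lam K A f g n =
     (\<Oplus>\<^bsub>A\<^esub>k\<in>{0..n}. \<Oplus>\<^bsub>A\<^esub>j\<in>{0..n - k}.
        add_pow A ((n choose k) * ((n - k) choose j))
          ((lam [^]\<^bsub>K\<^esub> k) \<odot>\<^bsub>A\<^esub> (f (n - j) \<otimes>\<^bsub>A\<^esub> g (k + j))))"

definition Seqs :: "('k, 'z) ring_scheme \<Rightarrow> 'k \<Rightarrow> ('k, 'a) alg \<Rightarrow> ('k, 'a) alg" where
  "Seqs K lam A = \<lparr>
     carrier = Seq ` {f. \<forall>n. f n \<in> carrier A},
     mult = (\<lambda>x y. Seq (Seq_mult lam K A (un_Seq x) (un_Seq y))),
     one = Seq (\<lambda>n. if n = 0 then \<one>\<^bsub>A\<^esub> else \<zero>\<^bsub>A\<^esub>),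
     zero = Seq (\<lambda>n. \<zero>\<^bsub>A\<^esub>),
     add = (\<lambda>x y. Seq (\<lambda>n. un_Seq x n \<oplus>\<^bsub>A\<^esub> un_Seq y n)),
     smult = (\<lambda>c x. Seq (\<lambda>n. c \<odot>\<^bsub>A\<^esub> un_Seq x n))\<rparr>"

definition Seqs_map :: "('k, 'z) ring_scheme \<Rightarrow> 'k \<Rightarrow> ('k, 'a) alg_arr \<Rightarrow> ('k, 'a) alg_arr" where
  "Seqs_map K lam = (\<lambda>(A, h, B). (Seqs K lam A,
     (\<lambda>x\<in>carrier (Seqs K lam A). Seq (\<lambda>n. h (un_Seq x n))),
     Seqs K lam B))"

definition Seqs_counit :: "('k, 'z) ring_scheme \<Rightarrow> 'k \<Rightarrow> ('k, 'a) alg \<Rightarrow> ('k, 'a) alg_arr" where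
  "Seqs_counit K lam A = (Seqs K lam A, (\<lambda>x\<in>carrier (Seqs K lam A). un_Seq x 0), A)"

definition Seqs_delta :: "('k, 'z) ring_scheme \<Rightarrow> 'k \<Rightarrow> ('k, 'a) alg \<Rightarrow> ('k, 'a) alg_arr" where
  "Seqs_delta K lam A = (Seqs K lam A,
     (\<lambda>x\<in>carrier (Seqs K lam A). Seq (\<lambda>m. Seq (\<lambda>n. un_Seq x (m + n)))),
     Seqs K lam (Seqs K lam A))"

definition Seqs_comonad :: "('k, 'z) ring_scheme \<Rightarrow> 'k \<Rightarrow> (('k, 'a) alg, ('k, 'a) alg_arr) cmnd" where
  "Seqs_comonad K lam = \<lparr>
     CF = \<lparr>FO = Seqs K lam, FA = Seqs_map K lam\<rparr>,
     counit = Seqs_counit K lam,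
     delta = Seqs_delta K lam\<rparr>"

definition Seqs_P :: "(('k, 'a) univ \<Rightarrow> ('k, 'a) univ) \<Rightarrow> ('k, 'a) univ \<Rightarrow> ('k, 'a) univ" where
  "Seqs_P P x = Seq (\<lambda>n. case n of 0 \<Rightarrow> P (un_Seq x 0) | Suc m \<Rightarrow> un_Seq x m)"


section \<open>The mixed distributive law\<close>

definition beta :: "('k, 'z) ring_scheme \<Rightarrow> 'k \<Rightarrow> ('k, 'a) alg \<Rightarrow> ('k, 'a) alg_arr" where
  "beta K lam A = (THE b.
     b \<in> Homs (ALG K) (Sha K lam (Seqs K lam A)) (Seqs K lam (Sha K lam A))
     \<and> fst (snd b) \<in> rota_baxter_hom K lam
          (Sha K lam (Seqs K lam A)) (Sha_P K (Seqs K lam A))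
          (Seqs K lam (Sha K lam A)) (Seqs_P (Sha_P K A))
     \<and> Cmp (ALG K) b (Sha_unit K lam (Seqs K lam A)) = Seqs_map K lam (Sha_unit K lam A))"

end

theory Submission
  imports Defs
begin

text \<open>The proof separates the categorical content from the algebra.

Every mixed distributive law \<open>\<beta>\<close> of a monad \<open>T\<close> over a comonad \<open>C\<close> yields both liftings: an
algebra \<open>h\<close> on \<open>a\<close> is sent to the algebra \<open>C h \<circ> \<beta>\<close> on \<open>C a\<close>, a coalgebra \<open>f\<close> on \<open>a\<close> to the
coalgebra \<open>\<beta> \<circ> T f\<close> on \<open>T a\<close>, and the four laws of \<open>\<beta>\<close> are what is needed for this to be
compatible with the structure of \<open>T\<close> and \<open>C\<close> (locale \<open>mixed_law\<close>). An object of either iterated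
category amounts to an algebra \<open>h\<close> and a coalgebra \<open>f\<close> on the same object with \<open>f \<circ> h = C h \<circ> \<beta>
\<circ> T f\<close>, and arrows are those that respect \<open>h\<close> and \<open>f\<close>. The condition is symmetric in the two
readings, and this gives the isomorphism.

That \<open>\<beta>\<close> is a mixed distributive law follows from two facts: \<open>T\<close> constructs free structured
objects, and \<open>C\<close> lifts to structured objects. All arrows in the laws are then structured arrows
out of a free object, so that it suffices to compare them on generators (locale
\<open>lifted_comonad\<close>). Here the structures are Rota-Baxter operators, and the two facts are the
algebraic work.

For sequences, the shift is a derivation of weight \<open>\<lambda>\<close>. This rule determines the product
recursively (\<open>Seq_mult_eq_hurwitz\<close>), and makes the algebra laws, the multiplicativity of the
comultiplication and the Rota-Baxter identity of the lifted operator inductions on the index or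
direct consequences.

For \<open>Sha(A)\<close>, linear maps are defined by multilinear maps on words. The product \<open>\<diamond>\<close> is shown to
be multilinear in each word, hence bilinear on tensors, where its recursion reads \<open>(a \<otimes> x) (b \<otimes>
y) = a b \<otimes> (x P(y) + P(x) y + \<lambda> x y)\<close> with \<open>P(x) = 1 \<otimes> x\<close> (\<open>mult_prefix\<close>). Associativity follows
by induction on the total length, the Rota-Baxter identity is the case \<open>a = b = 1\<close>, and freeness
holds because \<open>a\<^sub>0 \<otimes> \<dots> \<otimes> a\<^sub>n\<close> is \<open>a\<^sub>0 P(a\<^sub>1 P(\<dots> P(a\<^sub>n) \<dots>))\<close>.\<close>

section \<open>Categories\<close>

context category
begin

abbreviation comp (infixr \<open>\<cdot>\<close> 55) where "g \<cdot> f \<equiv> Cmp X g f"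

lemma HomsD:
  assumes "f \<in> Homs X a b"
  shows "f \<in> Arr X" "Src X f = a" "Tgt X f = b" "a \<in> Obj X" "b \<in> Obj X"
  using assms src tgt unfolding Homs_def by auto

lemma comp_cong_left:
  assumes "g \<cdot> f = k" and "e \<in> Homs X a b" "f \<in> Homs X b c" "g \<in> Homs X c d"
  shows "g \<cdot> (f \<cdot> e) = k \<cdot> e"
  using assms assoc by metis

end

lemma functorD:
  assumes "is_functor X Y F"
  shows "category X" "category Y"
    and "a \<in> Obj X \<Longrightarrow> FO F a \<in> Obj Y"
    and "f \<in> Homs X a b \<Longrightarrow> FA F f \<in> Homs Y (FO F a) (FO F b)"
    and "a \<in> Obj X \<Longrightarrow> FA F (Ident X a) = Ident Y (FO F a)"
    and "f \<in> Homs X a b \<Longrightarrow> g \<in> Homs X b c \<Longrightarrow> FA F (Cmp X g f) = Cmp Y (FA F g) (FA F f)"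
  using assms unfolding is_functor_def Homs_def by auto

lemma functorI:
  assumes "category X" "category Y"
    and "\<And>a. a \<in> Obj X \<Longrightarrow> FO F a \<in> Obj Y"
    and "\<And>f a b. f \<in> Homs X a b \<Longrightarrow> FA F f \<in> Homs Y (FO F a) (FO F b)"
    and "\<And>a. a \<in> Obj X \<Longrightarrow> FA F (Ident X a) = Ident Y (FO F a)"
    and "\<And>f g a b c. f \<in> Homs X a b \<Longrightarrow> g \<in> Homs X b c \<Longrightarrow>
      FA F (Cmp X g f) = Cmp Y (FA F g) (FA F f)"
  shows "is_functor X Y F"
  using assms unfolding is_functor_def Homs_def by auto

lemma comp_functor: "is_functor X Y F \<Longrightarrow> is_functor Y Z G \<Longrightarrow> is_functor X Z (G \<circ>\<^sub>F F)"
  by (rule functorI) (auto simp: comp_func_def functorD intro: functorD(4,6))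

lemma id_functor: "category X \<Longrightarrow> is_functor X X id_func"
  by (rule functorI) (auto simp: id_func_def)

lemma nat_transI:
  assumes "is_functor X Y F" "is_functor X Y G"
    and "\<And>a. a \<in> Obj X \<Longrightarrow> t a \<in> Homs Y (FO F a) (FO G a)"
    and "\<And>f a b. f \<in> Homs X a b \<Longrightarrow> Cmp Y (t b) (FA F f) = Cmp Y (FA G f) (t a)"
  shows "nat_trans X Y F G t"
  using assms unfolding nat_trans_def Homs_def by auto

lemma nat_transD:
  assumes "nat_trans X Y F G t"
  shows "is_functor X Y F" "is_functor X Y G"
    and "a \<in> Obj X \<Longrightarrow> t a \<in> Homs Y (FO F a) (FO G a)"
    and "f \<in> Homs X a b \<Longrightarrow> Cmp Y (t b) (FA F f) = Cmp Y (FA G f) (t a)"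
  using assms unfolding nat_trans_def Homs_def by auto

lemma Homs_algebras:
  "x \<in> Homs (algebras X T) (a, h) (b, k) \<longleftrightarrow> (\<exists>f. x = ((a, h), f, (b, k))
     \<and> (a, h) \<in> alg_objs X T \<and> (b, k) \<in> alg_objs X T
     \<and> f \<in> Homs X a b \<and> Cmp X f h = Cmp X k (FA (MF T) f))"
  unfolding Homs_def[of "algebras X T"] by (auto simp: algebras_def)

lemma Homs_coalgebras:
  "x \<in> Homs (coalgebras X C) (a, h) (b, k) \<longleftrightarrow> (\<exists>f. x = ((a, h), f, (b, k))
     \<and> (a, h) \<in> coalg_objs X C \<and> (b, k) \<in> coalg_objs X C
     \<and> f \<in> Homs X a b \<and> Cmp X k f = Cmp X (FA (CF C) f) h)"
  unfolding Homs_def[of "coalgebras X C"] by (auto simp: coalgebras_def)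

lemma algebras_simps [simp]:
  "Obj (algebras X T) = alg_objs X T"
  "Ident (algebras X T) (a, h) = ((a, h), Ident X a, (a, h))"
  "Cmp (algebras X T) (s', g, t') (s, f, t) = (s, Cmp X g f, t')"
  by (simp_all add: algebras_def)

lemma coalgebras_simps [simp]:
  "Obj (coalgebras X C) = coalg_objs X C"
  "Ident (coalgebras X C) (a, h) = ((a, h), Ident X a, (a, h))"
  "Cmp (coalgebras X C) (s', g, t') (s, f, t) = (s, Cmp X g f, t')"
  by (simp_all add: coalgebras_def)

lemma category_algebras:
  assumes "is_functor X X (MF T)"
  shows "category (algebras X T)"
proof -
  interpret category X using assms by (rule functorD)
  note T = functorD[OF assms]
  have obj: "a \<in> Obj X" "h \<in> Homs X (FO (MF T) a) a" if "(a, h) \<in> alg_objs X T" for a h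
    using that by (auto simp: alg_objs_def)
  show ?thesis
  proof
    show "Src (algebras X T) x \<in> Obj (algebras X T)" "Tgt (algebras X T) x \<in> Obj (algebras X T)"
      if "x \<in> Arr (algebras X T)" for x
      using that by (auto simp: algebras_def)
    show "Ident (algebras X T) a \<in> Homs (algebras X T) a a" if "a \<in> Obj (algebras X T)" for a
    proof (cases a)
      case (Pair b h)
      then have "b \<in> Obj X" "h \<in> Homs X (FO (MF T) b) b" using obj that by auto
      then show ?thesis using that Pair
        by (auto simp: Homs_algebras ident T ident_left ident_right)
    qed
    show "Cmp (algebras X T) y x \<in> Homs (algebras X T) a c"
      if x: "x \<in> Homs (algebras X T) a b" and y: "y \<in> Homs (algebras X T) b c" for x y a b c
    proof -
      obtain a' h b' k c' l where eqs: "a = (a', h)" "b = (b', k)" "c = (c', l)"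
        by (cases a, cases b, cases c) auto
      obtain f where f: "x = ((a', h), f, (b', k))" "(a', h) \<in> alg_objs X T"
        "f \<in> Homs X a' b'" "f \<cdot> h = k \<cdot> FA (MF T) f" using x by (auto simp: eqs Homs_algebras)
      obtain g where g: "y = ((b', k), g, (c', l))" "(b', k) \<in> alg_objs X T"
        "(c', l) \<in> alg_objs X T"
        "g \<in> Homs X b' c'" "g \<cdot> k = l \<cdot> FA (MF T) g" using y by (auto simp: eqs Homs_algebras)
      have "(g \<cdot> f) \<cdot> h = g \<cdot> (k \<cdot> FA (MF T) f)"
        using assoc[OF obj(2)[OF f(2)] f(3) g(4)] f(4) by simp
      also have "\<dots> = (l \<cdot> FA (MF T) g) \<cdot> FA (MF T) f"
        using assoc[OF T(4)[OF f(3)] obj(2)[OF g(2)] g(4)] g(5) by simp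
      also have "\<dots> = l \<cdot> FA (MF T) (g \<cdot> f)"
        using assoc[OF T(4)[OF f(3)] T(4)[OF g(4)] obj(2)[OF g(3)]] T(6)[OF f(3) g(4)] by simp
      finally show ?thesis using f g cmp by (auto simp: eqs Homs_algebras)
    qed
  qed (auto simp: Homs_algebras ident_left ident_right assoc)
qed

lemma category_coalgebras:
  assumes "is_functor X X (CF C)"
  shows "category (coalgebras X C)"
proof -
  interpret category X using assms by (rule functorD)
  note C = functorD[OF assms]
  have obj: "a \<in> Obj X" "h \<in> Homs X a (FO (CF C) a)" if "(a, h) \<in> coalg_objs X C" for a h
    using that by (auto simp: coalg_objs_def)
  show ?thesis
  proof
    show "Src (coalgebras X C) x \<in> Obj (coalgebras X C)"
      "Tgt (coalgebras X C) x \<in> Obj (coalgebras X C)"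
      if "x \<in> Arr (coalgebras X C)" for x
      using that by (auto simp: coalgebras_def)
    show "Ident (coalgebras X C) a \<in> Homs (coalgebras X C) a a" if "a \<in> Obj (coalgebras X C)" for a
    proof (cases a)
      case (Pair b h)
      then have "b \<in> Obj X" "h \<in> Homs X b (FO (CF C) b)" using obj that by auto
      then show ?thesis using that Pair
        by (auto simp: Homs_coalgebras ident C ident_left ident_right)
    qed
    show "Cmp (coalgebras X C) y x \<in> Homs (coalgebras X C) a c"
      if x: "x \<in> Homs (coalgebras X C) a b" and y: "y \<in> Homs (coalgebras X C) b c" for x y a b c
    proof -
      obtain a' h b' k c' l where eqs: "a = (a', h)" "b = (b', k)" "c = (c', l)"
        by (cases a, cases b, cases c) auto
      obtain f where f: "x = ((a', h), f, (b', k))" "(a', h) \<in> coalg_objs X C"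
        "f \<in> Homs X a' b'" "k \<cdot> f = FA (CF C) f \<cdot> h" using x by (auto simp: eqs Homs_coalgebras)
      obtain g where g: "y = ((b', k), g, (c', l))" "(b', k) \<in> coalg_objs X C"
        "(c', l) \<in> coalg_objs X C"
        "g \<in> Homs X b' c'" "l \<cdot> g = FA (CF C) g \<cdot> k" using y by (auto simp: eqs Homs_coalgebras)
      have "l \<cdot> (g \<cdot> f) = (FA (CF C) g \<cdot> k) \<cdot> f"
        using assoc[OF f(3) g(4) obj(2)[OF g(3)]] g(5) by simp
      also have "\<dots> = FA (CF C) g \<cdot> (FA (CF C) f \<cdot> h)"
        using assoc[OF f(3) obj(2)[OF g(2)] C(4)[OF g(4)]] f(4) by simp
      also have "\<dots> = FA (CF C) (g \<cdot> f) \<cdot> h"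
        using assoc[OF obj(2)[OF f(2)] C(4)[OF f(3)] C(4)[OF g(4)]] C(6)[OF f(3) g(4)] by simp
      finally show ?thesis using f g cmp by (auto simp: eqs Homs_coalgebras)
    qed
  qed (auto simp: Homs_coalgebras ident_left ident_right assoc)
qed

lemma functor_underlying_algebras:
  "is_functor X X (MF T) \<Longrightarrow> is_functor (algebras X T) X underlying"
  by (rule functorI)
    (auto simp: underlying_def category_algebras functorD Homs_algebras alg_objs_def)

lemma functor_underlying_coalgebras:
  "is_functor X X (CF C) \<Longrightarrow> is_functor (coalgebras X C) X underlying"
  by (rule functorI)
    (auto simp: underlying_def category_coalgebras functorD Homs_coalgebras coalg_objs_def)


section \<open>Liftings along a mixed distributive law\<close>

locale mixed_law =
  fixes X :: "('o, 'm) cat" and T :: "('o, 'm) mnd" and C :: "('o, 'm) cmnd" and \<beta> :: "'o \<Rightarrow> 'm"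
  assumes law: "mixed_distributive_law X T C \<beta>"
begin

abbreviation "To \<equiv> FO (MF T)"
abbreviation "Ta \<equiv> FA (MF T)"
abbreviation "Co \<equiv> FO (CF C)"
abbreviation "Ca \<equiv> FA (CF C)"

lemma monad_T: "monad X T" and comonad_C: "comonad X C"
  and nat_beta: "nat_trans X X (MF T \<circ>\<^sub>F CF C) (CF C \<circ>\<^sub>F MF T) \<beta>"
  using law by (auto simp: mixed_distributive_law_def)

lemma nat_unit: "nat_trans X X id_func (MF T) (unit T)"
  and nat_mu: "nat_trans X X (MF T \<circ>\<^sub>F MF T) (MF T) (mu T)"
  using monad_T by (auto simp: monad_def)

lemma nat_counit: "nat_trans X X (CF C) id_func (counit C)"
  and nat_delta: "nat_trans X X (CF C) (CF C \<circ>\<^sub>F CF C) (delta C)"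
  using comonad_C by (auto simp: comonad_def)

lemmas functor_T = nat_transD(2)[OF nat_unit]
lemmas functor_C = nat_transD(1)[OF nat_counit]

sublocale category X
  using functor_T by (rule functorD)

lemmas T_obj = functorD(3)[OF functor_T]
  and T_hom = functorD(4)[OF functor_T]
  and T_ident = functorD(5)[OF functor_T]
  and T_comp = functorD(6)[OF functor_T]
  and C_obj = functorD(3)[OF functor_C]
  and C_hom = functorD(4)[OF functor_C]
  and C_ident = functorD(5)[OF functor_C]
  and C_comp = functorD(6)[OF functor_C]

lemmas unit_hom = nat_transD(3)[OF nat_unit, unfolded id_func_def, simplified]
  and unit_nat = nat_transD(4)[OF nat_unit, unfolded id_func_def, simplified]
  and mu_hom = nat_transD(3)[OF nat_mu, unfolded comp_func_def, simplified]
  and mu_nat = nat_transD(4)[OF nat_mu, unfolded comp_func_def, simplified]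
  and counit_hom = nat_transD(3)[OF nat_counit, unfolded id_func_def, simplified]
  and counit_nat = nat_transD(4)[OF nat_counit, unfolded id_func_def, simplified]
  and delta_hom = nat_transD(3)[OF nat_delta, unfolded comp_func_def, simplified]
  and delta_nat = nat_transD(4)[OF nat_delta, unfolded comp_func_def, simplified]
  and beta_hom = nat_transD(3)[OF nat_beta, unfolded comp_func_def, simplified]
  and beta_nat = nat_transD(4)[OF nat_beta, unfolded comp_func_def, simplified]

lemma monad_laws:
  assumes "a \<in> Obj X"
  shows "mu T a \<cdot> unit T (To a) = Ident X (To a)"
    and "mu T a \<cdot> Ta (unit T a) = Ident X (To a)"
    and "mu T a \<cdot> mu T (To a) = mu T a \<cdot> Ta (mu T a)"
  using monad_T assms by (auto simp: monad_def)

lemma comonad_laws: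
  assumes "a \<in> Obj X"
  shows "counit C (Co a) \<cdot> delta C a = Ident X (Co a)"
    and "Ca (counit C a) \<cdot> delta C a = Ident X (Co a)"
    and "delta C (Co a) \<cdot> delta C a = Ca (delta C a) \<cdot> delta C a"
  using comonad_C assms by (auto simp: comonad_def)

lemma beta_laws:
  assumes "a \<in> Obj X"
  shows "\<beta> a \<cdot> unit T (Co a) = Ca (unit T a)"
    and "counit C (To a) \<cdot> \<beta> a = Ta (counit C a)"
    and "delta C (To a) \<cdot> \<beta> a = Ca (\<beta> a) \<cdot> \<beta> (Co a) \<cdot> Ta (delta C a)"
    and "\<beta> a \<cdot> mu T (Co a) = Ca (mu T a) \<cdot> \<beta> (To a) \<cdot> Ta (\<beta> a)"
  using law assms by (auto simp: mixed_distributive_law_def)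

lemmas homs = T_hom C_hom unit_hom mu_hom counit_hom delta_hom beta_hom T_obj C_obj cmp ident

abbreviation "Lc \<equiv> lift_comonad_obj X C \<beta>"
abbreviation "Lm \<equiv> lift_monad_obj X T \<beta>"

lemma Lc_simp: "Lc (a, h) = (Co a, Ca h \<cdot> \<beta> a)" and Lm_simp: "Lm (a, f) = (To a, \<beta> a \<cdot> Ta f)"
  by (simp_all add: lift_comonad_obj_def lift_monad_obj_def)

lemma alg_objsD:
  assumes "(a, h) \<in> alg_objs X T"
  shows "a \<in> Obj X" "h \<in> Homs X (To a) a" "h \<cdot> unit T a = Ident X a" "h \<cdot> mu T a = h \<cdot> Ta h"
  using assms by (auto simp: alg_objs_def)

lemma coalg_objsD:
  assumes "(a, f) \<in> coalg_objs X C"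
  shows "a \<in> Obj X" "f \<in> Homs X a (Co a)" "counit C a \<cdot> f = Ident X a"
    "delta C a \<cdot> f = Ca f \<cdot> f"
  using assms by (auto simp: coalg_objs_def)

text \<open>The structure map \<open>C h \<circ> \<beta>\<close> is again a \<open>T\<close>-algebra because \<open>\<beta>\<close> is compatible with the unit
and the multiplication of \<open>T\<close>: these two laws move \<open>\<beta>\<close> out of the way, and what remains is \<open>C\<close>
applied to the corresponding law for \<open>h\<close>.\<close>

lemma Lc_obj:
  assumes "(a, h) \<in> alg_objs X T"
  shows "Lc (a, h) \<in> alg_objs X T"
proof -
  note h = alg_objsD[OF assms]
  have "(Ca h \<cdot> \<beta> a) \<cdot> unit T (Co a) = Ca h \<cdot> Ca (unit T a)"
    using assoc[of "unit T (Co a)" _ _ "\<beta> a" _ "Ca h"] h beta_laws homs by metis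
  also have "\<dots> = Ident X (Co a)"
    using C_comp[OF unit_hom h(2)] h C_ident by metis
  finally have 1: "(Ca h \<cdot> \<beta> a) \<cdot> unit T (Co a) = Ident X (Co a)" .
  have T\<beta>: "Ta (\<beta> a) \<in> Homs X (To (To (Co a))) (To (Co (To a)))"
    and \<beta>T: "\<beta> (To a) \<in> Homs X (To (Co (To a))) (Co (To (To a)))"
    and \<beta>: "\<beta> a \<in> Homs X (To (Co a)) (Co (To a))"
    and Ch: "Ca h \<in> Homs X (Co (To a)) (Co a)"
    using h homs by auto
  have "(Ca h \<cdot> \<beta> a) \<cdot> mu T (Co a) = Ca h \<cdot> (Ca (mu T a) \<cdot> \<beta> (To a) \<cdot> Ta (\<beta> a))"
    using assoc[OF mu_hom[OF C_obj] \<beta> Ch] beta_laws(4) h(1) by metis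
  also have "\<dots> = Ca (h \<cdot> mu T a) \<cdot> \<beta> (To a) \<cdot> Ta (\<beta> a)"
    using assoc[OF cmp[OF T\<beta> \<beta>T] C_hom[OF mu_hom] Ch] C_comp[OF mu_hom h(2)] h(1) by metis
  also have "\<dots> = Ca h \<cdot> Ca (Ta h) \<cdot> \<beta> (To a) \<cdot> Ta (\<beta> a)"
    using assoc[OF cmp[OF T\<beta> \<beta>T] C_hom[OF T_hom[OF h(2)]] Ch] C_comp[OF T_hom[OF h(2)] h(2)] h(4)
    by metis
  also have "\<dots> = Ca h \<cdot> (\<beta> a \<cdot> Ta (Ca h)) \<cdot> Ta (\<beta> a)"
    using assoc[OF T\<beta> \<beta>T C_hom[OF T_hom[OF h(2)]]] beta_nat[OF h(2)] by metis
  also have "\<dots> = (Ca h \<cdot> \<beta> a) \<cdot> Ta (Ca h \<cdot> \<beta> a)"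
    using assoc[OF T\<beta> T_hom[OF Ch] \<beta>] assoc[OF cmp[OF T\<beta> T_hom[OF Ch]] \<beta> Ch] T_comp[OF \<beta> Ch]
    by metis
  finally show ?thesis
    using 1 h cmp[OF \<beta> Ch] C_obj by (simp add: alg_objs_def Lc_simp)
qed

text \<open>Dually, the compatibility of \<open>\<beta>\<close> with the counit and the comultiplication of \<open>C\<close> makes \<open>\<beta>
\<circ> T f\<close> a \<open>C\<close>-coalgebra.\<close>

lemma Lm_obj:
  assumes "(a, f) \<in> coalg_objs X C"
  shows "Lm (a, f) \<in> coalg_objs X C"
proof -
  note f = coalg_objsD[OF assms]
  have Tf: "Ta f \<in> Homs X (To a) (To (Co a))"
    and \<beta>: "\<beta> a \<in> Homs X (To (Co a)) (Co (To a))"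
    and \<beta>C: "\<beta> (Co a) \<in> Homs X (To (Co (Co a))) (Co (To (Co a)))"
    and C\<beta>: "Ca (\<beta> a) \<in> Homs X (Co (To (Co a))) (Co (Co (To a)))"
    using f homs by auto
  have "counit C (To a) \<cdot> \<beta> a \<cdot> Ta f = Ta (counit C a) \<cdot> Ta f"
    using comp_cong_left[OF beta_laws(2)[OF f(1)] Tf \<beta>] counit_hom T_obj f(1) by metis
  also have "\<dots> = Ident X (To a)"
    using T_comp[OF f(2) counit_hom] f T_ident by metis
  finally have 1: "counit C (To a) \<cdot> \<beta> a \<cdot> Ta f = Ident X (To a)" .
  have T\<delta>: "Ta (delta C a) \<in> Homs X (To (Co a)) (To (Co (Co a)))"
    using f homs by auto
  have CTf: "Ca (Ta f) \<in> Homs X (Co (To a)) (Co (To (Co a)))"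
    using f homs by auto
  have "delta C (To a) \<cdot> \<beta> a \<cdot> Ta f = (Ca (\<beta> a) \<cdot> \<beta> (Co a) \<cdot> Ta (delta C a)) \<cdot> Ta f"
    using comp_cong_left[OF beta_laws(3)[OF f(1)] Tf \<beta>] delta_hom T_obj f(1) by metis
  also have "\<dots> = Ca (\<beta> a) \<cdot> (\<beta> (Co a) \<cdot> Ta (delta C a)) \<cdot> Ta f"
    using assoc[OF Tf cmp[OF T\<delta> \<beta>C] C\<beta>] by metis
  also have "\<dots> = Ca (\<beta> a) \<cdot> \<beta> (Co a) \<cdot> Ta (delta C a \<cdot> f)"
    using assoc[OF Tf T\<delta> \<beta>C] T_comp[OF f(2) delta_hom[OF f(1)]] by metis
  also have "\<dots> = Ca (\<beta> a) \<cdot> \<beta> (Co a) \<cdot> Ta (Ca f) \<cdot> Ta f"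
    using T_comp[OF f(2) C_hom[OF f(2)]] f(4) by metis
  also have "\<dots> = Ca (\<beta> a) \<cdot> (Ca (Ta f) \<cdot> \<beta> a) \<cdot> Ta f"
    using assoc[OF Tf T_hom[OF C_hom[OF f(2)]] \<beta>C] beta_nat[OF f(2)] by metis
  also have "\<dots> = Ca (\<beta> a \<cdot> Ta f) \<cdot> \<beta> a \<cdot> Ta f"
    using assoc[OF Tf \<beta> CTf] assoc[OF cmp[OF Tf \<beta>] CTf C\<beta>] C_comp[OF Tf \<beta>] by metis
  finally show ?thesis
    using 1 f cmp[OF Tf \<beta>] T_obj by (simp add: coalg_objs_def Lm_simp)
qed

lemma lift_comonad_simps:
  "FO (CF (lift_comonad X C \<beta>)) = Lc"
  "FA (CF (lift_comonad X C \<beta>)) (s, f, t) = (Lc s, Ca f, Lc t)"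
  "counit (lift_comonad X C \<beta>) (a, h) = (Lc (a, h), counit C a, (a, h))"
  "delta (lift_comonad X C \<beta>) (a, h) = (Lc (a, h), delta C a, Lc (Lc (a, h)))"
  by (simp_all add: lift_comonad_def Let_def)

lemma lift_monad_simps:
  "FO (MF (lift_monad X T \<beta>)) = Lm"
  "FA (MF (lift_monad X T \<beta>)) (s, f, t) = (Lm s, Ta f, Lm t)"
  "unit (lift_monad X T \<beta>) (a, f) = ((a, f), unit T a, Lm (a, f))"
  "mu (lift_monad X T \<beta>) (a, f) = (Lm (Lm (a, f)), mu T a, Lm (a, f))"
  by (simp_all add: lift_monad_def Let_def)

lemma Lc_arrow:
  assumes "(a, h) \<in> alg_objs X T" "(b, k) \<in> alg_objs X T"
    and f: "f \<in> Homs X a b" and eq: "f \<cdot> h = k \<cdot> Ta f"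
  shows "Ca f \<cdot> Ca h \<cdot> \<beta> a = (Ca k \<cdot> \<beta> b) \<cdot> Ta (Ca f)"
proof -
  note h = alg_objsD[OF assms(1)] and k = alg_objsD[OF assms(2)]
  have "Ca f \<cdot> Ca h \<cdot> \<beta> a = Ca (f \<cdot> h) \<cdot> \<beta> a"
    using comp_cong_left[OF _ beta_hom C_hom[OF h(2)] C_hom[OF f]] C_comp[OF h(2) f] h(1) by metis
  also have "\<dots> = Ca k \<cdot> (Ca (Ta f) \<cdot> \<beta> a)"
    using assoc[OF beta_hom C_hom[OF T_hom[OF f]] C_hom[OF k(2)]] C_comp[OF T_hom[OF f] k(2)]
      eq h(1)
    by metis
  also have "\<dots> = (Ca k \<cdot> \<beta> b) \<cdot> Ta (Ca f)"
    using beta_nat[OF f] assoc[OF T_hom[OF C_hom[OF f]] beta_hom C_hom[OF k(2)]] k(1) by metis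
  finally show ?thesis .
qed

lemma Lm_arrow:
  assumes "(a, h) \<in> coalg_objs X C" "(b, k) \<in> coalg_objs X C"
    and f: "f \<in> Homs X a b" and eq: "k \<cdot> f = Ca f \<cdot> h"
  shows "(\<beta> b \<cdot> Ta k) \<cdot> Ta f = Ca (Ta f) \<cdot> \<beta> a \<cdot> Ta h"
proof -
  note h = coalg_objsD[OF assms(1)] and k = coalg_objsD[OF assms(2)]
  have "(\<beta> b \<cdot> Ta k) \<cdot> Ta f = \<beta> b \<cdot> Ta (Ca f \<cdot> h)"
    using assoc[OF T_hom[OF f] T_hom[OF k(2)] beta_hom] T_comp[OF f k(2)] eq k(1) by metis
  also have "\<dots> = (\<beta> b \<cdot> Ta (Ca f)) \<cdot> Ta h"
    using assoc[OF T_hom[OF h(2)] T_hom[OF C_hom[OF f]] beta_hom] T_comp[OF h(2) C_hom[OF f]] k(1)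
    by metis
  also have "\<dots> = Ca (Ta f) \<cdot> \<beta> a \<cdot> Ta h"
    using beta_nat[OF f] assoc[OF T_hom[OF h(2)] beta_hom C_hom[OF T_hom[OF f]]] h(1) by metis
  finally show ?thesis .
qed

abbreviation "XT \<equiv> algebras X T"
abbreviation "XC \<equiv> coalgebras X C"
abbreviation "C' \<equiv> lift_comonad X C \<beta>"
abbreviation "T' \<equiv> lift_monad X T \<beta>"

lemmas category_XT = category_algebras[OF functor_T]
  and category_XC = category_coalgebras[OF functor_C]

lemma functor_C': "is_functor XT XT (CF C')"
proof (rule functorI)
  show "FA (CF C') f \<in> Homs XT (FO (CF C') a) (FO (CF C') b)" if "f \<in> Homs XT a b" for f a b
  proof -
    obtain a' h b' k where "a = (a', h)" "b = (b', k)" by (cases a, cases b) auto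
    with that show ?thesis
      using Lc_obj Lc_arrow C_hom
      by (auto simp: Homs_algebras lift_comonad_simps) (auto simp: Homs_algebras Lc_simp)
  qed
qed (auto simp: category_XT lift_comonad_simps Lc_obj Homs_algebras C_comp,
    auto simp: Lc_simp C_ident alg_objsD)

lemma functor_T': "is_functor XC XC (MF T')"
proof (rule functorI)
  show "FA (MF T') f \<in> Homs XC (FO (MF T') a) (FO (MF T') b)" if "f \<in> Homs XC a b" for f a b
  proof -
    obtain a' h b' k where "a = (a', h)" "b = (b', k)" by (cases a, cases b) auto
    with that show ?thesis
      using Lm_obj Lm_arrow T_hom
      by (auto simp: Homs_coalgebras lift_monad_simps) (auto simp: Homs_coalgebras Lm_simp)
  qed
qed (auto simp: category_XC lift_monad_simps Lm_obj Homs_coalgebras T_comp,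
    auto simp: Lm_simp T_ident coalg_objsD)


text \<open>The counit and the comultiplication of \<open>C\<close> become arrows of \<open>T\<close>-algebras by the two laws
of \<open>\<beta>\<close> that concern \<open>C\<close>; in \<open>unit_arrow\<close> and \<open>mu_arrow\<close> below, the other two laws do the same
for the unit and the multiplication of \<open>T\<close>. Thus each lifting uses all four laws.\<close>

lemma counit_arrow:
  assumes "(a, h) \<in> alg_objs X T"
  shows "counit C a \<cdot> Ca h \<cdot> \<beta> a = h \<cdot> Ta (counit C a)"
proof -
  note h = alg_objsD[OF assms]
  have "counit C a \<cdot> Ca h \<cdot> \<beta> a = (h \<cdot> counit C (To a)) \<cdot> \<beta> a"
    using assoc[OF beta_hom C_hom[OF h(2)] counit_hom] counit_nat[OF h(2)] h(1) by metis
  then show ?thesis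
    using assoc[OF beta_hom counit_hom[OF T_obj] h(2)] beta_laws(2) h(1) by metis
qed

lemma delta_arrow:
  assumes "(a, h) \<in> alg_objs X T"
  shows "delta C a \<cdot> Ca h \<cdot> \<beta> a = (Ca (Ca h \<cdot> \<beta> a) \<cdot> \<beta> (Co a)) \<cdot> Ta (delta C a)"
proof -
  note h = alg_objsD[OF assms]
  have CCh: "Ca (Ca h) \<in> Homs X (Co (Co (To a))) (Co (Co a))"
    and \<delta>T: "delta C (To a) \<in> Homs X (Co (To a)) (Co (Co (To a)))"
    and \<beta>C: "\<beta> (Co a) \<in> Homs X (To (Co (Co a))) (Co (To (Co a)))"
    and C\<beta>: "Ca (\<beta> a) \<in> Homs X (Co (To (Co a))) (Co (Co (To a)))"
    and T\<delta>: "Ta (delta C a) \<in> Homs X (To (Co a)) (To (Co (Co a)))"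
    using h homs by auto
  have "delta C a \<cdot> Ca h \<cdot> \<beta> a = (Ca (Ca h) \<cdot> delta C (To a)) \<cdot> \<beta> a"
    using assoc[OF beta_hom C_hom[OF h(2)] delta_hom] delta_nat[OF h(2)] h(1) by metis
  also have "\<dots> = Ca (Ca h) \<cdot> Ca (\<beta> a) \<cdot> \<beta> (Co a) \<cdot> Ta (delta C a)"
    using assoc[OF beta_hom \<delta>T CCh] beta_laws(3) h(1) by metis
  also have "\<dots> = Ca (Ca h \<cdot> \<beta> a) \<cdot> \<beta> (Co a) \<cdot> Ta (delta C a)"
    using assoc[OF cmp[OF T\<delta> \<beta>C] C\<beta> CCh] C_comp[OF beta_hom C_hom[OF h(2)]] h(1) by metis
  also have "\<dots> = (Ca (Ca h \<cdot> \<beta> a) \<cdot> \<beta> (Co a)) \<cdot> Ta (delta C a)"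
    using assoc[OF T\<delta> \<beta>C C_hom[OF cmp[OF beta_hom C_hom[OF h(2)]]]] h(1) by metis
  finally show ?thesis .
qed

lemma unit_arrow:
  assumes "(a, f) \<in> coalg_objs X C"
  shows "(\<beta> a \<cdot> Ta f) \<cdot> unit T a = Ca (unit T a) \<cdot> f"
proof -
  note f = coalg_objsD[OF assms]
  have "(\<beta> a \<cdot> Ta f) \<cdot> unit T a = \<beta> a \<cdot> unit T (Co a) \<cdot> f"
    using assoc[OF unit_hom T_hom[OF f(2)] beta_hom] unit_nat[OF f(2)] f(1) by metis
  then show ?thesis
    using assoc[OF f(2) unit_hom[OF C_obj] beta_hom] beta_laws(1) f(1) by metis
qed

lemma mu_arrow:
  assumes "(a, f) \<in> coalg_objs X C"
  shows "(\<beta> a \<cdot> Ta f) \<cdot> mu T a = Ca (mu T a) \<cdot> \<beta> (To a) \<cdot> Ta (\<beta> a \<cdot> Ta f)"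
proof -
  note f = coalg_objsD[OF assms]
  have TTf: "Ta (Ta f) \<in> Homs X (To (To a)) (To (To (Co a)))"
    and T\<beta>: "Ta (\<beta> a) \<in> Homs X (To (To (Co a))) (To (Co (To a)))"
    and \<beta>T: "\<beta> (To a) \<in> Homs X (To (Co (To a))) (Co (To (To a)))"
    and C\<mu>: "Ca (mu T a) \<in> Homs X (Co (To (To a))) (Co (To a))"
    and \<mu>C: "mu T (Co a) \<in> Homs X (To (To (Co a))) (To (Co a))"
    using f homs by auto
  have "(\<beta> a \<cdot> Ta f) \<cdot> mu T a = \<beta> a \<cdot> mu T (Co a) \<cdot> Ta (Ta f)"
    using assoc[OF mu_hom T_hom[OF f(2)] beta_hom] mu_nat[OF f(2)] f(1) by metis
  also have "\<dots> = (Ca (mu T a) \<cdot> \<beta> (To a) \<cdot> Ta (\<beta> a)) \<cdot> Ta (Ta f)"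
    using assoc[OF TTf \<mu>C beta_hom] beta_laws(4) f(1) by metis
  also have "\<dots> = Ca (mu T a) \<cdot> (\<beta> (To a) \<cdot> Ta (\<beta> a)) \<cdot> Ta (Ta f)"
    using assoc[OF TTf cmp[OF T\<beta> \<beta>T] C\<mu>] by simp
  also have "\<dots> = Ca (mu T a) \<cdot> \<beta> (To a) \<cdot> Ta (\<beta> a \<cdot> Ta f)"
    using assoc[OF TTf T\<beta> \<beta>T] T_comp[OF T_hom[OF f(2)] beta_hom] f(1) by metis
  finally show ?thesis .
qed

text \<open>Once the structure is known to consist of \<open>T\<close>-algebras and their arrows, the comonad laws
are those of \<open>C\<close>, since arrows of algebras compose as their underlying arrows do.\<close>

theorem comonad_C': "comonad XT C'"
  unfolding comonad_def
proof (intro conjI ballI)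
  have C'C': "is_functor XT XT (CF C' \<circ>\<^sub>F CF C')" and id: "is_functor XT XT id_func"
    using comp_functor functor_C' id_functor category_XT by blast+
  have obj: "a \<in> Obj X" if "(a, h) \<in> alg_objs X T" for a h
    using that alg_objsD by blast
  show "nat_trans XT XT (CF C') id_func (counit C')"
  proof (rule nat_transI[OF functor_C' id])
    show "counit C' a \<in> Homs XT (FO (CF C') a) (FO id_func a)" if "a \<in> Obj XT" for a
    proof (cases a)
      case (Pair b h)
      with that show ?thesis
        using Lc_obj[of b h] counit_hom[of b] counit_arrow[of b h] obj
        by (auto simp: lift_comonad_simps id_func_def Lc_simp Homs_algebras)
    qed
    show "Cmp XT (counit C' b) (FA (CF C') f) = Cmp XT (FA id_func f) (counit C' a)"
      if "f \<in> Homs XT a b" for f a b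
      using that
      by (cases a, cases b) (auto simp: Homs_algebras lift_comonad_simps id_func_def counit_nat)
  qed
  show "nat_trans XT XT (CF C') (CF C' \<circ>\<^sub>F CF C') (delta C')"
  proof (rule nat_transI[OF functor_C' C'C'])
    show "delta C' a \<in> Homs XT (FO (CF C') a) (FO (CF C' \<circ>\<^sub>F CF C') a)" if "a \<in> Obj XT" for a
    proof (cases a)
      case (Pair b h)
      with that show ?thesis
        using Lc_obj[of b h] Lc_obj[of "Co b" "Ca h \<cdot> \<beta> b"] delta_hom[of b] delta_arrow[of b h] obj
        by (auto simp: lift_comonad_simps comp_func_def Lc_simp Homs_algebras)
    qed
    show "Cmp XT (delta C' b) (FA (CF C') f) = Cmp XT (FA (CF C' \<circ>\<^sub>F CF C') f) (delta C' a)"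
      if "f \<in> Homs XT a b" for f a b
      using that
      by (cases a, cases b) (auto simp: Homs_algebras lift_comonad_simps comp_func_def delta_nat)
  qed
  fix a assume "a \<in> Obj XT"
  moreover obtain b h where "a = (b, h)" by (cases a)
  ultimately show
    "Cmp XT (counit C' (FO (CF C') a)) (delta C' a) = Ident XT (FO (CF C') a)"
    "Cmp XT (FA (CF C') (counit C' a)) (delta C' a) = Ident XT (FO (CF C') a)"
    "Cmp XT (delta C' (FO (CF C') a)) (delta C' a) = Cmp XT (FA (CF C') (delta C' a)) (delta C' a)"
    by (auto simp: lift_comonad_simps Lc_simp comonad_laws obj)
qed

theorem monad_T': "monad XC T'"
  unfolding monad_def
proof (intro conjI ballI)
  have T'T': "is_functor XC XC (MF T' \<circ>\<^sub>F MF T')" and id: "is_functor XC XC id_func"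
    using comp_functor functor_T' id_functor category_XC by blast+
  have obj: "a \<in> Obj X" if "(a, h) \<in> coalg_objs X C" for a h
    using that coalg_objsD by blast
  show "nat_trans XC XC id_func (MF T') (unit T')"
  proof (rule nat_transI[OF id functor_T'])
    show "unit T' a \<in> Homs XC (FO id_func a) (FO (MF T') a)" if "a \<in> Obj XC" for a
    proof (cases a)
      case (Pair b f)
      with that show ?thesis
        using Lm_obj[of b f] unit_hom[of b] unit_arrow[of b f] obj
        by (auto simp: lift_monad_simps id_func_def Lm_simp Homs_coalgebras)
    qed
    show "Cmp XC (unit T' b) (FA id_func f) = Cmp XC (FA (MF T') f) (unit T' a)"
      if "f \<in> Homs XC a b" for f a b
      using that
      by (cases a, cases b) (auto simp: Homs_coalgebras lift_monad_simps id_func_def unit_nat)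
  qed
  show "nat_trans XC XC (MF T' \<circ>\<^sub>F MF T') (MF T') (mu T')"
  proof (rule nat_transI[OF T'T' functor_T'])
    show "mu T' a \<in> Homs XC (FO (MF T' \<circ>\<^sub>F MF T') a) (FO (MF T') a)" if "a \<in> Obj XC" for a
    proof (cases a)
      case (Pair b f)
      with that show ?thesis
        using Lm_obj[of b f] Lm_obj[of "To b" "\<beta> b \<cdot> Ta f"] mu_hom[of b] mu_arrow[of b f] obj
        by (auto simp: lift_monad_simps comp_func_def Lm_simp Homs_coalgebras)
    qed
    show "Cmp XC (mu T' b) (FA (MF T' \<circ>\<^sub>F MF T') f) = Cmp XC (FA (MF T') f) (mu T' a)"
      if "f \<in> Homs XC a b" for f a b
      using that
      by (cases a, cases b) (auto simp: Homs_coalgebras lift_monad_simps comp_func_def mu_nat)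
  qed
  fix a assume "a \<in> Obj XC"
  moreover obtain b h where "a = (b, h)" by (cases a)
  ultimately show
    "Cmp XC (mu T' a) (unit T' (FO (MF T') a)) = Ident XC (FO (MF T') a)"
    "Cmp XC (mu T' a) (FA (MF T') (unit T' a)) = Ident XC (FO (MF T') a)"
    "Cmp XC (mu T' a) (mu T' (FO (MF T') a)) = Cmp XC (mu T' a) (FA (MF T') (mu T' a))"
    by (auto simp: lift_monad_simps Lm_simp monad_laws obj)
qed

theorem lifts_comonad:
  "functor_eq XT (underlying \<circ>\<^sub>F CF C') (CF C \<circ>\<^sub>F underlying)"
  "trans_eq XT (whisker_left underlying (counit C')) (whisker_right (counit C) underlying)"
  "trans_eq XT (whisker_left underlying (delta C')) (whisker_right (delta C) underlying)"
  by (auto simp: functor_eq_def trans_eq_def comp_func_def whisker_left_def whisker_right_def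
      underlying_def lift_comonad_simps lift_comonad_obj_def algebras_def)

theorem lifts_monad:
  "functor_eq XC (underlying \<circ>\<^sub>F MF T') (MF T \<circ>\<^sub>F underlying)"
  "trans_eq XC (whisker_left underlying (unit T')) (whisker_right (unit T) underlying)"
  "trans_eq XC (whisker_left underlying (mu T')) (whisker_right (mu T) underlying)"
  by (auto simp: functor_eq_def trans_eq_def comp_func_def whisker_left_def whisker_right_def
      underlying_def lift_monad_simps lift_monad_obj_def coalgebras_def)

section \<open>Bialgebras\<close>

text \<open>The equation says both that \<open>f\<close> is an arrow of \<open>T\<close>-algebras into the lifted \<open>C\<close>-image of
\<open>h\<close>, and that \<open>h\<close> is an arrow of \<open>C\<close>-coalgebras from the lifted \<open>T\<close>-image of \<open>f\<close>. This symmetry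
is the reason for the isomorphism of categories.\<close>

definition bialgebra :: "'o \<Rightarrow> 'm \<Rightarrow> 'm \<Rightarrow> bool" where
  "bialgebra a h f \<longleftrightarrow> (a, h) \<in> alg_objs X T \<and> (a, f) \<in> coalg_objs X C
     \<and> f \<cdot> h = Ca h \<cdot> \<beta> a \<cdot> Ta f"

abbreviation "XCT \<equiv> algebras XC T'"
abbreviation "XTC \<equiv> coalgebras XT C'"

text \<open>An algebra for the lifted monad has a structure map that is a triple, but its source and
target are forced, so only the underlying arrow \<open>h\<close> is free. Its unit and multiplication laws
are those of \<open>T\<close>.\<close>

lemma Obj_XCT:
  "y \<in> Obj XCT \<longleftrightarrow> (\<exists>a h f. y = ((a, f), (Lm (a, f), h, (a, f))) \<and> bialgebra a h f)"
proof -
  obtain a f H where y: "y = ((a, f), H)" by (cases y) auto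
  show ?thesis
    using Lm_obj[of a f]
    by (auto simp: y alg_objs_def[of XC] lift_monad_simps Homs_coalgebras Lm_simp
        bialgebra_def alg_objs_def[of X] dest: coalg_objsD)
qed

lemma Obj_XTC:
  "y \<in> Obj XTC \<longleftrightarrow> (\<exists>a h f. y = ((a, h), ((a, h), f, Lc (a, h))) \<and> bialgebra a h f)"
proof -
  obtain a h H where y: "y = ((a, h), H)" by (cases y) auto
  have eq: "(Ca h \<cdot> \<beta> a) \<cdot> Ta f = Ca h \<cdot> \<beta> a \<cdot> Ta f"
    if "(a, h) \<in> alg_objs X T" "f \<in> Homs X a (Co a)" for f
    using assoc[OF T_hom[OF that(2)] beta_hom C_hom] alg_objsD[OF that(1)] by metis
  show ?thesis
    using Lc_obj[of a h] eq
    by (auto simp: y coalg_objs_def[of XT] lift_comonad_simps Homs_algebras Lc_simp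
        bialgebra_def coalg_objs_def[of X] dest: alg_objsD)
qed

definition bialgebra_arrow :: "'o \<Rightarrow> 'm \<Rightarrow> 'm \<Rightarrow> 'm \<Rightarrow> 'o \<Rightarrow> 'm \<Rightarrow> 'm \<Rightarrow> bool" where
  "bialgebra_arrow a h f u b k g \<longleftrightarrow> bialgebra a h f \<and> bialgebra b k g \<and> u \<in> Homs X a b
     \<and> u \<cdot> h = k \<cdot> Ta u \<and> g \<cdot> u = Ca u \<cdot> f"

lemma Homs_XCT:
  "x \<in> Homs XCT ((a, f), (Lm (a, f), h, (a, f))) ((b, g), (Lm (b, g), k, (b, g))) \<longleftrightarrow>
    (\<exists>u. x = (((a, f), (Lm (a, f), h, (a, f))), ((a, f), u, (b, g)),
        ((b, g), (Lm (b, g), k, (b, g))))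
      \<and> bialgebra_arrow a h f u b k g)"
  using Obj_XCT[of "((a, f), (Lm (a, f), h, (a, f)))"]
    Obj_XCT[of "((b, g), (Lm (b, g), k, (b, g)))"]
  by (auto simp: Homs_algebras Homs_coalgebras lift_monad_simps bialgebra_arrow_def)
    (auto simp: bialgebra_def)

lemma Homs_XTC:
  "x \<in> Homs XTC ((a, h), ((a, h), f, Lc (a, h))) ((b, k), ((b, k), g, Lc (b, k))) \<longleftrightarrow>
    (\<exists>u. x = (((a, h), ((a, h), f, Lc (a, h))), ((a, h), u, (b, k)),
        ((b, k), ((b, k), g, Lc (b, k))))
      \<and> bialgebra_arrow a h f u b k g)"
  using Obj_XTC[of "((a, h), ((a, h), f, Lc (a, h)))"]
    Obj_XTC[of "((b, k), ((b, k), g, Lc (b, k)))"]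
  by (auto simp: Homs_algebras Homs_coalgebras lift_comonad_simps bialgebra_arrow_def)
    (auto simp: bialgebra_def)

definition to_coalgebra ::
    "(('o, 'm) str, ('o, 'm) str_arr) str \<Rightarrow> (('o, 'm) str, ('o, 'm) str_arr) str" where
  "to_coalgebra = (\<lambda>((a, f), (s, h, t)). ((a, h), ((a, h), f, Lc (a, h))))"

definition to_algebra ::
    "(('o, 'm) str, ('o, 'm) str_arr) str \<Rightarrow> (('o, 'm) str, ('o, 'm) str_arr) str" where
  "to_algebra = (\<lambda>((a, h), (s, f, t)). ((a, f), (Lm (a, f), h, (a, f))))"

text \<open>Both directions of the isomorphism keep the underlying arrow \<open>u\<close> and replace only the
objects at its ends; the first component of the new object is the inner (co)algebra.\<close>

definition on_arrows where
  "on_arrows G = \<lparr>FO = G, FA = (\<lambda>(s, (s', u, t'), t). (G s, (fst (G s), u, fst (G t)), G t))\<rparr>"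

theorem iso_algebras_coalgebras: "iso_functor XCT XTC (on_arrows to_coalgebra)"
  unfolding iso_functor_def
proof (intro conjI exI)
  have cats: "category XCT" "category XTC"
    using category_algebras monad_T' category_coalgebras comonad_C'
    by (auto simp: monad_def comonad_def nat_trans_def)
  note defs = on_arrows_def to_coalgebra_def to_algebra_def
  show "is_functor XCT XTC (on_arrows to_coalgebra)"
  proof (rule functorI[OF cats])
    show "FO (on_arrows to_coalgebra) y \<in> Obj XTC" if "y \<in> Obj XCT" for y
      using that unfolding Obj_XCT Obj_XTC by (auto simp: defs)
  next
    fix x y z assume x: "x \<in> Homs XCT y z"
    then have "y \<in> Obj XCT" "z \<in> Obj XCT" using category.HomsD[OF cats(1)] by auto
    with x show "FA (on_arrows to_coalgebra) x
        \<in> Homs XTC (FO (on_arrows to_coalgebra) y) (FO (on_arrows to_coalgebra) z)"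
      unfolding Obj_XCT by (auto simp: defs Homs_XCT Homs_XTC)
  next
    fix y assume "y \<in> Obj XCT"
    then show "FA (on_arrows to_coalgebra) (Ident XCT y)
      = Ident XTC (FO (on_arrows to_coalgebra) y)"
      unfolding Obj_XCT by (auto simp: defs)
  next
    fix x1 x2 y z w assume x: "x1 \<in> Homs XCT y z" "x2 \<in> Homs XCT z w"
    then have "y \<in> Obj XCT" "z \<in> Obj XCT" "w \<in> Obj XCT" using category.HomsD[OF cats(1)] by blast+
    with x show "FA (on_arrows to_coalgebra) (Cmp XCT x2 x1)
        = Cmp XTC (FA (on_arrows to_coalgebra) x2) (FA (on_arrows to_coalgebra) x1)"
      unfolding Obj_XCT by (auto simp: defs Homs_XCT)
  qed
  show "is_functor XTC XCT (on_arrows to_algebra)"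
  proof (rule functorI[OF cats(2) cats(1)])
    show "FO (on_arrows to_algebra) y \<in> Obj XCT" if "y \<in> Obj XTC" for y
      using that unfolding Obj_XCT Obj_XTC by (auto simp: defs)
  next
    fix x y z assume x: "x \<in> Homs XTC y z"
    then have "y \<in> Obj XTC" "z \<in> Obj XTC" using category.HomsD[OF cats(2)] by auto
    with x show "FA (on_arrows to_algebra) x
        \<in> Homs XCT (FO (on_arrows to_algebra) y) (FO (on_arrows to_algebra) z)"
      unfolding Obj_XTC by (auto simp: defs Homs_XCT Homs_XTC)
  next
    fix y assume "y \<in> Obj XTC"
    then show "FA (on_arrows to_algebra) (Ident XTC y) = Ident XCT (FO (on_arrows to_algebra) y)"
      unfolding Obj_XTC by (auto simp: defs)
  next
    fix x1 x2 y z w assume x: "x1 \<in> Homs XTC y z" "x2 \<in> Homs XTC z w"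
    then have "y \<in> Obj XTC" "z \<in> Obj XTC" "w \<in> Obj XTC" using category.HomsD[OF cats(2)] by blast+
    with x show "FA (on_arrows to_algebra) (Cmp XTC x2 x1)
        = Cmp XCT (FA (on_arrows to_algebra) x2) (FA (on_arrows to_algebra) x1)"
      unfolding Obj_XTC by (auto simp: defs Homs_XTC)
  qed
  show "functor_eq XCT (on_arrows to_algebra \<circ>\<^sub>F on_arrows to_coalgebra) id_func"
    unfolding functor_eq_def
  proof (intro conjI ballI)
    show "FO (on_arrows to_algebra \<circ>\<^sub>F on_arrows to_coalgebra) y = FO id_func y" if "y \<in> Obj XCT"
      for y
      using that unfolding Obj_XCT by (auto simp: defs comp_func_def id_func_def)
    fix x assume "x \<in> Arr XCT"
    then obtain y z where x: "x \<in> Homs XCT y z" by (simp add: Homs_def)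
    then have "y \<in> Obj XCT" "z \<in> Obj XCT" using category.HomsD[OF cats(1)] by auto
    with x show "FA (on_arrows to_algebra \<circ>\<^sub>F on_arrows to_coalgebra) x = FA id_func x"
      unfolding Obj_XCT by (auto simp: defs comp_func_def id_func_def Homs_XCT)
  qed
  show "functor_eq XTC (on_arrows to_coalgebra \<circ>\<^sub>F on_arrows to_algebra) id_func"
    unfolding functor_eq_def
  proof (intro conjI ballI)
    show "FO (on_arrows to_coalgebra \<circ>\<^sub>F on_arrows to_algebra) y = FO id_func y" if "y \<in> Obj XTC"
      for y
      using that unfolding Obj_XTC by (auto simp: defs comp_func_def id_func_def)
    fix x assume "x \<in> Arr XTC"
    then obtain y z where x: "x \<in> Homs XTC y z" by (simp add: Homs_def)
    then have "y \<in> Obj XTC" "z \<in> Obj XTC" using category.HomsD[OF cats(2)] by auto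
    with x show "FA (on_arrows to_coalgebra \<circ>\<^sub>F on_arrows to_algebra) x = FA id_func x"
      unfolding Obj_XTC by (auto simp: defs comp_func_def id_func_def Homs_XTC)
  qed
qed

end

section \<open>Mixed distributive laws from free structures\<close>

text \<open>\<open>S a P\<close> reads "\<open>P\<close> is a structure on the object \<open>a\<close>", \<open>H f P Q\<close> reads "\<open>f\<close> carries the
structure \<open>P\<close> to \<open>Q\<close>", and \<open>p a\<close> is the structure of the free object \<open>T a\<close>. In the application,
structures are Rota-Baxter operators. The last two assumptions characterise \<open>T f\<close> and the
multiplication as the structured extensions of \<open>unit \<circ> f\<close> and of the identity.\<close>

locale free_structures = category X for X :: "('o, 'm) cat" +
  fixes S :: "'o \<Rightarrow> 'p \<Rightarrow> bool" and H :: "'m \<Rightarrow> 'p \<Rightarrow> 'p \<Rightarrow> bool"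
    and T :: "('o, 'm) mnd" and p :: "'o \<Rightarrow> 'p"
  assumes H_ident: "a \<in> Obj X \<Longrightarrow> S a P \<Longrightarrow> H (Ident X a) P P"
    and H_comp: "f \<in> Homs X a b \<Longrightarrow> g \<in> Homs X b c \<Longrightarrow> H f P Q \<Longrightarrow> H g Q R \<Longrightarrow> H (Cmp X g f) P R"
    and T_obj: "a \<in> Obj X \<Longrightarrow> FO (MF T) a \<in> Obj X"
    and S_free: "a \<in> Obj X \<Longrightarrow> S (FO (MF T) a) (p a)"
    and unit_hom: "a \<in> Obj X \<Longrightarrow> unit T a \<in> Homs X a (FO (MF T) a)"
    and free: "f \<in> Homs X a b \<Longrightarrow> S b Q \<Longrightarrow>
      \<exists>!g. g \<in> Homs X (FO (MF T) a) b \<and> H g (p a) Q \<and> Cmp X g (unit T a) = f"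
    and T_arrow: "f \<in> Homs X a b \<Longrightarrow> FA (MF T) f \<in> Homs X (FO (MF T) a) (FO (MF T) b)
      \<and> H (FA (MF T) f) (p a) (p b) \<and> Cmp X (FA (MF T) f) (unit T a) = Cmp X (unit T b) f"
    and mu_arrow: "a \<in> Obj X \<Longrightarrow> mu T a \<in> Homs X (FO (MF T) (FO (MF T) a)) (FO (MF T) a)
      \<and> H (mu T a) (p (FO (MF T) a)) (p a)
      \<and> Cmp X (mu T a) (unit T (FO (MF T) a)) = Ident X (FO (MF T) a)"
begin

abbreviation "To \<equiv> FO (MF T)"
abbreviation "Ta \<equiv> FA (MF T)"

text \<open>All equations between arrows out of a free object are proved in this way: both sides are
structured, and they are compared after composing with the unit.\<close>

lemma free_unique:
  assumes "a \<in> Obj X" "S b Q" "g \<in> Homs X (To a) b" "g' \<in> Homs X (To a) b"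
    and "H g (p a) Q" "H g' (p a) Q" "g \<cdot> unit T a = g' \<cdot> unit T a"
  shows "g = g'"
proof -
  have "g \<cdot> unit T a \<in> Homs X a b" using assms cmp unit_hom by blast
  from free[OF this assms(2)] show ?thesis using assms by metis
qed

lemmas T_hom = T_arrow[THEN conjunct1]
  and T_H = T_arrow[THEN conjunct2, THEN conjunct1]
  and T_unit = T_arrow[THEN conjunct2, THEN conjunct2]
  and mu_hom = mu_arrow[THEN conjunct1]
  and mu_H = mu_arrow[THEN conjunct2, THEN conjunct1]
  and mu_unit = mu_arrow[THEN conjunct2, THEN conjunct2]

lemma functor_T: "is_functor X X (MF T)"
proof (rule functorI)
  show "category X" ..
  show "Ta (Ident X a) = Ident X (To a)" if a: "a \<in> Obj X" for a
  proof (rule free_unique[OF a S_free[OF a]])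
    show "Ta (Ident X a) \<cdot> unit T a = Ident X (To a) \<cdot> unit T a"
      using T_unit[OF ident[OF a]] ident_left ident_right unit_hom[OF a] by simp
  qed (use a T_hom T_H ident H_ident T_obj S_free in auto)
  show "Ta (g \<cdot> f) = Ta g \<cdot> Ta f" if f: "f \<in> Homs X a b" and g: "g \<in> Homs X b c" for f g a b c
  proof -
    have obj: "a \<in> Obj X" "b \<in> Obj X" "c \<in> Obj X" using f g HomsD by auto
    show ?thesis
    proof (rule free_unique[OF obj(1) S_free[OF obj(3)]])
      have "(Ta g \<cdot> Ta f) \<cdot> unit T a = Ta g \<cdot> unit T b \<cdot> f"
        using assoc[OF unit_hom[OF obj(1)] T_hom[OF f] T_hom[OF g]] T_unit[OF f] by simp
      also have "\<dots> = unit T c \<cdot> g \<cdot> f"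
        using assoc[OF f unit_hom[OF obj(2)] T_hom[OF g]] assoc[OF f g unit_hom[OF obj(3)]]
          T_unit[OF g] by simp
      finally show "Ta (g \<cdot> f) \<cdot> unit T a = (Ta g \<cdot> Ta f) \<cdot> unit T a"
        using T_unit[OF cmp[OF f g]] by simp
      show "H (Ta g \<cdot> Ta f) (p a) (p c)"
        using H_comp[OF T_hom[OF f] T_hom[OF g] T_H[OF f] T_H[OF g]] .
      show "H (Ta (g \<cdot> f)) (p a) (p c)" using T_H[OF cmp[OF f g]] .
    qed (fact T_hom[OF cmp[OF f g]] cmp[OF T_hom[OF f] T_hom[OF g]])+
  qed
qed (auto simp: T_obj T_hom category_axioms)

theorem monad_T: "monad X T"
  unfolding monad_def
proof (intro conjI ballI)
  note TT = comp_functor[OF functor_T functor_T]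
  show "nat_trans X X id_func (MF T) (unit T)"
    by (rule nat_transI[OF id_functor functor_T])
      (auto simp: id_func_def unit_hom T_unit category_axioms)
  show "nat_trans X X (MF T \<circ>\<^sub>F MF T) (MF T) (mu T)"
  proof (rule nat_transI[OF TT functor_T])
    show "mu T a \<in> Homs X (FO (MF T \<circ>\<^sub>F MF T) a) (To a)" if "a \<in> Obj X" for a
      using that by (simp add: comp_func_def mu_hom)
    fix f a b assume f: "f \<in> Homs X a b"
    then have a: "a \<in> Obj X" and b: "b \<in> Obj X" using HomsD by auto
    note Tf = T_hom[OF f] and TTf = T_hom[OF T_hom[OF f]]
    have "mu T b \<cdot> Ta (Ta f) = Ta f \<cdot> mu T a"
    proof (rule free_unique[OF T_obj[OF a] S_free[OF b]])
      have "(mu T b \<cdot> Ta (Ta f)) \<cdot> unit T (To a) = mu T b \<cdot> unit T (To b) \<cdot> Ta f"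
        using assoc[OF unit_hom[OF T_obj[OF a]] TTf mu_hom[OF b]] T_unit[OF Tf] by simp
      also have "\<dots> = Ta f"
        using assoc[OF Tf unit_hom[OF T_obj[OF b]] mu_hom[OF b]] mu_unit[OF b] ident_left[OF Tf]
        by simp
      also have "\<dots> = (Ta f \<cdot> mu T a) \<cdot> unit T (To a)"
        using assoc[OF unit_hom[OF T_obj[OF a]] mu_hom[OF a] Tf] mu_unit[OF a] ident_right[OF Tf]
        by simp
      finally show "(mu T b \<cdot> Ta (Ta f)) \<cdot> unit T (To a) = (Ta f \<cdot> mu T a) \<cdot> unit T (To a)" .
      show "H (mu T b \<cdot> Ta (Ta f)) (p (To a)) (p b)" "H (Ta f \<cdot> mu T a) (p (To a)) (p b)"
        using H_comp[OF TTf mu_hom[OF b] T_H[OF Tf] mu_H[OF b]]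
          H_comp[OF mu_hom[OF a] Tf mu_H[OF a] T_H[OF f]] .
    qed (fact cmp[OF TTf mu_hom[OF b]] cmp[OF mu_hom[OF a] Tf])+
    then show "mu T b \<cdot> FA (MF T \<circ>\<^sub>F MF T) f = Ta f \<cdot> mu T a" by (simp add: comp_func_def)
  qed
  fix a assume a: "a \<in> Obj X"
  note Ta = T_obj[OF a] and TTa = T_obj[OF T_obj[OF a]]
  show "mu T a \<cdot> unit T (To a) = Ident X (To a)" using mu_unit[OF a] .
  note Tu = T_hom[OF unit_hom[OF a]]
  show "mu T a \<cdot> Ta (unit T a) = Ident X (To a)"
  proof (rule free_unique[OF a S_free[OF a]])
    have "(mu T a \<cdot> Ta (unit T a)) \<cdot> unit T a = mu T a \<cdot> unit T (To a) \<cdot> unit T a"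
      using assoc[OF unit_hom[OF a] Tu mu_hom[OF a]] T_unit[OF unit_hom[OF a]] by simp
    then show "(mu T a \<cdot> Ta (unit T a)) \<cdot> unit T a = Ident X (To a) \<cdot> unit T a"
      using assoc[OF unit_hom[OF a] unit_hom[OF Ta] mu_hom[OF a]] mu_unit[OF a] by simp
    show "H (mu T a \<cdot> Ta (unit T a)) (p a) (p a)" "H (Ident X (To a)) (p a) (p a)"
      using H_comp[OF Tu mu_hom[OF a] T_H[OF unit_hom[OF a]] mu_H[OF a]]
        H_ident[OF Ta S_free[OF a]] .
  qed (fact cmp[OF Tu mu_hom[OF a]] ident[OF Ta])+
  note T\<mu> = T_hom[OF mu_hom[OF a]] and \<mu>T = mu_hom[OF Ta]
  show "mu T a \<cdot> mu T (To a) = mu T a \<cdot> Ta (mu T a)"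
  proof (rule free_unique[OF TTa S_free[OF a]])
    have "(mu T a \<cdot> mu T (To a)) \<cdot> unit T (To (To a)) = mu T a"
      using assoc[OF unit_hom[OF TTa] \<mu>T mu_hom[OF a]] mu_unit[OF Ta] ident_right[OF mu_hom[OF a]]
      by simp
    also have "\<dots> = mu T a \<cdot> unit T (To a) \<cdot> mu T a"
      using assoc[OF mu_hom[OF a] unit_hom[OF Ta] mu_hom[OF a]] mu_unit[OF a]
        ident_left[OF mu_hom[OF a]] by simp
    also have "\<dots> = (mu T a \<cdot> Ta (mu T a)) \<cdot> unit T (To (To a))"
      using assoc[OF unit_hom[OF TTa] T\<mu> mu_hom[OF a]] T_unit[OF mu_hom[OF a]] by simp
    finally show "(mu T a \<cdot> mu T (To a)) \<cdot> unit T (To (To a))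
      = (mu T a \<cdot> Ta (mu T a)) \<cdot> unit T (To (To a))" .
    show "H (mu T a \<cdot> mu T (To a)) (p (To (To a))) (p a)"
      "H (mu T a \<cdot> Ta (mu T a)) (p (To (To a))) (p a)"
      using H_comp[OF \<mu>T mu_hom[OF a] mu_H[OF Ta] mu_H[OF a]]
        H_comp[OF T\<mu> mu_hom[OF a] T_H[OF mu_hom[OF a]] mu_H[OF a]] .
  qed (fact cmp[OF \<mu>T mu_hom[OF a]] cmp[OF T\<mu> mu_hom[OF a]])+
qed

end

text \<open>The comonad \<open>C\<close> lifts to structured objects, acting on structures by \<open>L\<close>, and \<open>\<beta>\<close> is the
structured extension of \<open>C unit\<close>.\<close>

locale lifted_comonad = free_structures X S H T p
  for X :: "('o, 'm) cat" and S :: "'o \<Rightarrow> 'p \<Rightarrow> bool" and H and T and p +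
  fixes C :: "('o, 'm) cmnd" and L :: "'p \<Rightarrow> 'p" and \<beta> :: "'o \<Rightarrow> 'm"
  assumes comonad_C: "comonad X C"
    and L_struct: "a \<in> Obj X \<Longrightarrow> S a P \<Longrightarrow> S (FO (CF C) a) (L P)"
    and C_H: "f \<in> Homs X a b \<Longrightarrow> H f P Q \<Longrightarrow> H (FA (CF C) f) (L P) (L Q)"
    and counit_H: "a \<in> Obj X \<Longrightarrow> S a P \<Longrightarrow> H (counit C a) (L P) P"
    and delta_H: "a \<in> Obj X \<Longrightarrow> S a P \<Longrightarrow> H (delta C a) (L P) (L (L P))"
    and beta: "a \<in> Obj X \<Longrightarrow> \<beta> a \<in> Homs X (FO (MF T) (FO (CF C) a)) (FO (CF C) (FO (MF T) a))
      \<and> H (\<beta> a) (p (FO (CF C) a)) (L (p a))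
      \<and> Cmp X (\<beta> a) (unit T (FO (CF C) a)) = FA (CF C) (unit T a)"
begin

abbreviation "Co \<equiv> FO (CF C)"
abbreviation "Ca \<equiv> FA (CF C)"

lemma nat_counit: "nat_trans X X (CF C) id_func (counit C)"
  and nat_delta: "nat_trans X X (CF C) (CF C \<circ>\<^sub>F CF C) (delta C)"
  using comonad_C by (auto simp: comonad_def)

lemmas functor_C = nat_transD(1)[OF nat_counit]
lemmas C_obj = functorD(3)[OF functor_C]
  and C_hom = functorD(4)[OF functor_C]
  and C_comp = functorD(6)[OF functor_C]
  and counit_hom = nat_transD(3)[OF nat_counit, unfolded id_func_def, simplified]
  and counit_nat = nat_transD(4)[OF nat_counit, unfolded id_func_def, simplified]
  and delta_hom = nat_transD(3)[OF nat_delta, unfolded comp_func_def, simplified]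
  and delta_nat = nat_transD(4)[OF nat_delta, unfolded comp_func_def, simplified]

lemmas beta_hom = beta[THEN conjunct1]
  and beta_H = beta[THEN conjunct2, THEN conjunct1]
  and beta_unit = beta[THEN conjunct2, THEN conjunct2]

text \<open>The unit law is part of the description of \<open>\<beta>\<close>. In naturality and in the other laws, both
sides are structured arrows out of a free object. Composed with the unit, they become equal: for
the laws of the counit and the comultiplication, by naturality of these at the unit of \<open>T\<close>; for
the law of the multiplication, both sides reduce to \<open>\<beta>\<close> itself.\<close>

theorem mixed_distributive_law: "mixed_distributive_law X T C \<beta>"
  unfolding mixed_distributive_law_def
proof (intro conjI ballI)
  show "monad X T" by (rule monad_T)
  show "comonad X C" by (rule comonad_C)
  show "nat_trans X X (MF T \<circ>\<^sub>F CF C) (CF C \<circ>\<^sub>F MF T) \<beta>"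
  proof (rule nat_transI[OF comp_functor[OF functor_C functor_T] comp_functor[OF functor_T functor_C]])
    show "\<beta> a \<in> Homs X (FO (MF T \<circ>\<^sub>F CF C) a) (FO (CF C \<circ>\<^sub>F MF T) a)" if "a \<in> Obj X" for a
      using that by (simp add: comp_func_def beta_hom)
    fix f a b assume f: "f \<in> Homs X a b"
    then have a: "a \<in> Obj X" and b: "b \<in> Obj X" using HomsD by auto
    note Cf = C_hom[OF f]
    have "\<beta> b \<cdot> Ta (Ca f) = Ca (Ta f) \<cdot> \<beta> a"
    proof (rule free_unique[OF C_obj[OF a] L_struct[OF T_obj[OF b] S_free[OF b]]])
      have "(\<beta> b \<cdot> Ta (Ca f)) \<cdot> unit T (Co a) = \<beta> b \<cdot> unit T (Co b) \<cdot> Ca f"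
        using assoc[OF unit_hom[OF C_obj[OF a]] T_hom[OF Cf] beta_hom[OF b]] T_unit[OF Cf] by simp
      also have "\<dots> = Ca (unit T b) \<cdot> Ca f"
        using assoc[OF Cf unit_hom[OF C_obj[OF b]] beta_hom[OF b]] beta_unit[OF b] by simp
      also have "\<dots> = Ca (Ta f) \<cdot> Ca (unit T a)"
        using C_comp[OF f unit_hom[OF b]] C_comp[OF unit_hom[OF a] T_hom[OF f]] T_unit[OF f] by simp
      also have "\<dots> = (Ca (Ta f) \<cdot> \<beta> a) \<cdot> unit T (Co a)"
        using assoc[OF unit_hom[OF C_obj[OF a]] beta_hom[OF a] C_hom[OF T_hom[OF f]]]
          beta_unit[OF a]
        by simp
      finally show "(\<beta> b \<cdot> Ta (Ca f)) \<cdot> unit T (Co a) = (Ca (Ta f) \<cdot> \<beta> a) \<cdot> unit T (Co a)" .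
      show "H (\<beta> b \<cdot> Ta (Ca f)) (p (Co a)) (L (p b))" "H (Ca (Ta f) \<cdot> \<beta> a) (p (Co a)) (L (p b))"
        using H_comp[OF T_hom[OF Cf] beta_hom[OF b] T_H[OF Cf] beta_H[OF b]]
          H_comp[OF beta_hom[OF a] C_hom[OF T_hom[OF f]] beta_H[OF a] C_H[OF T_hom[OF f] T_H[OF f]]] .
    qed (fact cmp[OF T_hom[OF Cf] beta_hom[OF b]] cmp[OF beta_hom[OF a] C_hom[OF T_hom[OF f]]])+
    then show "\<beta> b \<cdot> FA (MF T \<circ>\<^sub>F CF C) f = FA (CF C \<circ>\<^sub>F MF T) f \<cdot> \<beta> a"
      by (simp add: comp_func_def)
  qed
  fix a assume a: "a \<in> Obj X"
  note Ca = C_obj[OF a] and Ta = T_obj[OF a]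
  note \<epsilon> = counit_hom[OF a] and \<delta> = delta_hom[OF a]
  show "\<beta> a \<cdot> unit T (Co a) = Ca (unit T a)" using beta_unit[OF a] .
  show "counit C (To a) \<cdot> \<beta> a = Ta (counit C a)"
  proof (rule free_unique[OF Ca S_free[OF a]])
    show "(counit C (To a) \<cdot> \<beta> a) \<cdot> unit T (Co a) = Ta (counit C a) \<cdot> unit T (Co a)"
      using assoc[OF unit_hom[OF Ca] beta_hom[OF a] counit_hom[OF Ta]] beta_unit[OF a]
        counit_nat[OF unit_hom[OF a]] T_unit[OF \<epsilon>] by simp
    show "H (counit C (To a) \<cdot> \<beta> a) (p (Co a)) (p a)" "H (Ta (counit C a)) (p (Co a)) (p a)"
      using H_comp[OF beta_hom[OF a] counit_hom[OF Ta] beta_H[OF a] counit_H[OF Ta S_free[OF a]]]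
        T_H[OF \<epsilon>] .
  qed (fact cmp[OF beta_hom[OF a] counit_hom[OF Ta]] T_hom[OF \<epsilon>])+
  have C\<beta>: "Ca (\<beta> a) \<in> Homs X (Co (To (Co a))) (Co (Co (To a)))"
    and \<beta>C: "\<beta> (Co a) \<in> Homs X (To (Co (Co a))) (Co (To (Co a)))"
    and T\<delta>: "Ta (delta C a) \<in> Homs X (To (Co a)) (To (Co (Co a)))"
    and LL: "S (Co (Co (To a))) (L (L (p a)))" and L: "S (Co (To a)) (L (p a))"
    using a by (auto intro: C_hom T_hom beta_hom delta_hom C_obj T_obj L_struct S_free)
  show "delta C (To a) \<cdot> \<beta> a = Ca (\<beta> a) \<cdot> \<beta> (Co a) \<cdot> Ta (delta C a)"
  proof (rule free_unique[OF Ca LL])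
    have "(Ca (\<beta> a) \<cdot> \<beta> (Co a) \<cdot> Ta (delta C a)) \<cdot> unit T (Co a)
        = Ca (\<beta> a) \<cdot> (\<beta> (Co a) \<cdot> Ta (delta C a)) \<cdot> unit T (Co a)"
      using assoc[OF unit_hom[OF Ca] cmp[OF T\<delta> \<beta>C] C\<beta>] by simp
    also have "\<dots> = Ca (\<beta> a) \<cdot> \<beta> (Co a) \<cdot> unit T (Co (Co a)) \<cdot> delta C a"
      using assoc[OF unit_hom[OF Ca] T\<delta> \<beta>C] T_unit[OF \<delta>] by simp
    also have "\<dots> = Ca (\<beta> a) \<cdot> Ca (unit T (Co a)) \<cdot> delta C a"
      using assoc[OF \<delta> unit_hom[OF C_obj[OF Ca]] \<beta>C] beta_unit[OF Ca] by simp
    also have "\<dots> = Ca (Ca (unit T a)) \<cdot> delta C a"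
      using assoc[OF \<delta> C_hom[OF unit_hom[OF Ca]] C\<beta>] C_comp[OF unit_hom[OF Ca] beta_hom[OF a]]
        beta_unit[OF a] by simp
    also have "\<dots> = (delta C (To a) \<cdot> \<beta> a) \<cdot> unit T (Co a)"
      using assoc[OF unit_hom[OF Ca] beta_hom[OF a] delta_hom[OF Ta]] beta_unit[OF a]
        delta_nat[OF unit_hom[OF a]] by simp
    finally show "(delta C (To a) \<cdot> \<beta> a) \<cdot> unit T (Co a)
      = (Ca (\<beta> a) \<cdot> \<beta> (Co a) \<cdot> Ta (delta C a)) \<cdot> unit T (Co a)" by simp
    show "H (delta C (To a) \<cdot> \<beta> a) (p (Co a)) (L (L (p a)))"
      by (rule H_comp[OF beta_hom[OF a] delta_hom[OF Ta] beta_H[OF a] delta_H[OF Ta S_free[OF a]]])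
    have "H (\<beta> (Co a) \<cdot> Ta (delta C a)) (p (Co a)) (L (p (Co a)))"
      by (rule H_comp[OF T\<delta> \<beta>C T_H[OF \<delta>] beta_H[OF Ca]])
    then show "H (Ca (\<beta> a) \<cdot> \<beta> (Co a) \<cdot> Ta (delta C a)) (p (Co a)) (L (L (p a)))"
      by (rule H_comp[OF cmp[OF T\<delta> \<beta>C] C\<beta> _ C_H[OF beta_hom[OF a] beta_H[OF a]]])
  qed (fact cmp[OF beta_hom[OF a] delta_hom[OF Ta]] cmp[OF cmp[OF T\<delta> \<beta>C] C\<beta>])+
  have T\<beta>: "Ta (\<beta> a) \<in> Homs X (To (To (Co a))) (To (Co (To a)))"
    and \<beta>T: "\<beta> (To a) \<in> Homs X (To (Co (To a))) (Co (To (To a)))"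
    and C\<mu>: "Ca (mu T a) \<in> Homs X (Co (To (To a))) (Co (To a))"
    and \<mu>C: "mu T (Co a) \<in> Homs X (To (To (Co a))) (To (Co a))"
    using a by (auto intro: C_hom T_hom beta_hom mu_hom C_obj T_obj)
  note \<beta> = beta_hom[OF a] and TCa = T_obj[OF Ca] and CTa = C_obj[OF Ta]
  show "\<beta> a \<cdot> mu T (Co a) = Ca (mu T a) \<cdot> \<beta> (To a) \<cdot> Ta (\<beta> a)"
  proof (rule free_unique[OF TCa L])
    have "(Ca (mu T a) \<cdot> \<beta> (To a) \<cdot> Ta (\<beta> a)) \<cdot> unit T (To (Co a))
        = Ca (mu T a) \<cdot> (\<beta> (To a) \<cdot> Ta (\<beta> a)) \<cdot> unit T (To (Co a))"
      using assoc[OF unit_hom[OF TCa] cmp[OF T\<beta> \<beta>T] C\<mu>] by simp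
    also have "\<dots> = Ca (mu T a) \<cdot> \<beta> (To a) \<cdot> unit T (Co (To a)) \<cdot> \<beta> a"
      using assoc[OF unit_hom[OF TCa] T\<beta> \<beta>T] T_unit[OF \<beta>] by simp
    also have "\<dots> = Ca (mu T a) \<cdot> Ca (unit T (To a)) \<cdot> \<beta> a"
      using assoc[OF \<beta> unit_hom[OF CTa] \<beta>T] beta_unit[OF Ta] by simp
    also have "\<dots> = \<beta> a"
      using assoc[OF \<beta> C_hom[OF unit_hom[OF Ta]] C\<mu>] C_comp[OF unit_hom[OF Ta] mu_hom[OF a]]
        mu_unit[OF a] functorD(5)[OF functor_C Ta] ident_left[OF \<beta>] by simp
    also have "\<dots> = (\<beta> a \<cdot> mu T (Co a)) \<cdot> unit T (To (Co a))"
      using assoc[OF unit_hom[OF TCa] \<mu>C \<beta>] mu_unit[OF Ca] ident_right[OF \<beta>] by simp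
    finally show "(\<beta> a \<cdot> mu T (Co a)) \<cdot> unit T (To (Co a))
      = (Ca (mu T a) \<cdot> \<beta> (To a) \<cdot> Ta (\<beta> a)) \<cdot> unit T (To (Co a))" by simp
    show "H (\<beta> a \<cdot> mu T (Co a)) (p (To (Co a))) (L (p a))"
      by (rule H_comp[OF \<mu>C \<beta> mu_H[OF Ca] beta_H[OF a]])
    have "H (\<beta> (To a) \<cdot> Ta (\<beta> a)) (p (To (Co a))) (L (p (To a)))"
      by (rule H_comp[OF T\<beta> \<beta>T T_H[OF \<beta>] beta_H[OF Ta]])
    then show "H (Ca (mu T a) \<cdot> \<beta> (To a) \<cdot> Ta (\<beta> a)) (p (To (Co a))) (L (p a))"
      by (rule H_comp[OF cmp[OF T\<beta> \<beta>T] C\<mu> _ C_H[OF mu_hom[OF a] mu_H[OF a]]])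
  qed (fact cmp[OF \<mu>C \<beta>] cmp[OF cmp[OF T\<beta> \<beta>T] C\<mu>])+
qed

end

section \<open>The Hurwitz product\<close>

abbreviation (input) shift :: "(nat \<Rightarrow> 'b) \<Rightarrow> nat \<Rightarrow> 'b" where "shift f \<equiv> \<lambda>n. f (Suc n)"

text \<open>The shift \<open>d\<close> is a derivation of weight \<open>\<lambda>\<close> for the product of sequences: \<open>d (f g) = d f g
+ f d g + \<lambda> d f d g\<close>. Together with \<open>(f g) 0 = f 0 g 0\<close> this determines the product, and it
turns the algebra laws into inductions on the index that need no binomial coefficients.\<close>

primrec hurwitz :: "'k \<Rightarrow> ('k, 'b) module \<Rightarrow> (nat \<Rightarrow> 'b) \<Rightarrow> (nat \<Rightarrow> 'b) \<Rightarrow> nat \<Rightarrow> 'b" where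
  "hurwitz lam A f g 0 = f 0 \<otimes>\<^bsub>A\<^esub> g 0"
| "hurwitz lam A f g (Suc n) = (hurwitz lam A (shift f) g n \<oplus>\<^bsub>A\<^esub> hurwitz lam A f (shift g) n)
     \<oplus>\<^bsub>A\<^esub> lam \<odot>\<^bsub>A\<^esub> hurwitz lam A (shift f) (shift g) n"

locale weighted_algebra = algebra K A for K :: "('k, 'z) ring_scheme" and A :: "('k, 'b) module" +
  fixes lam :: 'k
  assumes lam: "lam \<in> carrier K"
begin

abbreviation hz :: "(nat \<Rightarrow> 'b) \<Rightarrow> (nat \<Rightarrow> 'b) \<Rightarrow> nat \<Rightarrow> 'b" where "hz \<equiv> hurwitz lam A"

lemma hz_closed [simp]: "\<lbrakk>\<And>n. f n \<in> carrier A; \<And>n. g n \<in> carrier A\<rbrakk> \<Longrightarrow> hz f g n \<in> carrier A"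
  by (induction n arbitrary: f g) (auto simp: lam)

lemma hz_comm: "\<lbrakk>\<And>n. f n \<in> carrier A; \<And>n. g n \<in> carrier A\<rbrakk> \<Longrightarrow> hz f g n = hz g f n"
proof (induction n arbitrary: f g)
  case (Suc n)
  have "hz (shift f) g n = hz g (shift f) n" "hz f (shift g) n = hz (shift g) f n"
    "hz (shift f) (shift g) n = hz (shift g) (shift f) n"
    by (rule Suc.IH; simp add: Suc.prems)+
  then show ?case using Suc.prems by (simp add: M.a_comm)
qed (simp add: m_comm)

lemma hz_add_left:
  "\<lbrakk>\<And>n. f n \<in> carrier A; \<And>n. f' n \<in> carrier A; \<And>n. g n \<in> carrier A\<rbrakk>
    \<Longrightarrow> hz (\<lambda>n. f n \<oplus>\<^bsub>A\<^esub> f' n) g n = hz f g n \<oplus>\<^bsub>A\<^esub> hz f' g n"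
  by (induction n arbitrary: f f' g) (simp_all add: M.a_ac l_distr lam smult_r_distr)

lemma hz_smult_left:
  "\<lbrakk>c \<in> carrier K; \<And>n. f n \<in> carrier A; \<And>n. g n \<in> carrier A\<rbrakk>
    \<Longrightarrow> hz (\<lambda>n. c \<odot>\<^bsub>A\<^esub> f n) g n = c \<odot>\<^bsub>A\<^esub> hz f g n"
  by (induction n arbitrary: f g)
    (simp_all add: lam smult_r_distr smult_assoc1[symmetric] R.m_comm smult_assoc2)

lemma hz_zero_left: "(\<And>n. g n \<in> carrier A) \<Longrightarrow> hz (\<lambda>n. \<zero>\<^bsub>A\<^esub>) g n = \<zero>\<^bsub>A\<^esub>"
  by (induction n arbitrary: g) (simp_all add: lam)

lemma hz_one_left:
  "(\<And>n. g n \<in> carrier A) \<Longrightarrow> hz (\<lambda>n. if n = 0 then \<one>\<^bsub>A\<^esub> else \<zero>\<^bsub>A\<^esub>) g n = g n"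
  by (induction n arbitrary: g) (simp_all add: lam hz_zero_left)

lemma hz_add_right:
  "\<lbrakk>\<And>n. f n \<in> carrier A; \<And>n. f' n \<in> carrier A; \<And>n. g n \<in> carrier A\<rbrakk>
    \<Longrightarrow> hz g (\<lambda>n. f n \<oplus>\<^bsub>A\<^esub> f' n) n = hz g f n \<oplus>\<^bsub>A\<^esub> hz g f' n"
  using hz_add_left[of f f' g n] hz_comm[of g] by simp

lemma hz_smult_right:
  "\<lbrakk>c \<in> carrier K; \<And>n. f n \<in> carrier A; \<And>n. g n \<in> carrier A\<rbrakk>
    \<Longrightarrow> hz g (\<lambda>n. c \<odot>\<^bsub>A\<^esub> f n) n = c \<odot>\<^bsub>A\<^esub> hz g f n"
  using hz_smult_left[of c f g n] hz_comm[of g] by simp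

text \<open>By the derivation rule, the shifts of both sides expand into the same seven triple
products of \<open>f\<close>, \<open>g\<close>, \<open>h\<close> and their shifts, at the previous index.\<close>

lemma hz_assoc:
  "\<lbrakk>\<And>n. f n \<in> carrier A; \<And>n. g n \<in> carrier A; \<And>n. h n \<in> carrier A\<rbrakk>
    \<Longrightarrow> hz (hz f g) h n = hz f (hz g h) n"
proof (induction n arbitrary: f g h)
  case (Suc n)
  note cl = Suc.prems
  have IH: "hz (hz f' g') h' n = hz f' (hz g' h') n"
    if "f' = f \<or> f' = shift f" "g' = g \<or> g' = shift g" "h' = h \<or> h' = shift h" for f' g' h'
    by (rule Suc.IH) (use that cl in auto)
  show ?case
    using cl lam
    by (simp add: hz_add_left hz_add_right hz_smult_left hz_smult_right IH smult_r_distr M.a_ac)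
qed (simp add: m_assoc)

section \<open>The binomial formula for the Hurwitz product\<close>

text \<open>The expansion of \<open>(X + Y)\<^sup>n\<close> with \<open>G a b\<close> in place of \<open>X\<^sup>a Y\<^sup>b\<close>.\<close>

definition binomial_sum :: "nat \<Rightarrow> (nat \<Rightarrow> nat \<Rightarrow> 'b) \<Rightarrow> 'b" where
  "binomial_sum n G = (\<Oplus>\<^bsub>A\<^esub>j\<in>{..n}. add_pow A (n choose j) (G (n - j) j))"

lemma binomial_sum_closed [simp]: "(\<And>a b. G a b \<in> carrier A) \<Longrightarrow> binomial_sum n G \<in> carrier A"
  by (simp add: binomial_sum_def)

lemma add_pow_smult:
  "\<lbrakk>c \<in> carrier K; x \<in> carrier A\<rbrakk> \<Longrightarrow> c \<odot>\<^bsub>A\<^esub> add_pow A (n :: nat) x = add_pow A n (c \<odot>\<^bsub>A\<^esub> x)"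
  by (induction n) (simp_all add: smult_r_distr)

lemma add_pow_finsum:
  "\<lbrakk>finite I; \<And>i. i \<in> I \<Longrightarrow> f i \<in> carrier A\<rbrakk>
    \<Longrightarrow> add_pow A (n :: nat) (finsum A f I) = (\<Oplus>\<^bsub>A\<^esub>i\<in>I. add_pow A n (f i))"
  by (induction I rule: finite_induct) (simp_all add: Pi_def M.add.nat_pow_distrib)

lemma binomial_sum_add:
  "\<lbrakk>\<And>a b. G a b \<in> carrier A; \<And>a b. G' a b \<in> carrier A\<rbrakk>
    \<Longrightarrow> binomial_sum n (\<lambda>a b. G a b \<oplus>\<^bsub>A\<^esub> G' a b) = binomial_sum n G \<oplus>\<^bsub>A\<^esub> binomial_sum n G'"
  by (simp add: binomial_sum_def M.add.nat_pow_distrib M.finsum_addf)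

lemma binomial_sum_smult:
  "\<lbrakk>c \<in> carrier K; \<And>a b. G a b \<in> carrier A\<rbrakk>
    \<Longrightarrow> binomial_sum n (\<lambda>a b. c \<odot>\<^bsub>A\<^esub> G a b) = c \<odot>\<^bsub>A\<^esub> binomial_sum n G"
  by (simp add: binomial_sum_def finsum_smult_ldistr add_pow_smult)

lemma binomial_sum_Suc:
  assumes G: "\<And>a b. G a b \<in> carrier A"
  shows "binomial_sum (Suc n) G
    = binomial_sum n (\<lambda>a b. G (Suc a) b) \<oplus>\<^bsub>A\<^esub> binomial_sum n (\<lambda>a b. G a (Suc b))"
proof -
  \<comment> \<open>Pascal's rule splits the summand at \<open>j\<close> into \<open>L j\<close> and \<open>R j\<close>; \<open>L (Suc n)\<close> and \<open>R 0\<close> vanish.\<close>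
  define L where "L = (\<lambda>j. add_pow A (n choose j) (G (Suc n - j) j))"
  define R where "R = (\<lambda>j. if j = 0 then \<zero>\<^bsub>A\<^esub> else add_pow A (n choose (j - 1)) (G (Suc n - j) j))"
  have cl: "L j \<in> carrier A" "R j \<in> carrier A" for j using G by (auto simp: L_def R_def)
  have "binomial_sum (Suc n) G = (\<Oplus>\<^bsub>A\<^esub>j\<in>{..Suc n}. L j \<oplus>\<^bsub>A\<^esub> R j)"
    unfolding binomial_sum_def
  proof (rule M.finsum_cong')
    fix j
    show "add_pow A (Suc n choose j) (G (Suc n - j) j) = L j \<oplus>\<^bsub>A\<^esub> R j"
      using G by (cases j) (auto simp: L_def R_def M.add.nat_pow_mult add.commute)
  qed (use cl in auto)
  also have "\<dots> = finsum A L {..Suc n} \<oplus>\<^bsub>A\<^esub> finsum A R {..Suc n}"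
    using cl by (intro M.finsum_addf) auto
  also have "finsum A L {..Suc n} = finsum A L {..n}"
    using cl G by (subst M.finsum_Suc) (auto simp: L_def binomial_eq_0)
  also have "finsum A L {..n} = binomial_sum n (\<lambda>a b. G (Suc a) b)"
    unfolding binomial_sum_def
    by (rule M.finsum_cong') (use G in \<open>auto simp: L_def Suc_diff_le\<close>)
  also have "finsum A R {..Suc n} = finsum A (\<lambda>j. R (Suc j)) {..n}"
    using cl G by (subst M.finsum_Suc2) (auto simp: R_def)
  also have "\<dots> = binomial_sum n (\<lambda>a b. G a (Suc b))"
    unfolding binomial_sum_def
    by (rule M.finsum_cong') (use G in \<open>auto simp: R_def\<close>)
  finally show ?thesis .
qed

text \<open>By the derivation rule, the value of the product at \<open>n\<close> is \<open>(X + Y + Z)\<^sup>n\<close> applied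
to \<open>f \<otimes> g\<close> and evaluated at \<open>0\<close>, where \<open>X\<close> shifts the first factor, \<open>Y\<close> the second, and \<open>Z\<close>
shifts both and multiplies by \<open>\<lambda>\<close>. The double sum is its trinomial expansion, written as two
nested binomial ones; \<open>F f g a b c\<close> in the proof is the term of \<open>X\<^sup>a Y\<^sup>b
Z\<^sup>c\<close>.\<close>

lemma Seq_mult_eq_hurwitz:
  assumes "\<And>n. f n \<in> carrier A" "\<And>n. g n \<in> carrier A"
  shows "Seq_mult lam K A f g n = hz f g n"
proof -
  define F where "F f g a b c = (lam [^]\<^bsub>K\<^esub> c) \<odot>\<^bsub>A\<^esub> (f (a + c) \<otimes>\<^bsub>A\<^esub> g (b + c))"
    for f g :: "nat \<Rightarrow> 'b" and a b c :: nat
  have "binomial_sum n (\<lambda>m c. binomial_sum m (\<lambda>a b. F f g a b c)) = hz f g n"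
    using assms
  proof (induction n arbitrary: f g)
    case 0
    then show ?case by (simp add: binomial_sum_def F_def)
  next
    case (Suc n)
    have cl: "F f' g' a b c \<in> carrier A"
      if "f' = f \<or> f' = shift f" "g' = g \<or> g' = shift g" for f' g' a b c
      using that Suc.prems by (auto simp: F_def lam)
    have F: "F f g (Suc a) b c = F (shift f) g a b c" "F f g a (Suc b) c = F f (shift g) a b c"
      "F f g a b (Suc c) = lam \<odot>\<^bsub>A\<^esub> F (shift f) (shift g) a b c" for a b c
      using Suc.prems
      by (simp_all add: F_def lam smult_assoc1[symmetric] R.m_comm)
    show ?case
      by (simp add: binomial_sum_Suc binomial_sum_add binomial_sum_smult cl F lam Suc.IH Suc.prems)
  qed
  moreover have "Seq_mult lam K A f g n = binomial_sum n (\<lambda>m c. binomial_sum m (\<lambda>a b. F f g a b c))"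
    unfolding Seq_mult_def binomial_sum_def atLeast0AtMost
  proof (rule M.finsum_cong')
    fix k assume k: "k \<in> {..n}"
    have "add_pow A (n choose k) (\<Oplus>\<^bsub>A\<^esub>j\<in>{..n - k}. add_pow A (n - k choose j) (F f g (n - k - j) j k))
      = (\<Oplus>\<^bsub>A\<^esub>j\<in>{..n - k}. add_pow A (n choose k) 
          (add_pow A (n - k choose j) (F f g (n - k - j) j k)))"
      by (rule add_pow_finsum) (use assms in \<open>auto simp: F_def lam\<close>)
    also have "\<dots> = (\<Oplus>\<^bsub>A\<^esub>j\<in>{..n - k}.
        add_pow A ((n choose k) * (n - k choose j)) (lam [^]\<^bsub>K\<^esub> k \<odot>\<^bsub>A\<^esub> (f (n - j) \<otimes>\<^bsub>A\<^esub> g (k + j))))"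
      by (rule M.finsum_cong')
        (use assms k in \<open>auto simp: F_def lam M.add.nat_pow_pow ac_simps\<close>)
    finally show "(\<Oplus>\<^bsub>A\<^esub>j\<in>{..n - k}.
        add_pow A ((n choose k) * (n - k choose j)) (lam [^]\<^bsub>K\<^esub> k \<odot>\<^bsub>A\<^esub> (f (n - j) \<otimes>\<^bsub>A\<^esub> g (k + j))))
      = add_pow A (n choose k) (\<Oplus>\<^bsub>A\<^esub>j\<in>{..n - k}. add_pow A (n - k choose j) (F f g (n - k - j) j k))"
      by simp
  qed (use assms in \<open>auto simp: F_def lam\<close>)
  ultimately show ?thesis by simp
qed

end


section \<open>The category of commutative algebras\<close>

lemma alg_homI:
  assumes "\<And>x. x \<in> carrier A \<Longrightarrow> f x \<in> carrier B"
    and "\<And>x y. x \<in> carrier A \<Longrightarrow> y \<in> carrier A \<Longrightarrow> f (x \<otimes>\<^bsub>A\<^esub> y) = f x \<otimes>\<^bsub>B\<^esub> f y"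
    and "\<And>x y. x \<in> carrier A \<Longrightarrow> y \<in> carrier A \<Longrightarrow> f (x \<oplus>\<^bsub>A\<^esub> y) = f x \<oplus>\<^bsub>B\<^esub> f y"
    and "f \<one>\<^bsub>A\<^esub> = \<one>\<^bsub>B\<^esub>"
    and "\<And>c x. c \<in> carrier K \<Longrightarrow> x \<in> carrier A \<Longrightarrow> f (c \<odot>\<^bsub>A\<^esub> x) = c \<odot>\<^bsub>B\<^esub> f x"
  shows "f \<in> alg_hom K A B"
  using assms by (auto simp: alg_hom_def ring_hom_def)

lemma alg_homD:
  assumes "f \<in> alg_hom K A B"
  shows "x \<in> carrier A \<Longrightarrow> f x \<in> carrier B"
    and "x \<in> carrier A \<Longrightarrow> y \<in> carrier A \<Longrightarrow> f (x \<otimes>\<^bsub>A\<^esub> y) = f x \<otimes>\<^bsub>B\<^esub> f y"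
    and "x \<in> carrier A \<Longrightarrow> y \<in> carrier A \<Longrightarrow> f (x \<oplus>\<^bsub>A\<^esub> y) = f x \<oplus>\<^bsub>B\<^esub> f y"
    and "f \<one>\<^bsub>A\<^esub> = \<one>\<^bsub>B\<^esub>"
    and "c \<in> carrier K \<Longrightarrow> x \<in> carrier A \<Longrightarrow> f (c \<odot>\<^bsub>A\<^esub> x) = c \<odot>\<^bsub>B\<^esub> f x"
  using assms by (auto simp: alg_hom_def ring_hom_def)

lemma alg_hom_zero:
  assumes "f \<in> alg_hom K A B" "algebra K A" "algebra K B"
  shows "f \<zero>\<^bsub>A\<^esub> = \<zero>\<^bsub>B\<^esub>"
proof -
  interpret A: algebra K A by fact
  interpret B: algebra K B by fact
  show ?thesis
    using alg_homD(5)[OF assms(1) A.R.zero_closed A.M.zero_closed] alg_homD(1)[OF assms(1)] by simp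
qed

abbreviation fn :: "('k, 'a) alg_arr \<Rightarrow> ('k, 'a) univ \<Rightarrow> ('k, 'a) univ" where "fn x \<equiv> fst (snd x)"

lemma Obj_ALG [simp]: "Obj (ALG K) = {A. algebra K A}"
  and Ident_ALG: "Ident (ALG K) A = (A, \<lambda>x\<in>carrier A. x, A)"
  and Cmp_ALG: "Cmp (ALG K) (A', g, B') (A, f, B) = (A, compose (carrier A) g f, B')"
  by (simp_all add: ALG_def)

lemma Homs_ALG: "x \<in> Homs (ALG K) A B \<longleftrightarrow> (\<exists>f. x = (A, f, B) \<and> algebra K A \<and> algebra K B
    \<and> f \<in> alg_hom K A B \<and> f \<in> extensional (carrier A))"
  by (auto simp: ALG_def Homs_def)

lemma Homs_ALG_restrict:
  assumes "algebra K A" "algebra K B" "f \<in> alg_hom K A B"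
  shows "(A, restrict f (carrier A), B) \<in> Homs (ALG K) A B"
proof -
  interpret A: algebra K A by fact
  have "restrict f (carrier A) \<in> alg_hom K A B"
    using alg_homD[OF assms(3)] by (intro alg_homI) auto
  then show ?thesis using assms by (simp add: Homs_ALG)
qed

lemma Homs_ALG_D:
  assumes "x \<in> Homs (ALG K) A B"
  shows "algebra K A" "algebra K B" "fn x \<in> alg_hom K A B" "fst x = A" "snd (snd x) = B"
  using assms by (auto simp: Homs_ALG)

lemma fn_comp [simp]:
  "f \<in> Homs (ALG K) A B \<Longrightarrow> a \<in> carrier A \<Longrightarrow> fn (Cmp (ALG K) g f) a = fn g (fn f a)"
  by (auto simp: ALG_def Homs_def compose_def split: prod.splits)

lemma ALG_eqI:
  assumes "x \<in> Homs (ALG K) A B" "y \<in> Homs (ALG K) A B"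
    and "\<And>a. a \<in> carrier A \<Longrightarrow> fn x a = fn y a"
  shows "x = y"
  using assms by (auto simp: Homs_ALG intro: extensionalityI)

lemma category_ALG: "category (ALG K)"
proof
  show cmp: "Cmp (ALG K) g f \<in> Homs (ALG K) A C"
    if f: "f \<in> Homs (ALG K) A B" and g: "g \<in> Homs (ALG K) B C" for f g A B C
  proof -
    interpret A: algebra K A using f by (rule Homs_ALG_D)
    have "(\<lambda>x. fn g (fn f x)) \<in> alg_hom K A C"
      using alg_homD[OF Homs_ALG_D(3)[OF f]] alg_homD[OF Homs_ALG_D(3)[OF g]]
      by (intro alg_homI) auto
    from Homs_ALG_restrict[OF _ _ this] show ?thesis
      using f g by (auto simp: Homs_ALG Cmp_ALG compose_def)
  qed
  show id: "Ident (ALG K) A \<in> Homs (ALG K) A A" if "A \<in> Obj (ALG K)" for A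
    using that Homs_ALG_restrict[of K A A "\<lambda>x. x"] by (auto simp: Ident_ALG intro: alg_homI)
  fix f A B assume f: "f \<in> Homs (ALG K) A B"
  note fD = Homs_ALG_D[OF f] and fn = alg_homD(1)[OF Homs_ALG_D(3)[OF f]]
  have idA: "Ident (ALG K) A \<in> Homs (ALG K) A A" and idB: "Ident (ALG K) B \<in> Homs (ALG K) B B"
    using fD id by auto
  show "Cmp (ALG K) f (Ident (ALG K) A) = f"
    by (rule ALG_eqI[OF cmp[OF idA f] f]) (simp add: fn_comp[OF idA], simp add: Ident_ALG)
  show "Cmp (ALG K) (Ident (ALG K) B) f = f"
    by (rule ALG_eqI[OF cmp[OF f idB] f]) (simp add: fn_comp[OF f], simp add: Ident_ALG fn)
  fix g h C D assume g: "g \<in> Homs (ALG K) B C" and h: "h \<in> Homs (ALG K) C D"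
  show "Cmp (ALG K) h (Cmp (ALG K) g f) = Cmp (ALG K) (Cmp (ALG K) h g) f"
    by (rule ALG_eqI[OF cmp[OF cmp[OF f g] h] cmp[OF f cmp[OF g h]]])
      (simp add: fn_comp[OF f] fn_comp[OF g] fn_comp[OF cmp[OF f g]] fn)
qed (auto simp: ALG_def)

section \<open>The comonad of sequences\<close>

locale weighted_alg = weighted_algebra K A lam
  for K :: "('k, 'z) ring_scheme" and A :: "('k, 'a) alg" and lam
begin

abbreviation "AN \<equiv> Seqs K lam A"

lemma carrier_Seqs: "x \<in> carrier AN \<longleftrightarrow> (\<exists>f. x = Seq f \<and> (\<forall>n. f n \<in> carrier A))"
  by (auto simp: Seqs_def)

lemma Seqs_simps [simp]:
  "(\<And>n. f n \<in> carrier A) \<Longrightarrow> (\<And>n. g n \<in> carrier A) \<Longrightarrow> Seq f \<otimes>\<^bsub>AN\<^esub> Seq g = Seq (hz f g)"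
  "Seq f \<oplus>\<^bsub>AN\<^esub> Seq g = Seq (\<lambda>n. f n \<oplus>\<^bsub>A\<^esub> g n)"
  "c \<odot>\<^bsub>AN\<^esub> Seq f = Seq (\<lambda>n. c \<odot>\<^bsub>A\<^esub> f n)"
  "\<one>\<^bsub>AN\<^esub> = Seq (\<lambda>n. if n = 0 then \<one>\<^bsub>A\<^esub> else \<zero>\<^bsub>A\<^esub>)"
  "\<zero>\<^bsub>AN\<^esub> = Seq (\<lambda>n. \<zero>\<^bsub>A\<^esub>)"
  by (auto simp: Seqs_def Seq_mult_eq_hurwitz)

lemma algebra_Seqs: "algebra K AN"
proof (rule algebraI)
  show "cring K" ..
  show "cring AN"
  proof (rule cringI)
    show "abelian_group AN"
    proof (rule abelian_groupI)
      fix x assume "x \<in> carrier AN"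
      then obtain f where f: "x = Seq f" "\<And>n. f n \<in> carrier A" by (auto simp: carrier_Seqs)
      then show "\<exists>y\<in>carrier AN. y \<oplus>\<^bsub>AN\<^esub> x = \<zero>\<^bsub>AN\<^esub>"
        by (intro bexI[of _ "Seq (\<lambda>n. \<ominus>\<^bsub>A\<^esub> f n)"]) (auto simp: carrier_Seqs M.l_neg)
    qed (auto simp: carrier_Seqs M.a_ac)
    show "comm_monoid AN"
      by (rule comm_monoidI) (auto simp: carrier_Seqs intro!: ext hz_assoc hz_one_left hz_comm)
  qed (auto simp: carrier_Seqs hz_add_left intro!: ext)
qed (auto simp: carrier_Seqs smult_l_distr smult_r_distr smult_assoc1 hz_smult_left intro!: ext)

end

lemma rota_baxterD:
  assumes "rota_baxter K lam R P"
  shows "algebra K R" "x \<in> carrier R \<Longrightarrow> P x \<in> carrier R"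
    and "x \<in> carrier R \<Longrightarrow> y \<in> carrier R \<Longrightarrow> P (x \<oplus>\<^bsub>R\<^esub> y) = P x \<oplus>\<^bsub>R\<^esub> P y"
    and "c \<in> carrier K \<Longrightarrow> x \<in> carrier R \<Longrightarrow> P (c \<odot>\<^bsub>R\<^esub> x) = c \<odot>\<^bsub>R\<^esub> P x"
    and "x \<in> carrier R \<Longrightarrow> y \<in> carrier R \<Longrightarrow>
      P x \<otimes>\<^bsub>R\<^esub> P y = P (x \<otimes>\<^bsub>R\<^esub> P y) \<oplus>\<^bsub>R\<^esub> P (y \<otimes>\<^bsub>R\<^esub> P x) \<oplus>\<^bsub>R\<^esub> lam \<odot>\<^bsub>R\<^esub> P (x \<otimes>\<^bsub>R\<^esub> y)"
  using assms by (auto simp: rota_baxter_def)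

locale base_ring = cring K for K :: "('k, 'z) ring_scheme" +
  fixes lam :: 'k
  assumes lam: "lam \<in> carrier K"
begin

lemma weighted: "algebra K A \<Longrightarrow> weighted_alg K A lam"
  by (simp add: weighted_alg_def weighted_algebra_def weighted_algebra_axioms_def lam)

lemmas Seqs_algebra = weighted_alg.algebra_Seqs[OF weighted]
  and in_Seqs = weighted_alg.carrier_Seqs[OF weighted]

lemma Seqs_map_hom:
  assumes "f \<in> Homs (ALG K) A B"
  shows "Seqs_map K lam f \<in> Homs (ALG K) (Seqs K lam A) (Seqs K lam B)"
proof -
  note f = Homs_ALG_D[OF assms]
  note fD = alg_homD[OF f(3)]
  interpret A: weighted_alg K A lam by (rule weighted[OF f(1)])
  interpret B: weighted_alg K B lam by (rule weighted[OF f(2)])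
  have mult: "fn f (A.hz x y n) = B.hz (\<lambda>n. fn f (x n)) (\<lambda>n. fn f (y n)) n"
    if "\<And>n. x n \<in> carrier A" "\<And>n. y n \<in> carrier A" for x y n
    using that by (induction n arbitrary: x y) (simp_all add: fD lam)
  have "(\<lambda>x. Seq (\<lambda>n. fn f (un_Seq x n))) \<in> alg_hom K (Seqs K lam A) (Seqs K lam B)"
    using alg_hom_zero[OF f(3,1,2)]
    by (intro alg_homI) (auto simp: A.carrier_Seqs B.carrier_Seqs fD mult if_distrib cong: if_cong)
  from Homs_ALG_restrict[OF A.algebra_Seqs B.algebra_Seqs this] show ?thesis
    using f by (auto simp: Seqs_map_def split: prod.splits)
qed

lemma fn_Seqs_map:
  assumes "f \<in> Homs (ALG K) A B" "x \<in> carrier (Seqs K lam A)"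
  shows "fn (Seqs_map K lam f) x = Seq (\<lambda>n. fn f (un_Seq x n))"
  using assms Homs_ALG_D[OF assms(1)] by (auto simp: Seqs_map_def split: prod.splits)

lemma counit_hom:
  assumes "algebra K A"
  shows "Seqs_counit K lam A \<in> Homs (ALG K) (Seqs K lam A) A"
proof -
  interpret weighted_alg K A lam using weighted assms .
  have "(\<lambda>x. un_Seq x 0) \<in> alg_hom K (Seqs K lam A) A"
    by (intro alg_homI) (auto simp: carrier_Seqs)
  from Homs_ALG_restrict[OF algebra_Seqs assms this] show ?thesis by (simp add: Seqs_counit_def)
qed

lemma delta_hom:
  assumes "algebra K A"
  shows "Seqs_delta K lam A \<in> Homs (ALG K) (Seqs K lam A) (Seqs K lam (Seqs K lam A))"
proof -
  interpret A: weighted_alg K A lam using weighted assms .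
  interpret AN: weighted_alg K "Seqs K lam A" lam using weighted A.algebra_Seqs .
  \<comment> \<open>Shifting commutes with the comultiplication, so the derivation rule carries over to it.\<close>
  have mult: "Seq (\<lambda>n. A.hz x y (m + n))
      = AN.hz (\<lambda>m. Seq (\<lambda>n. x (m + n))) (\<lambda>m. Seq (\<lambda>n. y (m + n))) m"
    if "\<And>n. x n \<in> carrier A" "\<And>n. y n \<in> carrier A" for x y m
    using that
  proof (induction m arbitrary: x y)
    case (Suc m)
    show ?case
      by (simp add: Suc.prems Suc.IH[of "shift x" y, symmetric] Suc.IH[of x "shift y", symmetric]
          Suc.IH[of "shift x" "shift y", symmetric])
  qed simp
  have "(\<lambda>x. Seq (\<lambda>m. Seq (\<lambda>n. un_Seq x (m + n))))
      \<in> alg_hom K (Seqs K lam A) (Seqs K lam (Seqs K lam A))"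
    by (intro alg_homI) (auto simp: A.carrier_Seqs AN.carrier_Seqs mult intro!: ext)
  from Homs_ALG_restrict[OF A.algebra_Seqs AN.algebra_Seqs this] show ?thesis
    by (simp add: Seqs_delta_def)
qed


lemma Seqs_fns:
  "x \<in> carrier (Seqs K lam A) \<Longrightarrow> fn (Seqs_counit K lam A) x = un_Seq x 0"
  "x \<in> carrier (Seqs K lam A) \<Longrightarrow>
    fn (Seqs_delta K lam A) x = Seq (\<lambda>m. Seq (\<lambda>n. un_Seq x (m + n)))"
  by (simp_all add: Seqs_counit_def Seqs_delta_def)

lemma Seqs_carriers:
  "algebra K A \<Longrightarrow> x \<in> carrier (Seqs K lam A) \<Longrightarrow> un_Seq x n \<in> carrier A"
  "algebra K A \<Longrightarrow> (\<And>n. f n \<in> carrier A) \<Longrightarrow> Seq f \<in> carrier (Seqs K lam A)"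
  by (auto simp: in_Seqs)

theorem comonad_Seqs: "comonad (ALG K) (Seqs_comonad K lam)"
proof -
  interpret category "ALG K" by (rule category_ALG)
  let ?C = "CF (Seqs_comonad K lam)
    :: (('k, 'a) alg, ('k, 'a) alg_arr, ('k, 'a) alg, ('k, 'a) alg_arr) func"
  have C [simp]: "FO ?C = Seqs K lam" "FA ?C = Seqs_map K lam"
    "counit (Seqs_comonad K lam) = Seqs_counit K lam"
    "delta (Seqs_comonad K lam) = Seqs_delta K lam"
    by (simp_all add: Seqs_comonad_def)
  note fnD = alg_homD(1)[OF Homs_ALG_D(3)]
  have F: "is_functor (ALG K) (ALG K) ?C"
  proof (rule functorI)
    show "FA ?C (Ident (ALG K) A) = Ident (ALG K) (FO ?C A)" if A: "A \<in> Obj (ALG K)" for A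
    proof (rule ALG_eqI)
      show "FA ?C (Ident (ALG K) A) \<in> Homs (ALG K) (Seqs K lam A) (Seqs K lam A)"
        using Seqs_map_hom[OF ident[OF A]] by simp
      show "Ident (ALG K) (FO ?C A) \<in> Homs (ALG K) (Seqs K lam A) (Seqs K lam A)"
        using ident[of "Seqs K lam A"] A by (simp add: Seqs_algebra)
      show "fn (FA ?C (Ident (ALG K) A)) x = fn (Ident (ALG K) (FO ?C A)) x"
        if "x \<in> carrier (Seqs K lam A)" for x
        using fn_Seqs_map[OF ident[OF A] that] that A by (auto simp: Ident_ALG in_Seqs)
    qed
    show "FA ?C (Cmp (ALG K) g f) = Cmp (ALG K) (FA ?C g) (FA ?C f)"
      if f: "f \<in> Homs (ALG K) A B" and g: "g \<in> Homs (ALG K) B D" for f g A B D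
    proof (rule ALG_eqI)
      show "FA ?C (Cmp (ALG K) g f) \<in> Homs (ALG K) (Seqs K lam A) (Seqs K lam D)"
        "Cmp (ALG K) (FA ?C g) (FA ?C f) \<in> Homs (ALG K) (Seqs K lam A) (Seqs K lam D)"
        using Seqs_map_hom[OF cmp[OF f g]] cmp[OF Seqs_map_hom[OF f] Seqs_map_hom[OF g]] by simp_all
      fix x assume x: "x \<in> carrier (Seqs K lam A)"
      note A = Homs_ALG_D(1)[OF f]
      show "fn (FA ?C (Cmp (ALG K) g f)) x = fn (Cmp (ALG K) (FA ?C g) (FA ?C f)) x"
        using fn_Seqs_map[OF cmp[OF f g] x] fn_Seqs_map[OF f x]
          fn_Seqs_map[OF g fnD[OF Seqs_map_hom[OF f] x]] Seqs_carriers(1)[OF A x]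
        by (simp add: fn_comp[OF Seqs_map_hom[OF f] x] fn_comp[OF f])
    qed
  qed (auto simp: category_ALG Seqs_algebra Seqs_map_hom)
  note FF = comp_functor[OF F F]
  have counit: "nat_trans (ALG K) (ALG K) ?C id_func (Seqs_counit K lam)"
  proof (rule nat_transI[OF F id_functor[OF category_ALG]])
    show "Cmp (ALG K) (Seqs_counit K lam B) (FA ?C f)
      = Cmp (ALG K) (FA id_func f) (Seqs_counit K lam A)"
      if f: "f \<in> Homs (ALG K) A B" for f A B
    proof (rule ALG_eqI)
      note A = Homs_ALG_D(1)[OF f] and B = Homs_ALG_D(2)[OF f]
      note Cf = Seqs_map_hom[OF f]
      show "Cmp (ALG K) (Seqs_counit K lam B) (FA ?C f) \<in> Homs (ALG K) (Seqs K lam A) B"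
        "Cmp (ALG K) (FA id_func f) (Seqs_counit K lam A) \<in> Homs (ALG K) (Seqs K lam A) B"
        using cmp[OF Cf counit_hom[OF B]] cmp[OF counit_hom[OF A] f] by (simp_all add: id_func_def)
      fix x assume x: "x \<in> carrier (Seqs K lam A)"
      show "fn (Cmp (ALG K) (Seqs_counit K lam B) (FA ?C f)) x
        = fn (Cmp (ALG K) (FA id_func f) (Seqs_counit K lam A)) x"
        using x fnD[OF Cf x]
        by (simp add: id_func_def fn_comp[OF Cf] fn_comp[OF counit_hom[OF A]] Seqs_fns
            fn_Seqs_map[OF f])
    qed
  qed (simp add: counit_hom id_func_def)
  have delta: "nat_trans (ALG K) (ALG K) ?C (?C \<circ>\<^sub>F ?C) (Seqs_delta K lam)"
  proof (rule nat_transI[OF F FF])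
    show "Cmp (ALG K) (Seqs_delta K lam B) (FA ?C f)
        = Cmp (ALG K) (FA (?C \<circ>\<^sub>F ?C) f) (Seqs_delta K lam A)"
      if f: "f \<in> Homs (ALG K) A B" for f A B
    proof (rule ALG_eqI)
      note A = Homs_ALG_D(1)[OF f] and B = Homs_ALG_D(2)[OF f]
      note Cf = Seqs_map_hom[OF f] and CCf = Seqs_map_hom[OF Seqs_map_hom[OF f]]
      show "Cmp (ALG K) (Seqs_delta K lam B) (FA ?C f)
          \<in> Homs (ALG K) (Seqs K lam A) (Seqs K lam (Seqs K lam B))"
        "Cmp (ALG K) (FA (?C \<circ>\<^sub>F ?C) f) (Seqs_delta K lam A)
          \<in> Homs (ALG K) (Seqs K lam A) (Seqs K lam (Seqs K lam B))"
        using cmp[OF Cf delta_hom[OF B]] cmp[OF delta_hom[OF A] CCf]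
        by (simp_all add: comp_func_def)
      fix x assume x: "x \<in> carrier (Seqs K lam A)"
      show "fn (Cmp (ALG K) (Seqs_delta K lam B) (FA ?C f)) x
        = fn (Cmp (ALG K) (FA (?C \<circ>\<^sub>F ?C) f) (Seqs_delta K lam A)) x"
        using x fnD[OF Cf x] fnD[OF delta_hom[OF A] x] Seqs_carriers(1)[OF A x]
        by (simp add: comp_func_def fn_comp[OF Cf] fn_comp[OF delta_hom[OF A]] Seqs_fns
            fn_Seqs_map[OF f]
            fn_Seqs_map[OF Cf] Seqs_carriers(2)[OF A])
    qed
  qed (simp add: delta_hom comp_func_def)
  have laws: "Cmp (ALG K) (Seqs_counit K lam (Seqs K lam A)) (Seqs_delta K lam A)
        = Ident (ALG K) (Seqs K lam A)"
    "Cmp (ALG K) (Seqs_map K lam (Seqs_counit K lam A)) (Seqs_delta K lam A)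
        = Ident (ALG K) (Seqs K lam A)"
    "Cmp (ALG K) (Seqs_delta K lam (Seqs K lam A)) (Seqs_delta K lam A)
        = Cmp (ALG K) (Seqs_map K lam (Seqs_delta K lam A)) (Seqs_delta K lam A)"
    if A: "algebra K A" for A :: "('k, 'a) alg"
  proof -
    note CA = Seqs_algebra[OF A] and d = delta_hom[OF A] and e = counit_hom[OF A]
    note dC = delta_hom[OF CA] and eC = counit_hom[OF CA]
      and Cd = Seqs_map_hom[OF d] and Ce = Seqs_map_hom[OF e]
    have idC: "Ident (ALG K) (Seqs K lam A) \<in> Homs (ALG K) (Seqs K lam A) (Seqs K lam A)"
      using ident[of "Seqs K lam A"] CA by simp
    have dx: "fn (Seqs_delta K lam A) x = Seq (\<lambda>m. Seq (\<lambda>n. un_Seq x (m + n)))"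
      "Seq (\<lambda>m. Seq (\<lambda>n. un_Seq x (m + n))) \<in> carrier (Seqs K lam (Seqs K lam A))"
      "Seq (\<lambda>n. un_Seq x (m + n)) \<in> carrier (Seqs K lam A)"
      "Seq (un_Seq x) = x"
      if "x \<in> carrier (Seqs K lam A)" for x m
      using Seqs_fns(2)[OF that] fnD[OF d that] that in_Seqs[OF A] by auto
    show "Cmp (ALG K) (Seqs_counit K lam (Seqs K lam A)) (Seqs_delta K lam A)
        = Ident (ALG K) (Seqs K lam A)"
      by (rule ALG_eqI[OF cmp[OF d eC] idC]) (simp add: fn_comp[OF d] dx Seqs_fns(1) Ident_ALG)
    show "Cmp (ALG K) (Seqs_map K lam (Seqs_counit K lam A)) (Seqs_delta K lam A)
        = Ident (ALG K) (Seqs K lam A)"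
      by (rule ALG_eqI[OF cmp[OF d Ce] idC])
        (simp add: fn_comp[OF d] dx fn_Seqs_map[OF e] Seqs_fns(1) Ident_ALG)
    show "Cmp (ALG K) (Seqs_delta K lam (Seqs K lam A)) (Seqs_delta K lam A)
        = Cmp (ALG K) (Seqs_map K lam (Seqs_delta K lam A)) (Seqs_delta K lam A)"
      by (rule ALG_eqI[OF cmp[OF d dC] cmp[OF d Cd]])
        (simp add: fn_comp[OF d] dx fn_Seqs_map[OF d] Seqs_fns(2) add.assoc)
  qed
  show ?thesis
    using counit delta laws by (simp add: comonad_def)
qed

section \<open>Rota-Baxter operators on sequences\<close>

lemma Seqs_P_Seq: "Seqs_P P (Seq f) = Seq (\<lambda>n. case n of 0 \<Rightarrow> P (f 0) | Suc m \<Rightarrow> f m)"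
  by (auto simp: Seqs_P_def split: nat.splits)

text \<open>At index \<open>0\<close> the identity is that of \<open>P\<close>. At a positive index it is the derivation rule
for a product of two values of the operator, because shifting undoes the operator.\<close>

lemma rota_baxter_Seqs:
  assumes "rota_baxter K lam A P"
  shows "rota_baxter K lam (Seqs K lam A) (Seqs_P P)"
proof -
  note P = rota_baxterD[OF assms]
  interpret weighted_alg K A lam by (rule weighted[OF P(1)])
  have cl: "(case n of 0 \<Rightarrow> P (f 0) | Suc m \<Rightarrow> f m) \<in> carrier A" if "\<And>n. f n \<in> carrier A" for f n
    using that P(2) by (cases n) auto
  have rb: "hz (\<lambda>n. case n of 0 \<Rightarrow> P (f 0) | Suc m \<Rightarrow> f m) (\<lambda>n. case n of 0 \<Rightarrow> P (g 0) | Suc m \<Rightarrow> g m) n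
    = (case n of 0 \<Rightarrow> P (hz f (\<lambda>n. case n of 0 \<Rightarrow> P (g 0) | Suc m \<Rightarrow> g m) 0)
         | Suc m \<Rightarrow> hz f (\<lambda>n. case n of 0 \<Rightarrow> P (g 0) | Suc m \<Rightarrow> g m) m) \<oplus>\<^bsub>A\<^esub>
      (case n of 0 \<Rightarrow> P (hz g (\<lambda>n. case n of 0 \<Rightarrow> P (f 0) | Suc m \<Rightarrow> f m) 0)
         | Suc m \<Rightarrow> hz g (\<lambda>n. case n of 0 \<Rightarrow> P (f 0) | Suc m \<Rightarrow> f m) m) \<oplus>\<^bsub>A\<^esub>
      lam \<odot>\<^bsub>A\<^esub> (case n of 0 \<Rightarrow> P (hz f g 0) | Suc m \<Rightarrow> hz f g m)"
    if "\<And>n. f n \<in> carrier A" "\<And>n. g n \<in> carrier A" for f g n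
  proof (cases n)
    case 0
    then show ?thesis using that P(5) by simp
  next
    case (Suc m)
    then show ?thesis
      using that cl hz_comm[of g "\<lambda>n. case n of 0 \<Rightarrow> P (f 0) | Suc m \<Rightarrow> f m" m] by simp
  qed
  show ?thesis
    unfolding rota_baxter_def
    by (intro conjI algebra_Seqs funcsetI ballI)
      (use P in \<open>auto simp: carrier_Seqs Seqs_P_Seq cl rb intro!: ext split: nat.splits\<close>)
qed

definition rb_arrow :: "('k, 'a) alg_arr \<Rightarrow> (('k, 'a) univ \<Rightarrow> ('k, 'a) univ) \<Rightarrow>
    (('k, 'a) univ \<Rightarrow> ('k, 'a) univ) \<Rightarrow> bool" where
  "rb_arrow f P Q \<longleftrightarrow> fn f \<in> rota_baxter_hom K lam (fst f) P (snd (snd f)) Q"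

lemma rb_arrow_iff:
  "f \<in> Homs (ALG K) A B \<Longrightarrow> rb_arrow f P Q \<longleftrightarrow>
    rota_baxter K lam A P \<and> rota_baxter K lam B Q \<and> (\<forall>x\<in>carrier A. fn f (P x) = Q (fn f x))"
  by (auto simp: rb_arrow_def rota_baxter_hom_def Homs_ALG_D)

lemma rb_arrow_ident:
  assumes "algebra K A" "rota_baxter K lam A P"
  shows "rb_arrow (Ident (ALG K) A) P P"
proof -
  interpret category "ALG K" by (rule category_ALG)
  show ?thesis
    using assms rb_arrow_iff[OF ident, of A P P] rota_baxterD(2)[OF assms(2)]
    by (simp add: Ident_ALG)
qed

lemma rb_arrow_comp:
  assumes f: "f \<in> Homs (ALG K) A B" and g: "g \<in> Homs (ALG K) B C"
    and "rb_arrow f P Q" "rb_arrow g Q R"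
  shows "rb_arrow (Cmp (ALG K) g f) P R"
proof -
  interpret category "ALG K" by (rule category_ALG)
  have "P x \<in> carrier A" if "x \<in> carrier A" for x
    using that assms(3) rota_baxterD(2) by (auto simp: rb_arrow_iff[OF f])
  then show ?thesis
    using assms alg_homD(1)[OF Homs_ALG_D(3)[OF f]]
    by (simp add: rb_arrow_iff[OF f] rb_arrow_iff[OF g] rb_arrow_iff[OF cmp[OF f g]] fn_comp[OF f])
qed

lemma rb_arrow_Seqs_map:
  assumes f: "f \<in> Homs (ALG K) A B" and "rb_arrow f P Q"
  shows "rb_arrow (Seqs_map K lam f) (Seqs_P P) (Seqs_P Q)"
proof -
  have P: "rota_baxter K lam A P" and Q: "rota_baxter K lam B Q"
    and eq: "\<And>x. x \<in> carrier A \<Longrightarrow> fn f (P x) = Q (fn f x)"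
    using assms(2) by (auto simp: rb_arrow_iff[OF f])
  note P' = rota_baxter_Seqs[OF P]
  show ?thesis
    unfolding rb_arrow_iff[OF Seqs_map_hom[OF f]]
  proof (intro conjI ballI P' rota_baxter_Seqs[OF Q])
    fix x assume "x \<in> carrier (Seqs K lam A)"
    then show "fn (Seqs_map K lam f) (Seqs_P P x) = Seqs_P Q (fn (Seqs_map K lam f) x)"
      using rota_baxterD(2)[OF P'] in_Seqs[OF rota_baxterD(1)[OF P]] eq
      by (auto simp: fn_Seqs_map[OF f] Seqs_P_def split: nat.splits intro!: ext)
  qed
qed

lemma rb_arrow_counit:
  assumes P: "rota_baxter K lam A P"
  shows "rb_arrow (Seqs_counit K lam A) (Seqs_P P) P"
  using P rota_baxter_Seqs[OF P] rota_baxterD(2)[OF rota_baxter_Seqs[OF P]]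
  by (simp add: rb_arrow_iff[OF counit_hom[OF rota_baxterD(1)[OF P]]] Seqs_fns)
      (simp add: Seqs_P_def)

lemma rb_arrow_delta:
  assumes P: "rota_baxter K lam A P"
  shows "rb_arrow (Seqs_delta K lam A) (Seqs_P P) (Seqs_P (Seqs_P P))"
  using P rota_baxter_Seqs[OF P] rota_baxter_Seqs[OF rota_baxter_Seqs[OF P]]
    rota_baxterD(2)[OF rota_baxter_Seqs[OF P]]
  by (simp add: rb_arrow_iff[OF delta_hom[OF rota_baxterD(1)[OF P]]] Seqs_fns)
    (auto simp: Seqs_P_def split: nat.splits intro!: ext)

end

section \<open>The module of tensors\<close>

definition words :: "('k, 'b) module \<Rightarrow> 'b list set" where
  "words A = lists (carrier A) - {[]}"

lemma words_simps [simp]: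
  "[] \<notin> words A"
  "a # w \<in> words A \<longleftrightarrow> a \<in> carrier A \<and> (w = [] \<or> w \<in> words A)"
  "u @ a # v \<in> words A \<longleftrightarrow> u \<in> lists (carrier A) \<and> a \<in> carrier A \<and> v \<in> lists (carrier A)"
  by (auto simp: words_def)

lemma words_lists: "w \<in> words A \<Longrightarrow> w \<in> lists (carrier A)"
  by (simp add: words_def)

lemma formal_sums_simps [simp]:
  "[] \<in> formal_sums K A"
  "(c, w) # xs \<in> formal_sums K A \<longleftrightarrow> c \<in> carrier K \<and> w \<in> words A \<and> xs \<in> formal_sums K A"
  "xs @ ys \<in> formal_sums K A \<longleftrightarrow> xs \<in> formal_sums K A \<and> ys \<in> formal_sums K A"
  by (auto simp: formal_sums_def words_def)

lemma formal_sums_induct [consumes 1, case_names Nil Cons]: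
  assumes "xs \<in> formal_sums K A" "Q []"
    and "\<And>c w xs. \<lbrakk>c \<in> carrier K; w \<in> words A; xs \<in> formal_sums K A; Q xs\<rbrakk> \<Longrightarrow> Q ((c, w) # xs)"
  shows "Q xs"
  using assms(1) by (induction xs) (auto intro: assms(2,3))

definition multilinear ::
    "('k, 'z) ring_scheme \<Rightarrow> ('k, 'b) module \<Rightarrow> ('k, 'c) module \<Rightarrow> ('b list \<Rightarrow> 'c) \<Rightarrow> bool" where
  "multilinear K A M g \<longleftrightarrow> (\<forall>w\<in>words A. g w \<in> carrier M)
     \<and> (\<forall>u\<in>lists (carrier A). \<forall>v\<in>lists (carrier A).
          (\<forall>a\<in>carrier A. \<forall>b\<in>carrier A. g (u @ (a \<oplus>\<^bsub>A\<^esub> b) # v) = g (u @ a # v) \<oplus>\<^bsub>M\<^esub> g (u @ b # v))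
        \<and> (\<forall>r\<in>carrier K. \<forall>a\<in>carrier A. g (u @ (r \<odot>\<^bsub>A\<^esub> a) # v) = r \<odot>\<^bsub>M\<^esub> g (u @ a # v)))"

lemma multilinearD:
  assumes "multilinear K A M g"
  shows "w \<in> words A \<Longrightarrow> g w \<in> carrier M"
    and "\<lbrakk>u \<in> lists (carrier A); v \<in> lists (carrier A); a \<in> carrier A; b \<in> carrier A\<rbrakk>
      \<Longrightarrow> g (u @ (a \<oplus>\<^bsub>A\<^esub> b) # v) = g (u @ a # v) \<oplus>\<^bsub>M\<^esub> g (u @ b # v)"
    and "\<lbrakk>u \<in> lists (carrier A); v \<in> lists (carrier A); r \<in> carrier K; a \<in> carrier A\<rbrakk>
      \<Longrightarrow> g (u @ (r \<odot>\<^bsub>A\<^esub> a) # v) = r \<odot>\<^bsub>M\<^esub> g (u @ a # v)"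
  using assms by (auto simp: multilinear_def)

lemma linear_ext_simps [simp]:
  "linear_ext M g [] = \<zero>\<^bsub>M\<^esub>"
  "linear_ext M g ((c, w) # xs) = c \<odot>\<^bsub>M\<^esub> g w \<oplus>\<^bsub>M\<^esub> linear_ext M g xs"
  by (simp_all add: linear_ext_def)

context
  fixes K :: "('k, 'z) ring_scheme" and M :: "('k, 'c) module" and A :: "('k, 'b) module"
    and g :: "'b list \<Rightarrow> 'c"
  assumes M: "module K M" and g: "\<And>w. w \<in> words A \<Longrightarrow> g w \<in> carrier M"
begin

interpretation module K M by (rule M)

lemma linear_ext_closed: "xs \<in> formal_sums K A \<Longrightarrow> linear_ext M g xs \<in> carrier M"
  by (induction xs rule: formal_sums_induct) (auto simp: g)

lemma linear_ext_append:
  "\<lbrakk>xs \<in> formal_sums K A; ys \<in> formal_sums K A\<rbrakk>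
    \<Longrightarrow> linear_ext M g (xs @ ys) = linear_ext M g xs \<oplus>\<^bsub>M\<^esub> linear_ext M g ys"
  by (induction xs rule: formal_sums_induct) (auto simp: g linear_ext_closed M.a_assoc)

lemma linear_ext_scale:
  "\<lbrakk>xs \<in> formal_sums K A; c \<in> carrier K\<rbrakk> \<Longrightarrow> linear_ext M g (scale K c xs) = c \<odot>\<^bsub>M\<^esub> linear_ext M g xs"
  by (induction xs rule: formal_sums_induct)
    (auto simp: g linear_ext_closed scale_def smult_r_distr smult_assoc1)

end

lemma scale_simps [simp]:
  "scale K c [] = []" "scale K c ((d, w) # xs) = (c \<otimes>\<^bsub>K\<^esub> d, w) # scale K c xs"
  "scale K c (xs @ ys) = scale K c xs @ scale K c ys"
  by (auto simp: scale_def)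

lemma prefix_factor_simps [simp]:
  "prefix_factor a [] = []" "prefix_factor a ((d, w) # xs) = (d, a # w) # prefix_factor a xs"
  by (auto simp: prefix_factor_def)

locale shuffle_alg = weighted_alg K A lam
  for K :: "('k, 'z) ring_scheme" and A :: "('k, 'a) alg" and lam
begin

abbreviation "F \<equiv> formal_sums K A"
abbreviation "S \<equiv> Sha K lam A"
abbreviation teq (infix "\<sim>" 50) where "xs \<sim> ys \<equiv> tensor_eq K A xs ys"
abbreviation "clsA \<equiv> cls K A"

lemma teq_formal_sums: "xs \<sim> ys \<Longrightarrow> xs \<in> F \<and> ys \<in> F"
  by (induction rule: tensor_eq.induct) (auto simp: words_lists, auto simp: words_def)

text \<open>The rules of \<open>tensor_eq\<close> express linearity in the coefficients and in each slot.
Hence multilinear maps on words extend to tensors, which is how the linear maps on \<open>Sha(A)\<close> are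
constructed below.\<close>

lemma linear_ext_teq:
  assumes "module K M" and g: "multilinear K A M g" and "xs \<sim> ys"
  shows "linear_ext M g xs = linear_ext M g ys"
proof -
  interpret N: module K M by fact
  note gD = multilinearD[OF g]
  show ?thesis using assms(3)
  proof (induction rule: tensor_eq.induct)
    case (append xs xs' ys ys')
    then show ?case
      using teq_formal_sums[OF append.hyps(1)] teq_formal_sums[OF append.hyps(2)]
      by (simp add: linear_ext_append[OF assms(1) gD(1)])
  next
    case (commute xs ys)
    then show ?case
      by (simp add: linear_ext_append[OF assms(1) gD(1)] linear_ext_closed[OF assms(1) gD(1)]
          N.M.a_comm)
  next
    case (coeff_add c d w)
    then have "g w \<in> carrier M" using gD(1) by (simp add: words_def)
    with coeff_add show ?case by (simp add: N.smult_l_distr N.M.a_assoc)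
  next
    case (coeff_zero w)
    then have "g w \<in> carrier M" using gD(1) by (simp add: words_def)
    then show ?case by simp
  next
    case (slot_add c u v a b)
    then show ?case by (simp add: gD N.smult_r_distr N.M.a_assoc)
  next
    case (slot_smult c r u v a)
    then show ?case by (simp add: gD N.smult_assoc1)
  qed auto
qed

lemma scale_closed [simp]: "\<lbrakk>xs \<in> F; c \<in> carrier K\<rbrakk> \<Longrightarrow> scale K c xs \<in> F"
  by (induction xs rule: formal_sums_induct) auto

lemma scale_teq: "\<lbrakk>xs \<sim> ys; r \<in> carrier K\<rbrakk> \<Longrightarrow> scale K r xs \<sim> scale K r ys"
proof (induction rule: tensor_eq.induct)
  case (coeff_add c d w)
  then show ?case using tensor_eq.coeff_add[of "r \<otimes>\<^bsub>K\<^esub> c" K "r \<otimes>\<^bsub>K\<^esub> d" w A] by (simp add: R.r_distr)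
next
  case (slot_smult c s u v a)
  then show ?case using tensor_eq.slot_smult[of "r \<otimes>\<^bsub>K\<^esub> c" K s u A v a] by (simp add: R.m_assoc)
qed (auto intro: tensor_eq.intros)

lemma cls_eq:
  assumes "xs \<sim> ys"
  shows "clsA xs = clsA ys"
proof -
  have "xs \<sim> zs \<longleftrightarrow> ys \<sim> zs" for zs
    using tensor_eq.trans[OF assms] tensor_eq.trans[OF tensor_eq.sym[OF assms]] by blast
  then show ?thesis by (simp add: cls_def)
qed

lemma un_Ten_cls: "xs \<in> F \<Longrightarrow> un_Ten (clsA xs) \<sim> xs"
  unfolding cls_def using tensor_eq.sym[OF someI[of "tensor_eq K A xs", OF tensor_eq.refl]] by simp

lemma Sha_cases:
  assumes "x \<in> carrier S"
  obtains xs where "xs \<in> F" "x = clsA xs"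
  using assms by (auto simp: Sha_def)

lemma cls_closed [simp]: "xs \<in> F \<Longrightarrow> clsA xs \<in> carrier S"
  by (simp add: Sha_def)

lemma un_Ten_closed: "x \<in> carrier S \<Longrightarrow> un_Ten x \<in> F"
  using un_Ten_cls teq_formal_sums by (auto elim!: Sha_cases)

lemma cls_un_Ten: "x \<in> carrier S \<Longrightarrow> clsA (un_Ten x) = x"
  using cls_eq[OF un_Ten_cls] by (auto elim!: Sha_cases)

lemma add_cls [simp]: "\<lbrakk>xs \<in> F; ys \<in> F\<rbrakk> \<Longrightarrow> clsA xs \<oplus>\<^bsub>S\<^esub> clsA ys = clsA (xs @ ys)"
  using cls_eq[OF tensor_eq.append[OF un_Ten_cls un_Ten_cls]] by (simp add: Sha_def)

lemma smult_cls [simp]: "\<lbrakk>c \<in> carrier K; xs \<in> F\<rbrakk> \<Longrightarrow> c \<odot>\<^bsub>S\<^esub> clsA xs = clsA (scale K c xs)"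
  using cls_eq[OF scale_teq[OF un_Ten_cls]] by (simp add: Sha_def)

lemma zero_Sha: "\<zero>\<^bsub>S\<^esub> = clsA []" and one_Sha: "\<one>\<^bsub>S\<^esub> = clsA [(\<one>\<^bsub>K\<^esub>, [\<one>\<^bsub>A\<^esub>])]"
  by (simp_all add: Sha_def)

lemma cls_commute: "\<lbrakk>xs \<in> F; ys \<in> F\<rbrakk> \<Longrightarrow> clsA (xs @ ys) = clsA (ys @ xs)"
  by (intro cls_eq tensor_eq.commute)

lemma cls_scale_add:
  assumes "xs \<in> F" and c: "c \<in> carrier K" "d \<in> carrier K"
  shows "clsA (scale K (c \<oplus>\<^bsub>K\<^esub> d) xs) = clsA (scale K c xs @ scale K d xs)"
  using assms(1)
proof (induction xs rule: formal_sums_induct)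
  case (Cons e w xs)
  have "clsA [((c \<oplus>\<^bsub>K\<^esub> d) \<otimes>\<^bsub>K\<^esub> e, w)] = clsA [(c \<otimes>\<^bsub>K\<^esub> e, w), (d \<otimes>\<^bsub>K\<^esub> e, w)]"
    using Cons c by (intro cls_eq) (auto simp: R.l_distr words_def intro: tensor_eq.coeff_add)
  then have "clsA (scale K (c \<oplus>\<^bsub>K\<^esub> d) ((e, w) # xs))
    = clsA [(c \<otimes>\<^bsub>K\<^esub> e, w), (d \<otimes>\<^bsub>K\<^esub> e, w)] \<oplus>\<^bsub>S\<^esub> clsA (scale K c xs @ scale K d xs)"
    using Cons c add_cls[of "[((c \<oplus>\<^bsub>K\<^esub> d) \<otimes>\<^bsub>K\<^esub> e, w)]" "scale K (c \<oplus>\<^bsub>K\<^esub> d) xs"] by simp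
  also have "\<dots> = clsA [(c \<otimes>\<^bsub>K\<^esub> e, w)] \<oplus>\<^bsub>S\<^esub> clsA ([(d \<otimes>\<^bsub>K\<^esub> e, w)] @ scale K c xs) \<oplus>\<^bsub>S\<^esub> clsA (scale K d xs)"
    using Cons c by simp
  also have "\<dots> = clsA [(c \<otimes>\<^bsub>K\<^esub> e, w)] \<oplus>\<^bsub>S\<^esub> clsA (scale K c xs @ [(d \<otimes>\<^bsub>K\<^esub> e, w)]) \<oplus>\<^bsub>S\<^esub> clsA (scale K d xs)"
    using Cons c by (subst cls_commute) auto
  finally show ?case using Cons c by simp
qed simp

lemma cls_scale_zero: "xs \<in> F \<Longrightarrow> clsA (scale K \<zero>\<^bsub>K\<^esub> xs) = clsA []"
proof (induction xs rule: formal_sums_induct)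
  case (Cons c w xs)
  have "clsA [(\<zero>\<^bsub>K\<^esub>, w)] = clsA []"
    using Cons by (intro cls_eq tensor_eq.coeff_zero) (auto simp: words_def)
  with Cons show ?case
    using add_cls[of "[(\<zero>\<^bsub>K\<^esub>, w)]" "scale K \<zero>\<^bsub>K\<^esub> xs"] add_cls[of "[]" "[]"] by simp
qed simp

lemma scale_one [simp]: "xs \<in> F \<Longrightarrow> scale K \<one>\<^bsub>K\<^esub> xs = xs"
  by (induction xs rule: formal_sums_induct) auto

lemma scale_scale: "\<lbrakk>xs \<in> F; c \<in> carrier K; d \<in> carrier K\<rbrakk>
    \<Longrightarrow> scale K (c \<otimes>\<^bsub>K\<^esub> d) xs = scale K c (scale K d xs)"
  by (induction xs rule: formal_sums_induct) (auto simp: R.m_assoc)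

lemma module_Sha: "module K S"
proof (rule moduleI)
  show "cring K" ..
  show "abelian_group S"
  proof (rule abelian_groupI)
    fix x assume "x \<in> carrier S"
    then obtain xs where xs: "xs \<in> F" "x = clsA xs" by (rule Sha_cases)
    have "clsA (scale K (\<ominus>\<^bsub>K\<^esub> \<one>\<^bsub>K\<^esub>) xs @ scale K \<one>\<^bsub>K\<^esub> xs) = \<zero>\<^bsub>S\<^esub>"
      using cls_scale_add[of xs "\<ominus>\<^bsub>K\<^esub> \<one>\<^bsub>K\<^esub>" "\<one>\<^bsub>K\<^esub>"] xs
      by (simp add: R.l_neg cls_scale_zero zero_Sha)
    then show "\<exists>y\<in>carrier S. y \<oplus>\<^bsub>S\<^esub> x = \<zero>\<^bsub>S\<^esub>"
      using xs by (intro bexI[of _ "clsA (scale K (\<ominus>\<^bsub>K\<^esub> \<one>\<^bsub>K\<^esub>) xs)"]) auto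
  qed (auto elim!: Sha_cases simp: zero_Sha cls_commute)
qed (auto elim!: Sha_cases simp: cls_scale_add scale_scale)

sublocale S: module K S
  by (rule module_Sha)

definition tensor :: "('k, 'a) univ list \<Rightarrow> ('k, 'a) univ" where
  "tensor w = clsA [(\<one>\<^bsub>K\<^esub>, w)]"

lemma tensor_closed [simp]: "w \<in> words A \<Longrightarrow> tensor w \<in> carrier S"
  by (simp add: tensor_def)

lemma cls_Cons: "(c, w) # xs \<in> F \<Longrightarrow> clsA ((c, w) # xs) = c \<odot>\<^bsub>S\<^esub> tensor w \<oplus>\<^bsub>S\<^esub> clsA xs"
  by (simp add: tensor_def)

lemma cls_linear_ext: "xs \<in> F \<Longrightarrow> clsA xs = linear_ext S tensor xs"
  by (induction xs rule: formal_sums_induct)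
    (simp_all add: zero_Sha cls_Cons del: smult_cls add_cls)

text \<open>Used for statements that are linear in \<open>x\<close>: they reduce to pure tensors.\<close>

lemma Sha_induct [consumes 1, case_names zero add]:
  assumes "x \<in> carrier S" and "Q \<zero>\<^bsub>S\<^esub>"
    and "\<And>c w x. \<lbrakk>c \<in> carrier K; w \<in> words A; x \<in> carrier S; Q x\<rbrakk> \<Longrightarrow> Q (c \<odot>\<^bsub>S\<^esub> tensor w \<oplus>\<^bsub>S\<^esub> x)"
  shows "Q x"
proof -
  obtain xs where xs: "xs \<in> F" "x = clsA xs" using assms(1) by (rule Sha_cases)
  have "Q (clsA xs)"
    using xs(1)
  proof (induction xs rule: formal_sums_induct)
    case (Cons c w xs)
    then show ?case using assms(3)[of c w "clsA xs"] cls_Cons[of c w xs] by simp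
  qed (use assms(2) in \<open>simp add: zero_Sha\<close>)
  then show ?thesis using xs by simp
qed

declare add_cls [simp del] smult_cls [simp del]

lemma multilinear_tensor: "multilinear K A S tensor"
proof -
  have "tensor (u @ (r \<odot>\<^bsub>A\<^esub> a) # v) = r \<odot>\<^bsub>S\<^esub> tensor (u @ a # v)"
    if "u \<in> lists (carrier A)" "v \<in> lists (carrier A)" "r \<in> carrier K" "a \<in> carrier A" for u v r a
    using cls_eq[OF tensor_eq.slot_smult[of "\<one>\<^bsub>K\<^esub>" K r u A v a]] that
    by (simp add: tensor_def smult_cls)
  moreover have "tensor (u @ (a \<oplus>\<^bsub>A\<^esub> b) # v) = tensor (u @ a # v) \<oplus>\<^bsub>S\<^esub> tensor (u @ b # v)"
    if "u \<in> lists (carrier A)" "v \<in> lists (carrier A)" "a \<in> carrier A" "b \<in> carrier A" for u v a b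
    using cls_eq[OF tensor_eq.slot_add[of "\<one>\<^bsub>K\<^esub>" K u A v a b]] that by (simp add: tensor_def add_cls)
  ultimately show ?thesis by (simp add: multilinear_def)
qed

text \<open>The value is taken on the chosen representative; by \<open>lift_cls\<close> every representative yields
it if \<open>g\<close> is multilinear.\<close>

definition lift :: "('k, 'c) module \<Rightarrow> (('k, 'a) univ list \<Rightarrow> 'c) \<Rightarrow> ('k, 'a) univ \<Rightarrow> 'c" where
  "lift M g x = linear_ext M g (un_Ten x)"

lemma lift_cls:
  "\<lbrakk>module K M; multilinear K A M g; xs \<in> F\<rbrakk> \<Longrightarrow> lift M g (clsA xs) = linear_ext M g xs"
  unfolding lift_def by (rule linear_ext_teq[OF _ _ un_Ten_cls])

lemma lift_props:
  assumes M: "module K M" and g: "multilinear K A M g"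
  shows lift_closed: "x \<in> carrier S \<Longrightarrow> lift M g x \<in> carrier M"
    and lift_add: "\<lbrakk>x \<in> carrier S; y \<in> carrier S\<rbrakk> \<Longrightarrow> lift M g (x \<oplus>\<^bsub>S\<^esub> y) = lift M g x \<oplus>\<^bsub>M\<^esub> lift M g y"
    and lift_smult: "\<lbrakk>c \<in> carrier K; x \<in> carrier S\<rbrakk> \<Longrightarrow> lift M g (c \<odot>\<^bsub>S\<^esub> x) = c \<odot>\<^bsub>M\<^esub> lift M g x"
    and lift_zero: "lift M g \<zero>\<^bsub>S\<^esub> = \<zero>\<^bsub>M\<^esub>"
    and lift_tensor: "w \<in> words A \<Longrightarrow> lift M g (tensor w) = g w"
proof -
  interpret N: module K M by (rule M)
  note gD = multilinearD[OF g] and l = lift_cls[OF M g]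
  show "x \<in> carrier S \<Longrightarrow> lift M g x \<in> carrier M"
    by (auto elim!: Sha_cases simp: l linear_ext_closed[OF M gD(1)])
  show "\<lbrakk>x \<in> carrier S; y \<in> carrier S\<rbrakk> \<Longrightarrow> lift M g (x \<oplus>\<^bsub>S\<^esub> y) = lift M g x \<oplus>\<^bsub>M\<^esub> lift M g y"
    by (auto elim!: Sha_cases simp: l linear_ext_append[OF M gD(1)] add_cls)
  show "\<lbrakk>c \<in> carrier K; x \<in> carrier S\<rbrakk> \<Longrightarrow> lift M g (c \<odot>\<^bsub>S\<^esub> x) = c \<odot>\<^bsub>M\<^esub> lift M g x"
    by (auto elim!: Sha_cases simp: l linear_ext_scale[OF M gD(1)] smult_cls)
  show "lift M g \<zero>\<^bsub>S\<^esub> = \<zero>\<^bsub>M\<^esub>" by (simp add: zero_Sha l)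
  show "w \<in> words A \<Longrightarrow> lift M g (tensor w) = g w" by (simp add: tensor_def l gD)
qed

section \<open>Prefixing a tensor factor\<close>

text \<open>The map \<open>x \<mapsto> a \<otimes> x\<close>. For \<open>a = 1\<close> it is the Rota-Baxter operator of \<open>Sha(A)\<close>.\<close>

definition prefix :: "('k, 'a) univ \<Rightarrow> ('k, 'a) univ \<Rightarrow> ('k, 'a) univ" where
  "prefix a = lift S (\<lambda>w. tensor (a # w))"

lemma multilinear_prefix:
  assumes "a \<in> carrier A" "multilinear K A M g"
  shows "multilinear K A M (\<lambda>w. g (a # w))"
proof -
  note gD = multilinearD[OF assms(2)]
  have "g (a # u @ x # v) = g ((a # u) @ x # v)" for u v x by simp
  then show ?thesis
    unfolding multilinear_def using assms(1) gD(1) gD(2)[of "a # _"] gD(3)[of "a # _"] by simp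
qed

lemmas prefix_props =
  lift_props[OF module_Sha multilinear_prefix[OF _ multilinear_tensor], folded prefix_def]
lemmas prefix_simps [simp] = prefix_props(1,5)

lemma prefix_factor_closed [simp]: "\<lbrakk>xs \<in> F; a \<in> carrier A\<rbrakk> \<Longrightarrow> prefix_factor a xs \<in> F"
  by (induction xs rule: formal_sums_induct) auto

lemma cls_prefix_factor:
  assumes "a \<in> carrier A" "xs \<in> F"
  shows "clsA (prefix_factor a xs) = prefix a (clsA xs)"
proof -
  have "prefix a (clsA xs) = linear_ext S (\<lambda>w. tensor (a # w)) xs"
    unfolding prefix_def
    using assms lift_cls[OF module_Sha multilinear_prefix[OF _ multilinear_tensor]] by simp
  also have "\<dots> = linear_ext S tensor (prefix_factor a xs)"
    using assms(2) by (induction xs rule: formal_sums_induct) auto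
  finally show ?thesis using assms cls_linear_ext by simp
qed

lemma Sha_P_prefix: "x \<in> carrier S \<Longrightarrow> Sha_P K A x = prefix \<one>\<^bsub>A\<^esub> x"
  unfolding Sha_P_def by (simp add: cls_prefix_factor un_Ten_closed cls_un_Ten)

lemma prefix_add_left:
  assumes "x \<in> carrier S" "a \<in> carrier A" "b \<in> carrier A"
  shows "prefix (a \<oplus>\<^bsub>A\<^esub> b) x = prefix a x \<oplus>\<^bsub>S\<^esub> prefix b x"
  using assms(1)
proof (induction x rule: Sha_induct)
  case (add c w x)
  then have "tensor ((a \<oplus>\<^bsub>A\<^esub> b) # w) = tensor (a # w) \<oplus>\<^bsub>S\<^esub> tensor (b # w)"
    using multilinearD(2)[OF multilinear_tensor, of "[]" w a b] assms words_lists[OF add.hyps(2)]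
    by simp
  with add show ?case using assms by (simp add: prefix_props S.smult_r_distr S.M.a_ac)
qed (use assms in \<open>simp add: prefix_props\<close>)

lemma prefix_smult_left:
  assumes "x \<in> carrier S" "r \<in> carrier K" "a \<in> carrier A"
  shows "prefix (r \<odot>\<^bsub>A\<^esub> a) x = r \<odot>\<^bsub>S\<^esub> prefix a x"
  using assms(1)
proof (induction x rule: Sha_induct)
  case (add c w x)
  then have "tensor ((r \<odot>\<^bsub>A\<^esub> a) # w) = r \<odot>\<^bsub>S\<^esub> tensor (a # w)"
    using multilinearD(3)[OF multilinear_tensor, of "[]" w r a] assms words_lists[OF add.hyps(2)]
    by simp
  with add show ?case
    using assms by (simp add: prefix_props S.smult_r_distr S.smult_assoc1[symmetric] R.m_comm)
qed (use assms in \<open>simp add: prefix_props\<close>)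


section \<open>The shuffle product\<close>

abbreviation "one_A \<equiv> \<one>\<^bsub>A\<^esub>"

lemma diamond_closed: "\<lbrakk>u \<in> words A; v \<in> words A\<rbrakk> \<Longrightarrow> diamond K lam A u v \<in> F"
proof (induction "length u + length v" arbitrary: u v rule: less_induct)
  case less
  obtain a u' b v' where uv: "u = a # u'" "v = b # v'"
    using less.prems by (cases u; cases v) auto
  show ?case
  proof (cases "u' = [] \<or> v' = []")
    case True
    then show ?thesis using less.prems uv by (cases u'; cases v') auto
  next
    case False
    then obtain a' u'' b' v'' where uv': "u' = a' # u''" "v' = b' # v''"
      by (cases u'; cases v') auto
    show ?thesis
      using less.prems less.hyps[of u' "one_A # v'"] less.hyps[of "one_A # u'" v']
        less.hyps[of u' v'] lam
      by (simp add: uv uv')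
  qed
qed

definition shuffle :: "('k, 'a) univ list \<Rightarrow> ('k, 'a) univ list \<Rightarrow> ('k, 'a) univ" where
  "shuffle u v = clsA (diamond K lam A u v)"

lemma shuffle_closed [simp]: "\<lbrakk>u \<in> words A; v \<in> words A\<rbrakk> \<Longrightarrow> shuffle u v \<in> carrier S"
  by (simp add: shuffle_def diamond_closed)

lemma shuffle_single_left: "v \<noteq> [] \<Longrightarrow> shuffle [a] v = tensor ((a \<otimes>\<^bsub>A\<^esub> hd v) # tl v)"
  and shuffle_single_right: "u \<noteq> [] \<Longrightarrow> shuffle u [b] = tensor ((hd u \<otimes>\<^bsub>A\<^esub> b) # tl u)"
   apply (cases v; simp add: shuffle_def tensor_def)
  apply (cases u; cases "tl u"; simp add: shuffle_def tensor_def)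
  done

lemma shuffle_Cons:
  assumes "a \<in> carrier A" "b \<in> carrier A" "u \<in> words A" "v \<in> words A"
  shows "shuffle (a # u) (b # v)
    = prefix (a \<otimes>\<^bsub>A\<^esub> b) (shuffle u (one_A # v) \<oplus>\<^bsub>S\<^esub> shuffle (one_A # u) v \<oplus>\<^bsub>S\<^esub> lam \<odot>\<^bsub>S\<^esub> shuffle u v)"
proof -
  obtain a' u' b' v' where uv: "u = a' # u'" "v = b' # v'"
    using assms by (cases u; cases v) auto
  have "diamond K lam A u (one_A # v) \<in> F" "diamond K lam A (one_A # u) v \<in> F"
      "diamond K lam A u v \<in> F"
    using assms by (simp_all add: diamond_closed)
  then show ?thesis
    using assms lam by (simp add: shuffle_def uv cls_prefix_factor add_cls smult_cls S.M.a_assoc)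
qed

lemma shuffle_comm: "\<lbrakk>u \<in> words A; v \<in> words A\<rbrakk> \<Longrightarrow> shuffle u v = shuffle v u"
proof (induction "length u + length v" arbitrary: u v rule: less_induct)
  case less
  obtain a u' b v' where uv: "u = a # u'" "v = b # v'"
    using less.prems by (cases u; cases v) auto
  consider "u' = []" | "v' = []" | "u' \<in> words A" "v' \<in> words A"
    using less.prems uv by auto
  then show ?case
  proof cases
    case 3
    have "shuffle u' (one_A # v') = shuffle (one_A # v') u'"
      "shuffle (one_A # u') v' = shuffle v' (one_A # u')"
      "shuffle u' v' = shuffle v' u'"
      by (intro less.hyps; use 3 uv in simp)+
    then show ?thesis using less.prems 3 lam by (simp add: uv shuffle_Cons m_comm S.M.a_ac)
  qed (use less.prems in \<open>auto simp: uv shuffle_single_left shuffle_single_right m_comm\<close>)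
qed

text \<open>If one of the words has length one, the product is a pure tensor. Otherwise, a slot in the
tail survives in each of the three summands of the recursion, whose words have smaller total
length; a slot in the head only affects the factor \<open>a b\<close>, in which prefixing is linear.\<close>

lemma shuffle_slot:
  assumes "w \<in> words A" "u \<in> lists (carrier A)" "v \<in> lists (carrier A)"
  shows "\<lbrakk>x \<in> carrier A; y \<in> carrier A\<rbrakk> \<Longrightarrow> shuffle w (u @ (x \<oplus>\<^bsub>A\<^esub> y) # v)
      = shuffle w (u @ x # v) \<oplus>\<^bsub>S\<^esub> shuffle w (u @ y # v)"
    and "\<lbrakk>r \<in> carrier K; x \<in> carrier A\<rbrakk> \<Longrightarrow> shuffle w (u @ (r \<odot>\<^bsub>A\<^esub> x) # v) = r \<odot>\<^bsub>S\<^esub> shuffle w (u @ x # v)"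
proof -
  note tD = multilinearD[OF multilinear_tensor]
  have smult_right: "a \<otimes>\<^bsub>A\<^esub> (r \<odot>\<^bsub>A\<^esub> x) = r \<odot>\<^bsub>A\<^esub> (a \<otimes>\<^bsub>A\<^esub> x)"
    if "r \<in> carrier K" "x \<in> carrier A" "a \<in> carrier A" for r x a
    using that smult_assoc2[of r x a] by (simp add: m_comm)
  have "(\<forall>x\<in>carrier A. \<forall>y\<in>carrier A. shuffle w (u @ (x \<oplus>\<^bsub>A\<^esub> y) # v)
      = shuffle w (u @ x # v) \<oplus>\<^bsub>S\<^esub> shuffle w (u @ y # v))
    \<and> (\<forall>r\<in>carrier K. \<forall>x\<in>carrier A. shuffle w (u @ (r \<odot>\<^bsub>A\<^esub> x) # v) = r \<odot>\<^bsub>S\<^esub> shuffle w (u @ x # v))"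
    using assms
  proof (induction "length w + length u" arbitrary: w u rule: less_induct)
    case less
    obtain a w' where w: "w = a # w'" using less.prems by (cases w) auto
    have a: "a \<in> carrier A" using less.prems w by simp
    show ?case
    proof (cases u)
      case Nil
      consider "w' = []" | "w' \<in> words A" "v = []" | "w' \<in> words A" "v \<in> words A"
        using less.prems w by (auto simp: words_def)
      then show ?thesis
      proof cases
        case 1
        then show ?thesis using a less.prems tD(2)[of "[]" v] tD(3)[of "[]" v]
          by (simp add: w Nil shuffle_single_left r_distr smult_right)
      next
        case 2
        then show ?thesis using a less.prems tD(2)[of "[]" w'] tD(3)[of "[]" w']
          by (simp add: w Nil shuffle_single_right r_distr smult_right words_lists)
      next
        case 3
        then show ?thesis using a less.prems lam
          by (simp add: w Nil shuffle_Cons r_distr smult_right prefix_add_left prefix_smult_left)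
      qed
    next
      case (Cons b u')
      then have b: "b \<in> carrier A" and u': "u' \<in> lists (carrier A)" using less.prems by auto
      consider "w' = []" | "w' \<in> words A" using less.prems w by auto
      then show ?thesis
      proof cases
        case 1
        then show ?thesis
          using a b u' less.prems tD(2)[of "(a \<otimes>\<^bsub>A\<^esub> b) # u'" v] tD(3)[of "(a \<otimes>\<^bsub>A\<^esub> b) # u'" v]
          by (simp add: w Cons shuffle_single_left)
      next
        case 2
        note IH1 = less.hyps[of w' "one_A # u'"]
        note IH2 = less.hyps[of "one_A # w'" u']
        note IH3 = less.hyps[of w' u']
        show ?thesis
          using 2 a b u' less.prems lam IH1 IH2 IH3
          by (simp add: w Cons shuffle_Cons prefix_props S.M.a_ac S.smult_r_distr
              S.smult_assoc1[symmetric] R.m_comm)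
      qed
    qed
  qed
  then show "\<lbrakk>x \<in> carrier A; y \<in> carrier A\<rbrakk>
    \<Longrightarrow> shuffle w (u @ (x \<oplus>\<^bsub>A\<^esub> y) # v) = shuffle w (u @ x # v) \<oplus>\<^bsub>S\<^esub> shuffle w (u @ y # v)"
    and "\<lbrakk>r \<in> carrier K; x \<in> carrier A\<rbrakk> \<Longrightarrow> shuffle w (u @ (r \<odot>\<^bsub>A\<^esub> x) # v) = r \<odot>\<^bsub>S\<^esub> shuffle w (u @ x # v)"
    by blast+
qed

lemma multilinear_shuffle: "u \<in> words A \<Longrightarrow> multilinear K A S (shuffle u)"
  by (simp add: multilinear_def shuffle_slot)

lemmas lift_shuffle = lift_props[OF module_Sha multilinear_shuffle]

text \<open>Extending the product linearly in the second argument leaves it multilinear in the first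
word, so that it can be extended there as well.\<close>

lemma multilinear_lift_shuffle:
  assumes "y \<in> carrier S"
  shows "multilinear K A S (\<lambda>u. lift S (shuffle u) y)"
proof -
  have "lift S (shuffle (u @ (a \<oplus>\<^bsub>A\<^esub> b) # v)) y
      = lift S (shuffle (u @ a # v)) y \<oplus>\<^bsub>S\<^esub> lift S (shuffle (u @ b # v)) y"
    if "u \<in> lists (carrier A)" "v \<in> lists (carrier A)" "a \<in> carrier A" "b \<in> carrier A" for u v a b
    using assms
  proof (induction y rule: Sha_induct)
    case (add c w x)
    have "shuffle (u @ (a \<oplus>\<^bsub>A\<^esub> b) # v) w = shuffle (u @ a # v) w \<oplus>\<^bsub>S\<^esub> shuffle (u @ b # v) w"
      using that add shuffle_slot(1)[of w u v a b] shuffle_comm by simp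
    with add that show ?case by (simp add: lift_shuffle S.smult_r_distr S.M.a_ac)
  qed (use that in \<open>simp add: lift_shuffle\<close>)
  moreover have "lift S (shuffle (u @ (r \<odot>\<^bsub>A\<^esub> a) # v)) y = r \<odot>\<^bsub>S\<^esub> lift S (shuffle (u @ a # v)) y"
    if "u \<in> lists (carrier A)" "v \<in> lists (carrier A)" "r \<in> carrier K" "a \<in> carrier A" for u v r a
    using assms
  proof (induction y rule: Sha_induct)
    case (add c w x)
    have "shuffle (u @ (r \<odot>\<^bsub>A\<^esub> a) # v) w = r \<odot>\<^bsub>S\<^esub> shuffle (u @ a # v) w"
      using that add shuffle_slot(2)[of w u v r a] shuffle_comm by simp
    with add that show ?case
      by (simp add: lift_shuffle S.smult_r_distr S.smult_assoc1[symmetric] R.m_comm)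
  qed (use that in \<open>simp add: lift_shuffle\<close>)
  ultimately show ?thesis using assms by (simp add: multilinear_def lift_shuffle)
qed

lemma cls_diamond_sums:
  assumes "xs \<in> F" "ys \<in> F"
  shows "diamond_sums K lam A xs ys \<in> F"
    and "clsA (diamond_sums K lam A xs ys) = linear_ext S (\<lambda>u. linear_ext S (shuffle u) ys) xs"
proof -
  define row where "row c u ys = concat (map (\<lambda>(d, v). scale K (c \<otimes>\<^bsub>K\<^esub> d) (diamond K lam A u v)) ys)"
    for c :: 'k and u and ys :: "('k \<times> ('k, 'a) univ list) list"
  have row: "row c u ys \<in> F \<and> clsA (row c u ys) = c \<odot>\<^bsub>S\<^esub> linear_ext S (shuffle u) ys"
    if "c \<in> carrier K" "u \<in> words A" for c u
    using assms(2)
  proof (induction ys rule: formal_sums_induct)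
    case (Cons d v ys)
    have "linear_ext S (shuffle u) ys \<in> carrier S"
      using Cons that by (intro linear_ext_closed[OF module_Sha]) auto
    with Cons that show ?case
      by (simp add: row_def diamond_closed add_cls[symmetric] smult_cls[symmetric]
          shuffle_def[symmetric]
          S.smult_r_distr S.smult_assoc1)
  qed (use that in \<open>simp add: row_def zero_Sha[symmetric]\<close>)
  have "diamond_sums K lam A xs ys \<in> F
    \<and> clsA (diamond_sums K lam A xs ys) = linear_ext S (\<lambda>u. linear_ext S (shuffle u) ys) xs"
    using assms(1)
  proof (induction xs rule: formal_sums_induct)
    case Nil
    then show ?case by (simp add: diamond_sums_def zero_Sha)
  next
    case (Cons c u xs)
    have "diamond_sums K lam A ((c, u) # xs) ys = row c u ys @ diamond_sums K lam A xs ys"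
      by (simp add: diamond_sums_def row_def)
    with Cons row[of c u] show ?case by (simp add: add_cls[symmetric])
  qed
  then show "diamond_sums K lam A xs ys \<in> F"
    and "clsA (diamond_sums K lam A xs ys) = linear_ext S (\<lambda>u. linear_ext S (shuffle u) ys) xs"
    by auto
qed

lemma mult_Sha:
  "\<lbrakk>x \<in> carrier S; y \<in> carrier S\<rbrakk> \<Longrightarrow> x \<otimes>\<^bsub>S\<^esub> y = lift S (\<lambda>u. lift S (shuffle u) y) x"
  using cls_diamond_sums(2)[OF un_Ten_closed un_Ten_closed, of x y] by (simp add: Sha_def lift_def)

lemma mult_closed [simp]: "\<lbrakk>x \<in> carrier S; y \<in> carrier S\<rbrakk> \<Longrightarrow> x \<otimes>\<^bsub>S\<^esub> y \<in> carrier S"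
  by (simp add: mult_Sha lift_props[OF module_Sha multilinear_lift_shuffle])

lemma mult_tensor_left: "\<lbrakk>u \<in> words A; y \<in> carrier S\<rbrakk> \<Longrightarrow> tensor u \<otimes>\<^bsub>S\<^esub> y = lift S (shuffle u) y"
  by (simp add: mult_Sha lift_props[OF module_Sha multilinear_lift_shuffle])

lemma mult_tensor: "\<lbrakk>u \<in> words A; v \<in> words A\<rbrakk> \<Longrightarrow> tensor u \<otimes>\<^bsub>S\<^esub> tensor v = shuffle u v"
  by (simp add: mult_tensor_left lift_shuffle)

lemma mult_left:
  assumes "z \<in> carrier S"
  shows "\<lbrakk>x \<in> carrier S; y \<in> carrier S\<rbrakk> \<Longrightarrow> (x \<oplus>\<^bsub>S\<^esub> y) \<otimes>\<^bsub>S\<^esub> z = x \<otimes>\<^bsub>S\<^esub> z \<oplus>\<^bsub>S\<^esub> y \<otimes>\<^bsub>S\<^esub> z"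
    and "\<lbrakk>c \<in> carrier K; x \<in> carrier S\<rbrakk> \<Longrightarrow> (c \<odot>\<^bsub>S\<^esub> x) \<otimes>\<^bsub>S\<^esub> z = c \<odot>\<^bsub>S\<^esub> (x \<otimes>\<^bsub>S\<^esub> z)"
    and "\<zero>\<^bsub>S\<^esub> \<otimes>\<^bsub>S\<^esub> z = \<zero>\<^bsub>S\<^esub>"
  using assms by (simp_all add: mult_Sha lift_props[OF module_Sha multilinear_lift_shuffle])

lemma mult_comm_tensor:
  assumes "y \<in> carrier S" "u \<in> words A"
  shows "tensor u \<otimes>\<^bsub>S\<^esub> y = y \<otimes>\<^bsub>S\<^esub> tensor u"
  using assms(1)
proof (induction y rule: Sha_induct)
  case zero
  then show ?case using assms by (simp add: mult_tensor_left lift_shuffle mult_left)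
next
  case (add c w x)
  then show ?case
    using assms by (simp add: mult_tensor_left lift_shuffle mult_left mult_tensor shuffle_comm)
qed

lemma mult_comm:
  assumes "x \<in> carrier S" "y \<in> carrier S"
  shows "x \<otimes>\<^bsub>S\<^esub> y = y \<otimes>\<^bsub>S\<^esub> x"
  using assms(1)
proof (induction x rule: Sha_induct)
  case zero
  show ?case
    using assms(2)
  proof (induction y rule: Sha_induct)
    case (add c w x)
    then show ?case using mult_comm_tensor[of "\<zero>\<^bsub>S\<^esub>" w] by (simp add: mult_left)
  qed simp
next
  case (add c w x)
  have right: "y \<otimes>\<^bsub>S\<^esub> (c \<odot>\<^bsub>S\<^esub> tensor w \<oplus>\<^bsub>S\<^esub> x) = c \<odot>\<^bsub>S\<^esub> (y \<otimes>\<^bsub>S\<^esub> tensor w) \<oplus>\<^bsub>S\<^esub> y \<otimes>\<^bsub>S\<^esub> x"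
    using assms(2)
  proof (induction y rule: Sha_induct)
    case zero
    then show ?case using add by (simp add: mult_left)
  next
    case step: (add d v y)
    with add show ?case
      by (simp add: mult_left mult_tensor_left lift_shuffle S.smult_r_distr
          S.smult_assoc1[symmetric] R.m_comm S.M.a_ac)
  qed
  then show ?case using add assms(2) by (simp add: mult_left mult_comm_tensor)
qed

lemma mult_right:
  assumes "z \<in> carrier S"
  shows "\<lbrakk>x \<in> carrier S; y \<in> carrier S\<rbrakk> \<Longrightarrow> z \<otimes>\<^bsub>S\<^esub> (x \<oplus>\<^bsub>S\<^esub> y) = z \<otimes>\<^bsub>S\<^esub> x \<oplus>\<^bsub>S\<^esub> z \<otimes>\<^bsub>S\<^esub> y"
    and "\<lbrakk>c \<in> carrier K; x \<in> carrier S\<rbrakk> \<Longrightarrow> z \<otimes>\<^bsub>S\<^esub> (c \<odot>\<^bsub>S\<^esub> x) = c \<odot>\<^bsub>S\<^esub> (z \<otimes>\<^bsub>S\<^esub> x)"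
    and "z \<otimes>\<^bsub>S\<^esub> \<zero>\<^bsub>S\<^esub> = \<zero>\<^bsub>S\<^esub>"
  using assms mult_left[OF assms] by (simp_all add: mult_comm[OF assms])

lemma mult_single_single: "\<lbrakk>a \<in> carrier A; b \<in> carrier A\<rbrakk>
    \<Longrightarrow> tensor [a] \<otimes>\<^bsub>S\<^esub> tensor [b] = tensor [a \<otimes>\<^bsub>A\<^esub> b]"
  by (simp add: mult_tensor shuffle_single_left)

lemma mult_single_prefix:
  assumes "x \<in> carrier S" "a \<in> carrier A" "b \<in> carrier A"
  shows "tensor [a] \<otimes>\<^bsub>S\<^esub> prefix b x = prefix (a \<otimes>\<^bsub>A\<^esub> b) x"
  using assms(1)
proof (induction x rule: Sha_induct)
  case (add c w x)
  then show ?case using assms by (simp add: prefix_props mult_right mult_tensor shuffle_single_left)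
qed (use assms in \<open>simp add: prefix_props mult_right\<close>)

text \<open>The recursion for words holds for arbitrary tensors \<open>x\<close> and \<open>y\<close> by bilinearity. Only in
this form can it be iterated, since one application already produces a sum.\<close>

lemma mult_prefix:
  assumes x: "x \<in> carrier S" and y: "y \<in> carrier S" and a: "a \<in> carrier A" and b: "b \<in> carrier A"
  shows "prefix a x \<otimes>\<^bsub>S\<^esub> prefix b y = prefix (a \<otimes>\<^bsub>A\<^esub> b)
    (x \<otimes>\<^bsub>S\<^esub> prefix one_A y \<oplus>\<^bsub>S\<^esub> prefix one_A x \<otimes>\<^bsub>S\<^esub> y \<oplus>\<^bsub>S\<^esub> lam \<odot>\<^bsub>S\<^esub> (x \<otimes>\<^bsub>S\<^esub> y))"
  using x
proof (induction x rule: Sha_induct)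
  case zero
  then show ?case using y a b lam by (simp add: prefix_props mult_left)
next
  case (add c u x)
  have "prefix a (tensor u) \<otimes>\<^bsub>S\<^esub> prefix b y = prefix (a \<otimes>\<^bsub>A\<^esub> b)
    (tensor u \<otimes>\<^bsub>S\<^esub> prefix one_A y \<oplus>\<^bsub>S\<^esub> prefix one_A (tensor u) \<otimes>\<^bsub>S\<^esub> y \<oplus>\<^bsub>S\<^esub> lam \<odot>\<^bsub>S\<^esub> (tensor u \<otimes>\<^bsub>S\<^esub> y))"
    using y
  proof (induction y rule: Sha_induct)
    case zero
    then show ?case using add a b lam by (simp add: prefix_props mult_right)
  next
    case step: (add d v y)
    have "tensor (a # u) \<otimes>\<^bsub>S\<^esub> tensor (b # v) = prefix (a \<otimes>\<^bsub>A\<^esub> b)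
      (tensor u \<otimes>\<^bsub>S\<^esub> tensor (one_A # v) \<oplus>\<^bsub>S\<^esub> tensor (one_A # u) \<otimes>\<^bsub>S\<^esub> tensor v
        \<oplus>\<^bsub>S\<^esub> lam \<odot>\<^bsub>S\<^esub> (tensor u \<otimes>\<^bsub>S\<^esub> tensor v))"
      using add step a b by (simp add: mult_tensor shuffle_Cons)
    with step add a b lam show ?case
      by (simp add: prefix_props mult_right S.smult_r_distr S.smult_assoc1[symmetric] R.m_comm
          S.M.a_ac)
  qed
  with add y a b lam show ?case
    by (simp add: prefix_props mult_left S.smult_r_distr S.smult_assoc1[symmetric] R.m_comm
        S.M.a_ac)
qed


lemma tensor_Cons: "\<lbrakk>a \<in> carrier A; w \<in> words A\<rbrakk> \<Longrightarrow> tensor (a # w) = prefix a (tensor w)"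
  by simp

text \<open>Multiplication by a tensor of length one acts on the head of a word alone.\<close>

lemma mult_single_assoc:
  assumes a: "a \<in> carrier A" and "v \<in> words A" "w \<in> words A"
  shows "tensor [a] \<otimes>\<^bsub>S\<^esub> (tensor v \<otimes>\<^bsub>S\<^esub> tensor w) = (tensor [a] \<otimes>\<^bsub>S\<^esub> tensor v) \<otimes>\<^bsub>S\<^esub> tensor w"
proof -
  obtain b v' c w' where vw: "v = b # v'" "w = c # w'"
    using assms by (cases v; cases w) auto
  have b: "b \<in> carrier A" and c: "c \<in> carrier A" using assms vw by auto
  have right: "prefix b x \<otimes>\<^bsub>S\<^esub> tensor [c] = prefix (b \<otimes>\<^bsub>A\<^esub> c) x" if "x \<in> carrier S" "b \<in> carrier A"
      for x b
    using that c mult_comm[of "prefix b x" "tensor [c]"] by (simp add: mult_single_prefix m_comm)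
  consider "v' = []" "w' = []" | "v' = []" "w' \<in> words A" | "v' \<in> words A" "w' = []"
    | "v' \<in> words A" "w' \<in> words A"
    using assms vw by auto
  then show ?thesis
  proof cases
    case 1
    then show ?thesis using a b c by (simp add: vw mult_single_single m_assoc)
  next
    case 2
    then show ?thesis
      using a b c
      by (simp add: vw tensor_Cons mult_single_single mult_single_prefix m_assoc del: prefix_simps(2))
  next
    case 3
    then show ?thesis
      using a b c
      by (simp add: vw tensor_Cons mult_single_prefix right m_assoc del: prefix_simps(2))
  next
    case 4
    then show ?thesis
      using a b c lam
      by (simp add: vw tensor_Cons mult_prefix mult_single_prefix m_assoc del: prefix_simps(2))
  qed
qed

text \<open>If one of the words has length one, commutativity brings it to the front, where the
previous lemma applies. Otherwise write the tensors as \<open>a \<otimes> x\<close>, \<open>b \<otimes> y\<close>, \<open>c \<otimes> z\<close> and put \<open>P x =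
1 \<otimes> x\<close>. Expanding both sides with \<open>mult_prefix\<close> gives \<open>a b c\<close> prefixed to a combination of seven
triple products of \<open>x\<close>, \<open>y\<close>, \<open>z\<close> and their images under \<open>P\<close>. In each of them at least one \<open>P\<close> is
missing, so the total length is smaller and the induction hypothesis applies.\<close>

lemma mult_assoc_tensor:
  "\<lbrakk>u \<in> words A; v \<in> words A; w \<in> words A\<rbrakk>
    \<Longrightarrow> (tensor u \<otimes>\<^bsub>S\<^esub> tensor v) \<otimes>\<^bsub>S\<^esub> tensor w = tensor u \<otimes>\<^bsub>S\<^esub> (tensor v \<otimes>\<^bsub>S\<^esub> tensor w)"
proof (induction "length u + length v + length w" arbitrary: u v w rule: less_induct)
  case less
  obtain a u' b v' c w' where uvw: "u = a # u'" "v = b # v'" "w = c # w'"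
    using less.prems by (cases u; cases v; cases w) auto
  have abc: "a \<in> carrier A" "b \<in> carrier A" "c \<in> carrier A" using less.prems uvw by auto
  consider "u' = []" | "v' = []" | "w' = []" | "u' \<in> words A" "v' \<in> words A" "w' \<in> words A"
    using less.prems uvw by auto
  then show ?case
  proof cases
    case 1
    then show ?thesis using mult_single_assoc[of a v w] less.prems uvw by simp
  next
    case 2
    have "(tensor u \<otimes>\<^bsub>S\<^esub> tensor [b]) \<otimes>\<^bsub>S\<^esub> tensor w = tensor [b] \<otimes>\<^bsub>S\<^esub> (tensor u \<otimes>\<^bsub>S\<^esub> tensor w)"
      using mult_single_assoc[of b u w] less.prems abc mult_comm[of "tensor u" "tensor [b]"] by simp
    also have "\<dots> = tensor u \<otimes>\<^bsub>S\<^esub> (tensor [b] \<otimes>\<^bsub>S\<^esub> tensor w)"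
      using mult_single_assoc[of b w u] less.prems abc mult_comm[of "tensor u" "tensor w"]
        mult_comm[of "tensor u" "tensor [b] \<otimes>\<^bsub>S\<^esub> tensor w"] by simp
    finally show ?thesis using 2 uvw by simp
  next
    case 3
    have "(tensor u \<otimes>\<^bsub>S\<^esub> tensor v) \<otimes>\<^bsub>S\<^esub> tensor [c] = tensor [c] \<otimes>\<^bsub>S\<^esub> (tensor v \<otimes>\<^bsub>S\<^esub> tensor u)"
      using less.prems abc mult_comm[of "tensor u" "tensor v"]
        mult_comm[of "tensor v \<otimes>\<^bsub>S\<^esub> tensor u" "tensor [c]"] by simp
    also have "\<dots> = tensor u \<otimes>\<^bsub>S\<^esub> (tensor v \<otimes>\<^bsub>S\<^esub> tensor [c])"
      using mult_single_assoc[of c v u] less.prems abc mult_comm[of "tensor v" "tensor [c]"]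
        mult_comm[of "tensor u" "tensor [c] \<otimes>\<^bsub>S\<^esub> tensor v"] by simp
    finally show ?thesis using 3 uvw by simp
  next
    case 4
    define x y z where xyz: "x = tensor u'" "y = tensor v'" "z = tensor w'"
    define Px Py Pz where P: "Px = tensor (one_A # u')" "Py = tensor (one_A # v')"
      "Pz = tensor (one_A # w')"
    have prefix: "prefix one_A x = Px" "prefix one_A y = Py" "prefix one_A z = Pz"
      "tensor u = prefix a x" "tensor v = prefix b y" "tensor w = prefix c z"
      using 4 uvw abc by (simp_all add: xyz P)
    have cl: "x \<in> carrier S" "y \<in> carrier S" "z \<in> carrier S"
      "Px \<in> carrier S" "Py \<in> carrier S" "Pz \<in> carrier S"
      using 4 by (simp_all add: xyz P)
    have IH: "(x \<otimes>\<^bsub>S\<^esub> Py) \<otimes>\<^bsub>S\<^esub> Pz = x \<otimes>\<^bsub>S\<^esub> (Py \<otimes>\<^bsub>S\<^esub> Pz)" "(Px \<otimes>\<^bsub>S\<^esub> y) \<otimes>\<^bsub>S\<^esub> Pz = Px \<otimes>\<^bsub>S\<^esub> (y \<otimes>\<^bsub>S\<^esub> Pz)"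
      "(x \<otimes>\<^bsub>S\<^esub> y) \<otimes>\<^bsub>S\<^esub> Pz = x \<otimes>\<^bsub>S\<^esub> (y \<otimes>\<^bsub>S\<^esub> Pz)" "(Px \<otimes>\<^bsub>S\<^esub> Py) \<otimes>\<^bsub>S\<^esub> z = Px \<otimes>\<^bsub>S\<^esub> (Py \<otimes>\<^bsub>S\<^esub> z)"
      "(x \<otimes>\<^bsub>S\<^esub> Py) \<otimes>\<^bsub>S\<^esub> z = x \<otimes>\<^bsub>S\<^esub> (Py \<otimes>\<^bsub>S\<^esub> z)" "(Px \<otimes>\<^bsub>S\<^esub> y) \<otimes>\<^bsub>S\<^esub> z = Px \<otimes>\<^bsub>S\<^esub> (y \<otimes>\<^bsub>S\<^esub> z)"
      "(x \<otimes>\<^bsub>S\<^esub> y) \<otimes>\<^bsub>S\<^esub> z = x \<otimes>\<^bsub>S\<^esub> (y \<otimes>\<^bsub>S\<^esub> z)"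
      unfolding xyz P by (rule less.hyps; use 4 uvw in simp)+
    \<comment> \<open>The sums are chosen so that \<open>P Q = P x P y\<close> and \<open>P Q' = P y P z\<close>.\<close>
    define Q where "Q = x \<otimes>\<^bsub>S\<^esub> Py \<oplus>\<^bsub>S\<^esub> Px \<otimes>\<^bsub>S\<^esub> y \<oplus>\<^bsub>S\<^esub> lam \<odot>\<^bsub>S\<^esub> (x \<otimes>\<^bsub>S\<^esub> y)"
    define Q' where "Q' = y \<otimes>\<^bsub>S\<^esub> Pz \<oplus>\<^bsub>S\<^esub> Py \<otimes>\<^bsub>S\<^esub> z \<oplus>\<^bsub>S\<^esub> lam \<odot>\<^bsub>S\<^esub> (y \<otimes>\<^bsub>S\<^esub> z)"
    have Q: "Q \<in> carrier S" "prefix one_A Q = Px \<otimes>\<^bsub>S\<^esub> Py" 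
      "prefix a x \<otimes>\<^bsub>S\<^esub> prefix b y = prefix (a \<otimes>\<^bsub>A\<^esub> b) Q"
      using mult_prefix[of x y one_A one_A] mult_prefix[of x y a b] abc cl lam
      by (simp_all add: Q_def prefix)
    have Q': "Q' \<in> carrier S" "prefix one_A Q' = Py \<otimes>\<^bsub>S\<^esub> Pz" 
      "prefix b y \<otimes>\<^bsub>S\<^esub> prefix c z = prefix (b \<otimes>\<^bsub>A\<^esub> c) Q'"
      using mult_prefix[of y z one_A one_A] mult_prefix[of y z b c] abc cl lam
      by (simp_all add: Q'_def prefix)
    have "Q \<otimes>\<^bsub>S\<^esub> Pz \<oplus>\<^bsub>S\<^esub> (Px \<otimes>\<^bsub>S\<^esub> Py) \<otimes>\<^bsub>S\<^esub> z \<oplus>\<^bsub>S\<^esub> lam \<odot>\<^bsub>S\<^esub> (Q \<otimes>\<^bsub>S\<^esub> z)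
      = x \<otimes>\<^bsub>S\<^esub> (Py \<otimes>\<^bsub>S\<^esub> Pz) \<oplus>\<^bsub>S\<^esub> Px \<otimes>\<^bsub>S\<^esub> Q' \<oplus>\<^bsub>S\<^esub> lam \<odot>\<^bsub>S\<^esub> (x \<otimes>\<^bsub>S\<^esub> Q')"
      unfolding Q_def Q'_def using cl lam
      by (simp add: mult_left mult_right IH S.smult_r_distr S.M.a_ac)
    then show ?thesis
      using abc cl Q Q' mult_prefix[of Q z "a \<otimes>\<^bsub>A\<^esub> b" c] mult_prefix[of x Q' a "b \<otimes>\<^bsub>A\<^esub> c"]
      by (simp add: prefix m_assoc)
  qed
qed

lemma mult_assoc:
  assumes "x \<in> carrier S" "y \<in> carrier S" "z \<in> carrier S"
  shows "(x \<otimes>\<^bsub>S\<^esub> y) \<otimes>\<^bsub>S\<^esub> z = x \<otimes>\<^bsub>S\<^esub> (y \<otimes>\<^bsub>S\<^esub> z)"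
proof -
  have 1: "(tensor u \<otimes>\<^bsub>S\<^esub> tensor v) \<otimes>\<^bsub>S\<^esub> z = tensor u \<otimes>\<^bsub>S\<^esub> (tensor v \<otimes>\<^bsub>S\<^esub> z)"
      if "u \<in> words A" "v \<in> words A" for u v
    using assms(3) that
    by (induction z rule: Sha_induct) (simp_all add: mult_right mult_assoc_tensor)
  have 2: "(tensor u \<otimes>\<^bsub>S\<^esub> y) \<otimes>\<^bsub>S\<^esub> z = tensor u \<otimes>\<^bsub>S\<^esub> (y \<otimes>\<^bsub>S\<^esub> z)" if "u \<in> words A" for u
    using assms(2) that assms(3)
    by (induction y rule: Sha_induct) (simp_all add: mult_right mult_left 1)
  show ?thesis
    using assms(1) assms(2,3) by (induction x rule: Sha_induct) (simp_all add: mult_left 2)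
qed

lemma one_eq_tensor: "\<one>\<^bsub>S\<^esub> = tensor [one_A]"
  by (simp add: one_Sha tensor_def)

lemma algebra_Sha: "algebra K S"
proof -
  have "\<one>\<^bsub>S\<^esub> \<otimes>\<^bsub>S\<^esub> x = x" if "x \<in> carrier S" for x
    using that
  proof (induction x rule: Sha_induct)
    case (add c w x)
    then have "tensor [one_A] \<otimes>\<^bsub>S\<^esub> tensor w = tensor w"
      by (cases w) (auto simp: mult_tensor shuffle_single_left)
    with add show ?case by (simp add: one_eq_tensor mult_right)
  qed (simp add: one_eq_tensor mult_right)
  then have "comm_monoid S"
    by (intro comm_monoidI) (auto simp: mult_assoc one_eq_tensor intro: mult_comm)
  then have "cring S"
    using S.M.abelian_group_axioms by (intro cringI) (auto simp: mult_left)
  then show ?thesis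
    by (intro algebra.intro module_Sha algebra_axioms.intro) (auto simp: mult_left)
qed

sublocale S: algebra K S
  by (rule algebra_Sha)

text \<open>The Rota-Baxter identity is \<open>mult_prefix\<close> with both heads equal to \<open>1\<close>.\<close>

lemma rota_baxter_Sha: "rota_baxter K lam S (Sha_P K A)"
  unfolding rota_baxter_def
proof (intro conjI ballI algebra_Sha funcsetI)
  fix x y assume x: "x \<in> carrier S" and y: "y \<in> carrier S"
  then have "Sha_P K A x \<otimes>\<^bsub>S\<^esub> Sha_P K A y
    = prefix one_A (x \<otimes>\<^bsub>S\<^esub> prefix one_A y \<oplus>\<^bsub>S\<^esub> y \<otimes>\<^bsub>S\<^esub> prefix one_A x \<oplus>\<^bsub>S\<^esub> lam \<odot>\<^bsub>S\<^esub> (x \<otimes>\<^bsub>S\<^esub> y))"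
    by (simp add: Sha_P_prefix mult_prefix mult_comm[of y])
  also have "\<dots> = Sha_P K A (x \<otimes>\<^bsub>S\<^esub> Sha_P K A y) \<oplus>\<^bsub>S\<^esub> Sha_P K A (y \<otimes>\<^bsub>S\<^esub> Sha_P K A x)
    \<oplus>\<^bsub>S\<^esub> lam \<odot>\<^bsub>S\<^esub> Sha_P K A (x \<otimes>\<^bsub>S\<^esub> y)"
    using x y lam by (simp add: Sha_P_prefix prefix_props)
  finally show "Sha_P K A x \<otimes>\<^bsub>S\<^esub> Sha_P K A y = \<dots>" .
qed (auto simp: Sha_P_prefix prefix_props)

section \<open>The universal property\<close>

lemma tensor_Cons_mult: "\<lbrakk>a \<in> carrier A; w \<in> words A\<rbrakk>
    \<Longrightarrow> tensor (a # w) = tensor [a] \<otimes>\<^bsub>S\<^esub> Sha_P K A (tensor w)"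
  by (simp add: Sha_P_prefix mult_tensor shuffle_single_left)

lemma nested_P_Cons: "w \<noteq> [] \<Longrightarrow> nested_P R P (a # w) = a \<otimes>\<^bsub>R\<^esub> P (nested_P R P w)"
  by (cases w) auto

text \<open>The word \<open>a\<^sub>0 \<dots> a\<^sub>n\<close> is sent to \<open>\<phi> a\<^sub>0 P (\<phi> a\<^sub>1 P (\<dots> P (\<phi> a\<^sub>n) \<dots>))\<close>, the only possible value of
a Rota-Baxter homomorphism that extends \<open>\<phi>\<close>.\<close>

definition nest :: "('k, 'c) module \<Rightarrow> ('c \<Rightarrow> 'c) \<Rightarrow> (('k, 'a) univ \<Rightarrow> 'c) \<Rightarrow>
    ('k, 'a) univ list \<Rightarrow> 'c" where
  "nest R P \<phi> w = nested_P R P (map \<phi> w)"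

lemma nest_Cons: "nest R P \<phi> (a # w) = (if w = [] then \<phi> a else \<phi> a \<otimes>\<^bsub>R\<^esub> P (nest R P \<phi> w))"
  by (simp add: nest_def nested_P_Cons)

context
  fixes R :: "('k, 'c) module" and P and \<phi>
  assumes R: "rota_baxter K lam R P" and \<phi>: "\<phi> \<in> alg_hom K A R"
begin

lemmas PD = rota_baxterD[OF R] and phiD = alg_homD[OF \<phi>]

interpretation R: algebra K R by (rule PD)

lemma nest_closed: "w \<in> words A \<Longrightarrow> nest R P \<phi> w \<in> carrier R"
  by (induction w) (auto simp: nest_Cons PD phiD)

lemma multilinear_nest: "multilinear K A R (nest R P \<phi>)"
proof -
  have smult_right: "a \<otimes>\<^bsub>R\<^esub> (r \<odot>\<^bsub>R\<^esub> x) = r \<odot>\<^bsub>R\<^esub> (a \<otimes>\<^bsub>R\<^esub> x)"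
    if "r \<in> carrier K" "x \<in> carrier R" "a \<in> carrier R" for r x a
    using that R.smult_assoc2[of r x a] by (simp add: R.m_comm)
  have nest_v: "P (nest R P \<phi> v) \<in> carrier R" if "v \<in> lists (carrier A)" "v \<noteq> []" for v
    using that nest_closed[of v] by (simp add: words_def PD)
  have "nest R P \<phi> (u @ (a \<oplus>\<^bsub>A\<^esub> b) # v) = nest R P \<phi> (u @ a # v) \<oplus>\<^bsub>R\<^esub> nest R P \<phi> (u @ b # v)"
    if "u \<in> lists (carrier A)" "v \<in> lists (carrier A)" "a \<in> carrier A" "b \<in> carrier A" for u v a b
    using that nest_v
    by (induction u) (auto simp: nest_Cons phiD R.l_distr R.r_distr PD nest_closed)
  moreover have "nest R P \<phi> (u @ (r \<odot>\<^bsub>A\<^esub> a) # v) = r \<odot>\<^bsub>R\<^esub> nest R P \<phi> (u @ a # v)"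
    if "u \<in> lists (carrier A)" "v \<in> lists (carrier A)" "r \<in> carrier K" "a \<in> carrier A" for u v r a
    using that nest_v
    by (induction u) (auto simp: nest_Cons phiD R.smult_assoc2 smult_right PD nest_closed)
  ultimately show ?thesis by (simp add: multilinear_def nest_closed)
qed

lemmas lift_nest = lift_props[OF R.module multilinear_nest]

lemma lift_nest_prefix:
  assumes "x \<in> carrier S" "a \<in> carrier A"
  shows "lift R (nest R P \<phi>) (prefix a x) = \<phi> a \<otimes>\<^bsub>R\<^esub> P (lift R (nest R P \<phi>) x)"
proof -
  have P0: "P \<zero>\<^bsub>R\<^esub> = \<zero>\<^bsub>R\<^esub>" using PD(4)[of "\<zero>\<^bsub>K\<^esub>" "\<zero>\<^bsub>R\<^esub>"] PD(2)[of "\<zero>\<^bsub>R\<^esub>"] by simp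
  show ?thesis
    using assms(1)
  proof (induction x rule: Sha_induct)
    case (add c w x)
    then have "nest R P \<phi> (a # w) = \<phi> a \<otimes>\<^bsub>R\<^esub> P (nest R P \<phi> w)" by (auto simp: nest_Cons)
    moreover have "\<phi> a \<otimes>\<^bsub>R\<^esub> (c \<odot>\<^bsub>R\<^esub> P (nest R P \<phi> w)) = c \<odot>\<^bsub>R\<^esub> (\<phi> a \<otimes>\<^bsub>R\<^esub> P (nest R P \<phi> w))"
      using add R.smult_assoc2[of c "P (nest R P \<phi> w)" "\<phi> a"] assms
      by (simp add: R.m_comm phiD PD nest_closed)
    ultimately show ?case
      using add assms by (simp add: lift_nest prefix_props R.r_distr PD phiD nest_closed)
  qed (use assms in \<open>simp add: prefix_props lift_nest P0 phiD\<close>)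
qed

text \<open>Induction along the recursion for the product: its three summands are sent to the
arguments of \<open>P\<close> in the three terms of the Rota-Baxter identity of \<open>R\<close>.\<close>

lemma lift_nest_shuffle:
  "\<lbrakk>u \<in> words A; v \<in> words A\<rbrakk> \<Longrightarrow> lift R (nest R P \<phi>) (shuffle u v) = nest R P \<phi> u \<otimes>\<^bsub>R\<^esub> nest R P \<phi> v"
proof (induction "length u + length v" arbitrary: u v rule: less_induct)
  case less
  let ?g = "nest R P \<phi>"
  obtain a u' b v' where uv: "u = a # u'" "v = b # v'"
    using less.prems by (cases u; cases v) auto
  have ab: "a \<in> carrier A" "b \<in> carrier A" using less.prems uv by auto
  consider "u' = []" | "v' = []" | "u' \<in> words A" "v' \<in> words A"
    using less.prems uv by auto
  then show ?case
  proof cases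
    case 1
    then show ?thesis using less.prems ab
      by (auto simp: uv shuffle_single_left lift_nest nest_Cons phiD R.m_assoc nest_closed PD)
  next
    case 2
    then show ?thesis using less.prems ab
      by (auto simp: uv shuffle_single_right lift_nest nest_Cons phiD R.m_ac nest_closed PD)
  next
    case 3
    then have ne: "u' \<noteq> []" "v' \<noteq> []" by auto
    note g = nest_closed[OF 3(1)] nest_closed[OF 3(2)]
    have IH: "lift R ?g (shuffle u' (one_A # v')) = ?g u' \<otimes>\<^bsub>R\<^esub> P (?g v')"
      "lift R ?g (shuffle (one_A # u') v') = P (?g u') \<otimes>\<^bsub>R\<^esub> ?g v'"
      "lift R ?g (shuffle u' v') = ?g u' \<otimes>\<^bsub>R\<^esub> ?g v'"
      using 3 ne uv g less.hyps[of u' "one_A # v'"] less.hyps[of "one_A # u'" v']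
        less.hyps[of u' v']
      by (simp_all add: nest_Cons phiD PD)
    have "lift R ?g (shuffle u v) = (\<phi> a \<otimes>\<^bsub>R\<^esub> \<phi> b) \<otimes>\<^bsub>R\<^esub> (P (?g u') \<otimes>\<^bsub>R\<^esub> P (?g v'))"
      using 3 ab g lam PD(5)[OF g]
      by (simp add: uv shuffle_Cons lift_nest_prefix lift_nest IH PD phiD
          R.m_comm[of "P (?g u')" "?g v'"])
    also have "\<dots> = ?g u \<otimes>\<^bsub>R\<^esub> ?g v"
      using ne ab g by (simp add: uv nest_Cons R.m_ac PD(2) phiD)
    finally show ?thesis .
  qed
qed

lemma lift_nest_mult:
  assumes "x \<in> carrier S" "y \<in> carrier S"
  shows "lift R (nest R P \<phi>) (x \<otimes>\<^bsub>S\<^esub> y) = lift R (nest R P \<phi>) x \<otimes>\<^bsub>R\<^esub> lift R (nest R P \<phi>) y"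
proof -
  have smult_right: "a \<otimes>\<^bsub>R\<^esub> (r \<odot>\<^bsub>R\<^esub> x) = r \<odot>\<^bsub>R\<^esub> (a \<otimes>\<^bsub>R\<^esub> x)"
    if "r \<in> carrier K" "x \<in> carrier R" "a \<in> carrier R" for r x a
    using that R.smult_assoc2[of r x a] by (simp add: R.m_comm)
  have 1: "lift R (nest R P \<phi>) (tensor u \<otimes>\<^bsub>S\<^esub> y) = nest R P \<phi> u \<otimes>\<^bsub>R\<^esub> lift R (nest R P \<phi>) y"
    if "u \<in> words A" for u
    using assms(2) that
    by (induction y rule: Sha_induct)
      (simp_all add: mult_right lift_nest nest_closed mult_tensor lift_nest_shuffle R.r_distr
        smult_right)
  show ?thesis
    using assms(1) assms(2)
    by (induction x rule: Sha_induct)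
      (simp_all add: mult_left lift_nest nest_closed 1 R.l_distr R.smult_assoc2)
qed

lemma lift_nest_hom: "lift R (nest R P \<phi>) \<in> rota_baxter_hom K lam S (Sha_P K A) R P"
  unfolding rota_baxter_hom_def
proof (intro CollectI conjI R rota_baxter_Sha ballI)
  show "lift R (nest R P \<phi>) \<in> alg_hom K S R"
    by (rule alg_homI) (auto simp: lift_nest lift_nest_mult one_eq_tensor nest_Cons phiD)
  show "lift R (nest R P \<phi>) (Sha_P K A x) = P (lift R (nest R P \<phi>) x)" if "x \<in> carrier S" for x
    using that by (simp add: Sha_P_prefix lift_nest_prefix phiD lift_nest PD)
qed

text \<open>Since \<open>a \<otimes> w = a P(w)\<close>, the elements of \<open>A\<close> generate all pure tensors under products and
the operator.\<close>

lemma rota_baxter_hom_unique: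
  assumes f: "f \<in> rota_baxter_hom K lam S (Sha_P K A) R P"
    and single: "\<And>a. a \<in> carrier A \<Longrightarrow> f (tensor [a]) = \<phi> a"
    and "x \<in> carrier S"
  shows "f x = lift R (nest R P \<phi>) x"
proof -
  have fh: "f \<in> alg_hom K S R" and fP: "\<And>x. x \<in> carrier S \<Longrightarrow> f (Sha_P K A x) = P (f x)"
    using f by (auto simp: rota_baxter_hom_def)
  note fD = alg_homD[OF fh]
  have word: "f (tensor w) = nest R P \<phi> w" if "w \<in> words A" for w
    using that
  proof (induction w)
    case (Cons a w)
    show ?case
    proof (cases "w = []")
      case False
      with Cons have "w \<in> words A" "a \<in> carrier A" by auto
      with Cons False show ?thesis
        by (simp add: tensor_Cons_mult fD fP single nest_Cons rota_baxterD(2)[OF rota_baxter_Sha])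
    qed (use Cons single in \<open>simp add: nest_Cons\<close>)
  qed simp
  show ?thesis
    using assms(3)
    by (induction x rule: Sha_induct)
      (simp_all add: fD word lift_nest alg_hom_zero[OF fh algebra_Sha PD(1)])
qed

end

end

section \<open>The distributive law between shuffle algebras and sequences\<close>

context base_ring
begin

lemma shuffle_algI: "algebra K A \<Longrightarrow> shuffle_alg K A lam"
  using weighted by (simp add: shuffle_alg_def)

lemmas Sha_algebra = shuffle_alg.algebra_Sha[OF shuffle_algI]
  and Sha_rota_baxter = shuffle_alg.rota_baxter_Sha[OF shuffle_algI]

lemma unit_hom:
  assumes "algebra K A"
  shows "Sha_unit K lam A \<in> Homs (ALG K) A (Sha K lam A)"
proof -
  interpret A: shuffle_alg K A lam by (rule shuffle_algI[OF assms])
  note tD = multilinearD(2,3)[OF A.multilinear_tensor, where u = "[]" and v = "[]"]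
  have "(\<lambda>a. A.tensor [a]) \<in> alg_hom K A (Sha K lam A)"
    by (rule alg_homI) (use tD in \<open>auto simp: A.mult_single_single A.one_eq_tensor\<close>)
  from Homs_ALG_restrict[OF assms A.algebra_Sha this] show ?thesis
    by (simp add: Sha_unit_def A.tensor_def)
qed

lemma fn_unit: "algebra K A \<Longrightarrow> a \<in> carrier A \<Longrightarrow> fn (Sha_unit K lam A) a = cls K A [(\<one>\<^bsub>K\<^esub>, [a])]"
  by (simp add: Sha_unit_def)

text \<open>The extension of \<open>f\<close> to \<open>Sha(A)\<close>, written out in the form in which the multiplication of
the monad is defined.\<close>

definition ext_arrow :: "('k, 'a) alg \<Rightarrow> ('k, 'a) alg \<Rightarrow> (('k, 'a) univ \<Rightarrow> ('k, 'a) univ) \<Rightarrow>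
    ('k, 'a) alg_arr \<Rightarrow> ('k, 'a) alg_arr" where
  "ext_arrow A B Q f = (Sha K lam A,
     (\<lambda>x\<in>carrier (Sha K lam A). linear_ext B (\<lambda>w. nested_P B Q (map (fn f) w)) (un_Ten x)), B)"

lemma ext_arrow:
  assumes f: "f \<in> Homs (ALG K) A B" and Q: "rota_baxter K lam B Q"
  shows "ext_arrow A B Q f \<in> Homs (ALG K) (Sha K lam A) B"
    and "rb_arrow (ext_arrow A B Q f) (Sha_P K A) Q"
    and "Cmp (ALG K) (ext_arrow A B Q f) (Sha_unit K lam A) = f"
    and "\<lbrakk>g \<in> Homs (ALG K) (Sha K lam A) B; rb_arrow g (Sha_P K A) Q;
      Cmp (ALG K) g (Sha_unit K lam A) = f\<rbrakk> \<Longrightarrow> g = ext_arrow A B Q f"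
proof -
  interpret category "ALG K" by (rule category_ALG)
  note fH = Homs_ALG_D[OF f]
  interpret A: shuffle_alg K A lam by (rule shuffle_algI[OF fH(1)])
  let ?e = "A.lift B (A.nest B Q (fn f))"
  have e: "?e \<in> rota_baxter_hom K lam (Sha K lam A) (Sha_P K A) B Q"
    by (rule A.lift_nest_hom[OF Q fH(3)])
  then have eh: "?e \<in> alg_hom K (Sha K lam A) B" by (auto simp: rota_baxter_hom_def)
  have E: "ext_arrow A B Q f = (Sha K lam A, restrict ?e (carrier (Sha K lam A)), B)"
    by (auto simp: ext_arrow_def A.lift_def A.nest_def[abs_def] intro!: restrict_ext)
  show hom: "ext_arrow A B Q f \<in> Homs (ALG K) (Sha K lam A) B"
    unfolding E by (rule Homs_ALG_restrict[OF A.algebra_Sha fH(2) eh])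
  have fnE: "fn (ext_arrow A B Q f) x = ?e x" if "x \<in> carrier (Sha K lam A)" for x
    using that by (simp add: E)
  show "rb_arrow (ext_arrow A B Q f) (Sha_P K A) Q"
    using Q e A.rota_baxter_Sha
    by (auto simp: rb_arrow_iff[OF hom] fnE rota_baxterD(2)[OF A.rota_baxter_Sha]
        rota_baxter_hom_def)
  note u = unit_hom[OF fH(1)]
  have tensor: "fn (Sha_unit K lam A) a = A.tensor [a]" if "a \<in> carrier A" for a
    using fn_unit[OF fH(1) that] by (simp add: A.tensor_def)
  show "Cmp (ALG K) (ext_arrow A B Q f) (Sha_unit K lam A) = f"
  proof (rule ALG_eqI[OF cmp[OF u hom] f])
    fix a assume a: "a \<in> carrier A"
    have "?e (A.tensor [a]) = fn f a"
      using A.lift_nest(5)[OF Q fH(3), of "[a]"] a by (simp add: A.nest_Cons)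
    then show "fn (Cmp (ALG K) (ext_arrow A B Q f) (Sha_unit K lam A)) a = fn f a"
      using a by (simp add: fn_comp[OF u] tensor fnE)
  qed
  assume g: "g \<in> Homs (ALG K) (Sha K lam A) B" and rb: "rb_arrow g (Sha_P K A) Q"
    and comp: "Cmp (ALG K) g (Sha_unit K lam A) = f"
  show "g = ext_arrow A B Q f"
  proof (rule ALG_eqI[OF g hom])
    fix x assume x: "x \<in> carrier (Sha K lam A)"
    have "fn g x = ?e x"
    proof (rule A.rota_baxter_hom_unique[OF Q fH(3) _ _ x])
      show "fn g \<in> rota_baxter_hom K lam (Sha K lam A) (Sha_P K A) B Q"
        using rb Homs_ALG_D[OF g] by (simp add: rb_arrow_def)
      show "fn g (A.tensor [a]) = fn f a" if "a \<in> carrier A" for a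
        using fn_comp[OF u that, of g] that by (simp add: comp tensor)
    qed
    then show "fn g x = fn (ext_arrow A B Q f) x" using x by (simp add: fnE)
  qed
qed

lemma linear_ext_cong:
  assumes "xs \<in> formal_sums K A" "\<And>w. w \<in> words A \<Longrightarrow> g w = h w"
  shows "linear_ext M g xs = linear_ext M h xs"
  using assms(1) by (induction xs rule: formal_sums_induct) (simp_all add: assms(2))

text \<open>With the next lemma, this identifies the concretely defined monad structure with the one
that the universal property induces.\<close>

lemma Sha_mu_eq:
  assumes "algebra K A"
  shows "Sha_mu K lam A
    = ext_arrow (Sha K lam A) (Sha K lam A) (Sha_P K A) (Ident (ALG K) (Sha K lam A))"
proof -
  note S = Sha_algebra[OF assms]
  interpret S: shuffle_alg K "Sha K lam A" lam by (rule shuffle_algI[OF S])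
  have "map (fn (Ident (ALG K) (Sha K lam A))) w = w" if "w \<in> words (Sha K lam A)" for w
    using words_lists[OF that] by (intro map_idI) (auto simp: Ident_ALG)
  then show ?thesis
    by (auto simp: Sha_mu_def ext_arrow_def intro!: restrict_ext
        linear_ext_cong[OF S.un_Ten_closed])
qed

lemma Sha_map_eq:
  assumes f: "f \<in> Homs (ALG K) A B"
  shows "Sha_map K lam f
    = ext_arrow A (Sha K lam B) (Sha_P K B) (Cmp (ALG K) (Sha_unit K lam B) f)"
proof -
  note fH = Homs_ALG_D[OF f]
  interpret A: shuffle_alg K A lam by (rule shuffle_algI[OF fH(1)])
  interpret B: shuffle_alg K B lam by (rule shuffle_algI[OF fH(2)])
  let ?u = "Cmp (ALG K) (Sha_unit K lam B) f"
  have u: "fn ?u a = B.tensor [fn f a]" if "a \<in> carrier A" for a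
    using that alg_homD(1)[OF fH(3) that]
    by (simp add: fn_comp[OF f] fn_unit[OF fH(2)] B.tensor_def)
  have words: "map (fn f) w \<in> words B" if "w \<in> words A" for w
    using that alg_homD(1)[OF fH(3)] by (auto simp: words_def)
  have word: "nested_P (Sha K lam B) (Sha_P K B) (map (fn ?u) w) = B.tensor (map (fn f) w)"
    if "w \<in> words A" for w
    using that
  proof (induction w)
    case (Cons a w)
    show ?case
    proof (cases "w = []")
      case False
      with Cons words[of w] alg_homD(1)[OF fH(3)] show ?thesis
        by (simp add: B.nested_P_Cons u B.tensor_Cons_mult[of "fn f a" "map (fn f) w"]
            del: B.prefix_simps(2))
    qed (use Cons u in simp)
  qed simp
  have sums: "map (\<lambda>(c, w). (c, map (fn f) w)) xs \<in> formal_sums K B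
    \<and> linear_ext (Sha K lam B) B.tensor (map (\<lambda>(c, w). (c, map (fn f) w)) xs)
        = linear_ext (Sha K lam B) (\<lambda>w. nested_P (Sha K lam B) (Sha_P K B) (map (fn ?u) w)) xs"
    if "xs \<in> formal_sums K A" for xs
    using that by (induction xs rule: formal_sums_induct) (simp_all add: words word)
  obtain f0 where f0: "f = (A, f0, B)" using f by (auto simp: Homs_ALG)
  show ?thesis
    using sums[OF A.un_Ten_closed]
    by (auto simp: Sha_map_def ext_arrow_def f0 B.cls_linear_ext intro!: restrict_ext)
qed

lemma ex1_ext_arrow:
  assumes "f \<in> Homs (ALG K) A B" "rota_baxter K lam B Q"
  shows "\<exists>!g. g \<in> Homs (ALG K) (Sha K lam A) B \<and> rb_arrow g (Sha_P K A) Q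
    \<and> Cmp (ALG K) g (Sha_unit K lam A) = f"
  using ext_arrow[OF assms] by blast

lemma beta_arrow:
  assumes A: "algebra K A"
  shows "beta K lam A \<in> Homs (ALG K) (Sha K lam (Seqs K lam A)) (Seqs K lam (Sha K lam A))
    \<and> rb_arrow (beta K lam A) (Sha_P K (Seqs K lam A)) (Seqs_P (Sha_P K A))
    \<and> Cmp (ALG K) (beta K lam A) (Sha_unit K lam (Seqs K lam A))
      = Seqs_map K lam (Sha_unit K lam A)"
    (is "?P (beta K lam A)")
proof -
  have "beta K lam A = (THE b. ?P b)"
    unfolding beta_def rb_arrow_def
    by (rule arg_cong[where f = The]) (auto simp: fun_eq_iff Homs_ALG)
  moreover have "?P (THE b. ?P b)"
    by (rule theI'[OF ex1_ext_arrow[OF Seqs_map_hom[OF unit_hom[OF A]]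
          rota_baxter_Seqs[OF Sha_rota_baxter[OF A]]]])
  ultimately show ?thesis by simp
qed

theorem mixed_distributive_law_beta:
  "mixed_distributive_law (ALG K) (Sha_monad K lam) (Seqs_comonad K lam) (beta K lam)"
proof -
  interpret category "ALG K" by (rule category_ALG)
  let ?T = "Sha_monad K lam :: (('k, 'a) alg, ('k, 'a) alg_arr) mnd"
  let ?C = "Seqs_comonad K lam :: (('k, 'a) alg, ('k, 'a) alg_arr) cmnd"
  have TC: "FO (MF ?T) = Sha K lam" "FA (MF ?T) = Sha_map K lam" "unit ?T = Sha_unit K lam"
    "mu ?T = Sha_mu K lam" "FO (CF ?C) = Seqs K lam" "FA (CF ?C) = Seqs_map K lam"
    "counit ?C = Seqs_counit K lam" "delta ?C = Seqs_delta K lam"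
    by (simp_all add: Sha_monad_def Seqs_comonad_def)
  interpret free_structures "ALG K" "rota_baxter K lam" rb_arrow ?T "Sha_P K"
  proof (unfold_locales, unfold TC)
    fix f :: "('k, 'a) alg_arr" and A B assume f: "f \<in> Homs (ALG K) A B"
    note B = Homs_ALG_D(2)[OF f]
    note ext = ext_arrow[OF cmp[OF f unit_hom[OF B]] Sha_rota_baxter[OF B]]
    show "Sha_map K lam f \<in> Homs (ALG K) (Sha K lam A) (Sha K lam B)
      \<and> rb_arrow (Sha_map K lam f) (Sha_P K A) (Sha_P K B)
      \<and> Cmp (ALG K) (Sha_map K lam f) (Sha_unit K lam A) = Cmp (ALG K) (Sha_unit K lam B) f"
      unfolding Sha_map_eq[OF f] using ext(1-3) by blast
  next
    fix A :: "('k, 'a) alg" assume "A \<in> Obj (ALG K)"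
    then have A: "algebra K A" by simp
    have S: "Sha K lam A \<in> Obj (ALG K)" using Sha_algebra[OF A] by simp
    note ext = ext_arrow[OF ident[OF S] Sha_rota_baxter[OF A]]
    show "Sha_mu K lam A \<in> Homs (ALG K) (Sha K lam (Sha K lam A)) (Sha K lam A)
      \<and> rb_arrow (Sha_mu K lam A) (Sha_P K (Sha K lam A)) (Sha_P K A)
      \<and> Cmp (ALG K) (Sha_mu K lam A) (Sha_unit K lam (Sha K lam A)) = Ident (ALG K) (Sha K lam A)"
      unfolding Sha_mu_eq[OF A] using ext(1-3) by blast
  next
    fix f :: "('k, 'a) alg_arr" and A B Q
    assume "f \<in> Homs (ALG K) A B" "rota_baxter K lam B Q"
    then show "\<exists>!g. g \<in> Homs (ALG K) (Sha K lam A) B \<and> rb_arrow g (Sha_P K A) Q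
        \<and> Cmp (ALG K) g (Sha_unit K lam A) = f"
      by (rule ex1_ext_arrow)
  qed (auto intro: rb_arrow_ident rb_arrow_comp Sha_algebra Sha_rota_baxter unit_hom)
  interpret lifted_comonad "ALG K" "rota_baxter K lam" rb_arrow ?T "Sha_P K" ?C Seqs_P "beta K lam"
  proof (unfold_locales, unfold TC)
    fix A :: "('k, 'a) alg" assume "A \<in> Obj (ALG K)"
    then have A: "algebra K A" by simp
    then show "beta K lam A \<in> Homs (ALG K) (Sha K lam (Seqs K lam A)) (Seqs K lam (Sha K lam A))
      \<and> rb_arrow (beta K lam A) (Sha_P K (Seqs K lam A)) (Seqs_P (Sha_P K A))
      \<and> Cmp (ALG K) (beta K lam A) (Sha_unit K lam (Seqs K lam A))
        = Seqs_map K lam (Sha_unit K lam A)"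
      by (rule beta_arrow)
  qed (auto intro: comonad_Seqs rota_baxter_Seqs rb_arrow_Seqs_map rb_arrow_counit rb_arrow_delta)
  show ?thesis by (rule mixed_distributive_law)
qed

end

theorem corollary4p5:
  fixes K :: "('k, 'z) ring_scheme" and lam :: 'k
    and X :: "(('k, 'a) alg, ('k, 'a) alg_arr) cat"
    and T :: "(('k, 'a) alg, ('k, 'a) alg_arr) mnd"
    and C :: "(('k, 'a) alg, ('k, 'a) alg_arr) cmnd"
    and \<beta> :: "('k, 'a) alg \<Rightarrow> ('k, 'a) alg_arr"
  assumes "cring K" and "lam \<in> carrier K"
    and "X = ALG K" and "T = Sha_monad K lam" and "C = Seqs_comonad K lam" and "\<beta> = beta K lam"
  shows
    "mixed_distributive_law X T C \<beta>
     \<and> (comonad (algebras X T) (lift_comonad X C \<beta>)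
        \<and> is_functor (algebras X T) X underlying
        \<and> functor_eq (algebras X T)
            (underlying \<circ>\<^sub>F CF (lift_comonad X C \<beta>)) (CF C \<circ>\<^sub>F underlying)
        \<and> trans_eq (algebras X T)
            (whisker_left underlying (counit (lift_comonad X C \<beta>)))
            (whisker_right (counit C) underlying)
        \<and> trans_eq (algebras X T)
            (whisker_left underlying (delta (lift_comonad X C \<beta>)))
            (whisker_right (delta C) underlying))
     \<and> (monad (coalgebras X C) (lift_monad X T \<beta>)
        \<and> is_functor (coalgebras X C) X underlying
        \<and> functor_eq (coalgebras X C)
            (underlying \<circ>\<^sub>F MF (lift_monad X T \<beta>)) (MF T \<circ>\<^sub>F underlying)
        \<and> trans_eq (coalgebras X C)
            (whisker_left underlying (unit (lift_monad X T \<beta>)))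
            (whisker_right (unit T) underlying)
        \<and> trans_eq (coalgebras X C)
            (whisker_left underlying (mu (lift_monad X T \<beta>)))
            (whisker_right (mu T) underlying))
     \<and> (\<exists>\<Phi>. iso_functor
          (algebras (coalgebras X C) (lift_monad X T \<beta>))
          (coalgebras (algebras X T) (lift_comonad X C \<beta>)) \<Phi>)"
proof -
  interpret base_ring K lam using assms by (simp add: base_ring_def base_ring_axioms_def)
  have law: "mixed_distributive_law X T C \<beta>"
    using mixed_distributive_law_beta by (simp add: assms)
  interpret mixed_law X T C \<beta> using law by (rule mixed_law.intro)
  show ?thesis
    using law comonad_C' monad_T' functor_underlying_algebras[OF functor_T]
      functor_underlying_coalgebras[OF functor_C] lifts_comonad lifts_monad iso_algebras_coalgebras
    by blast
qed

end
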